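(* For any Liouville number $\alpha$, there exist a $C^\infty$ diffeomorphism $f$ of $\mathbb{R}_+=[0,\infty)$ whose only fixed point is the origin and a Cantor set $K\subset\mathbb{R}$ with $\alpha\in K$ such that, for all $2\le r\le\infty$, the $C^r$ centralizer $\mathcal{Z}^r_f$ of $f$ is a proper subgroup of $\mathcal{Z}^1_f\cong\mathbb{R}$ and contains $K$ (under the identification $\mathcal{Z}^1_f\cong\mathbb{R}$).
   Context: Liouville number: an irrational number $\alpha$ satisfying no diophantine condition, where $\alpha$ satisfies a diophantine condition if there exist constants $c>0$ and $\gamma\ge 0$ such that $|\alpha-p/q|\ge c\,q^{-2-\gamma}$ for every rational number $p/q$ with $q\ge 1$. For $1\le r\le\infty$, let $\mathcal{D}^r$ be the group of $C^r$ diffeomorphisms of $\mathbb{R}_+=[0,\infty)$ (regularity up to and including $0$). For a $C^\infty$ diffeomorphism $f$ of $\mathbb{R}_+$, the $C^r$ centralizer $\mathcal{Z}^r_f$ is the subgroup of all elements of $\mathcal{D}^r$ commuting with $f$. If $f$ fixes only the origin, then by well-known theorems of Szekeres and Kopell there is a unique $C^1$ vector field $\nu_f$ on $\mathbb{R}_+$ (the Szekeres vector field of $f$) whose time-$1$ map is $f$, and $\mathcal{Z}^1_f$ is exactly the flow $\{f^t,\ t\in\mathbb{R}\}$ of $\nu_f$. The identification $\mathcal{Z}^1_f\cong\mathbb{R}$ is $f^t\leftrightarrow t$, so that $f\leftrightarrow 1$; each $\mathcal{Z}^r_f\subset\mathcal{Z}^1_f$ is viewed as a subgroup of $\mathbb{R}$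 in this way. *)

theory Defs
  imports "HOL-Analysis.Analysis" "HOL-Algebra.Bij"
begin

definition diophantine :: "real \<Rightarrow> bool" where
  "diophantine \<alpha> \<longleftrightarrow>
     (\<exists>c \<gamma> :: real. c > 0 \<and> \<gamma> \<ge> 0 \<and>
        (\<forall>p q :: int. q \<ge> 1 \<longrightarrow>
           \<bar>\<alpha> - of_int p / of_int q\<bar> \<ge> c * of_int q powr (- 2 - \<gamma>)))"

definition Liouville :: "real \<Rightarrow> bool" where
  "Liouville \<alpha> \<longleftrightarrow> \<alpha> \<notin> \<rat> \<and> \<not> diophantine \<alpha>"

definition cantor_set :: "real set \<Rightarrow> bool" where
  "cantor_set K \<longleftrightarrow>
     K \<noteq> {} \<and> compact K \<and> (\<forall>x\<in>K. x islimpt K) \<and>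
     (\<forall>x\<in>K. connected_component_set K x = {x})"

text \<open>Derivatives are taken within \<open>S\<close>; for \<open>S = {0..}\<close> they are one-sided at \<open>0\<close>, which
  gives regularity up to and including the boundary.\<close>

primrec Cn_on :: "nat \<Rightarrow> (real \<Rightarrow> real) \<Rightarrow> real set \<Rightarrow> bool" where
  "Cn_on 0 g S \<longleftrightarrow> continuous_on S g"
| "Cn_on (Suc n) g S \<longleftrightarrow>
     (\<exists>g'. (\<forall>x\<in>S. (g has_real_derivative g' x) (at x within S)) \<and> Cn_on n g' S)"

definition Cr_on :: "enat \<Rightarrow> (real \<Rightarrow> real) \<Rightarrow> real set \<Rightarrow> bool" where
  "Cr_on r g S \<longleftrightarrow> (\<forall>n. enat n \<le> r \<longrightarrow> Cn_on n g S)"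

text \<open>Self-maps of the half-line are represented by functions that are extensional on
  \<open>{0..}\<close>, as in \<^const>\<open>BijGroup\<close>, so that equality of functions is equality of maps.\<close>

definition Diff :: "enat \<Rightarrow> (real \<Rightarrow> real) set" where
  "Diff r = {g \<in> Bij {0..}. Cr_on r g {0..} \<and> Cr_on r (inv_into {0..} g) {0..}}"

definition centralizer :: "enat \<Rightarrow> (real \<Rightarrow> real) \<Rightarrow> (real \<Rightarrow> real) set" where
  "centralizer r f = {g \<in> Diff r. compose {0..} g f = compose {0..} f g}"

definition centralizer_group :: "enat \<Rightarrow> (real \<Rightarrow> real) \<Rightarrow> (real \<Rightarrow> real) monoid" where
  "centralizer_group r f = BijGroup {0..} \<lparr>carrier := centralizer r f\<rparr>"

definition real_group :: "real monoid" where
  "real_group = \<lparr>carrier = UNIV, monoid.mult = (+), one = (0::real)\<rparr>"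

text \<open>The function \<open>\<nu>\<close> stands for the vector field \<open>\<nu>(x) d/dx\<close> on the half-line, and
  \<open>\<phi> t\<close> for its time-\<open>t\<close> map, defined for all real \<open>t\<close>.\<close>

definition is_flow :: "(real \<Rightarrow> real) \<Rightarrow> (real \<Rightarrow> real \<Rightarrow> real) \<Rightarrow> bool" where
  "is_flow \<nu> \<phi> \<longleftrightarrow>
     (\<forall>t. \<phi> t \<in> extensional {0..}) \<and>
     (\<forall>x\<ge>0. \<phi> 0 x = x \<and>
        (\<forall>t. \<phi> t x \<ge> 0 \<and> ((\<lambda>s. \<phi> s x) has_real_derivative \<nu> (\<phi> t x)) (at t)))"

text \<open>Existence and uniqueness of the field, for a smooth \<open>f\<close> fixing only the origin, are the
  theorems of Szekeres and Kopell. The flow of a \<open>C\<^sup>1\<close> field is unique by Picard-Lindeloef.\<close>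

definition szekeres_field :: "(real \<Rightarrow> real) \<Rightarrow> real \<Rightarrow> real" where
  "szekeres_field f =
     (THE \<nu>. \<nu> \<in> extensional {0..} \<and> Cr_on 1 \<nu> {0..} \<and> (\<exists>\<phi>. is_flow \<nu> \<phi> \<and> \<phi> 1 = f))"

definition szekeres_flow :: "(real \<Rightarrow> real) \<Rightarrow> real \<Rightarrow> real \<Rightarrow> real" where
  "szekeres_flow f = (THE \<phi>. is_flow (szekeres_field f) \<phi>)"

text \<open>The \<open>C\<^sup>r\<close> centralizer as a subset of the real line, an element \<open>f\<^sup>t\<close> of the flow
  corresponding to its time \<open>t\<close>.\<close>

definition centralizer_times :: "enat \<Rightarrow> (real \<Rightarrow> real) \<Rightarrow> real set" where
  "centralizer_times r f = {t. szekeres_flow f t \<in> centralizer r f}"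

end

theory Submission
  imports Defs
begin

text \<open>In a time coordinate \<open>s\<close>, with \<open>x = \<psi> s\<close>, a flow on the half-line is the translation
  \<open>s \<mapsto> s + t\<close>. Let \<open>\<psi>\<^sub>0\<close> be the time coordinate of a smooth field, flat at \<open>0\<close>, which is a tiny
  constant \<open>\<lambda>\<^sub>n\<close> near \<open>x = 1/n\<close> and \<open>exp (- 1/x)\<close> away from these points, and put
  \<open>\<psi> s = \<psi>\<^sub>0 (s + P s)\<close>, where \<open>P s = \<epsilon>\<^sub>n sin (2 \<pi> q\<^sub>n s)\<close> for \<open>x\<close> near \<open>1/n\<close> and \<open>p\<^sub>n / q\<^sub>n\<close> are very
  good approximations of \<open>\<alpha>\<close>. If \<open>\<Phi>\<^sub>0\<close> is the flow of the smooth field, the new time-\<open>t\<close> map is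
  \<open>x \<mapsto> \<Phi>\<^sub>0 (t + P (s + t) - P s, x)\<close>, so it is smooth as soon as \<open>P (s + t) - P s\<close> is a flat function
  of \<open>x\<close>. This holds if all \<open>q\<^sub>n t\<close> are very close to integers: for \<open>t = 1\<close>, for \<open>t = \<alpha>\<close>, and for \<open>\<alpha>\<close> plus
  sums of distinct \<open>q\<^sub>n \<alpha> - p\<^sub>n\<close>; the closure of the set of finite sums is a Cantor set. If on
  the contrary infinitely many \<open>q\<^sub>n t\<close> are close to half-integers, the second derivative of the
  time-\<open>t\<close> map has no limit at \<open>0\<close>; since \<open>p\<^sub>n\<close> and \<open>q\<^sub>n\<close> are coprime, this happens for \<open>t = 1/2\<close> or for
  \<open>t = \<alpha>/2\<close>. Also, \<open>\<psi>'' / \<psi>'\<close> tends to \<open>0\<close> at the origin, which yields the theorems of Szekeres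
  and Kopell for this flow.\<close>

section \<open>Functions with continuous derivatives\<close>

text \<open>Three scales must fit together in the \<open>n\<close>-th core. All derivatives of
  \<open>P\<close> have to tend to 0, so its amplitude decays faster than every power of
  \<open>1 / q n\<close>. To be visible in second derivatives, the perturbation needs a speed
  \<open>\<lambda>\<^sub>n\<close> comparable to its amplitude times \<open>(q n)\<^sup>2\<close>,
  which is then super-polynomially small as well. A derivative in time costs a factor
  \<open>q n\<close>, but a derivative in \<open>x\<close> costs a factor
  \<open>1 / \<lambda>\<^sub>n\<close>; the distance of \<open>q n * t\<close> to the integers must
  therefore be small against every power of \<open>\<lambda>\<^sub>n\<close>. With
  \<open>\<lambda>\<^sub>n = 1 / (q n) ^ (n + 1)\<close>, a distance of
  \<open>1 / (q n) ^ (n + 1)\<^sup>2\<close> is enough. No fixed exponent of approximation gives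
  this, and here the Liouville property enters. The same \<open>f\<close> and the same Cantor set
  serve every \<open>r\<close>, because the good times give maps that are smooth to all orders,
  whereas the bad times already fail at order 2.\<close>

lemma Cn_on_cont: "Cn_on n f S \<Longrightarrow> continuous_on S f"
  by (cases n) (auto intro: DERIV_continuous_on)

lemma Cn_on_SucI:
  "(\<And>x. x \<in> S \<Longrightarrow> (f has_real_derivative f' x) (at x within S)) \<Longrightarrow> Cn_on n f' S \<Longrightarrow>
   Cn_on (Suc n) f S"
  by auto

lemma Cn_on_SucD: "Cn_on (Suc n) f S \<Longrightarrow> Cn_on n f S"
proof (induction n arbitrary: f)
  case 0
  then show ?case by (auto intro: DERIV_continuous_on)
next
  case (Suc n)
  then show ?case by (metis Cn_on.simps(2))
qed

lemma Cn_on_mono: "Cn_on n f S \<Longrightarrow> m \<le> n \<Longrightarrow> Cn_on m f S"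
proof (induction n)
  case (Suc n)
  then show ?case using Cn_on_SucD le_Suc_eq by blast
qed simp

lemma Cn_on_subset: "Cn_on n f S \<Longrightarrow> T \<subseteq> S \<Longrightarrow> Cn_on n f T"
proof (induction n arbitrary: f)
  case 0
  then show ?case by (auto intro: continuous_on_subset)
next
  case (Suc n)
  then obtain f' where "\<forall>x\<in>S. (f has_real_derivative f' x) (at x within S)" "Cn_on n f' S"
    by auto
  with Suc show ?case
    by (auto intro!: exI[of _ f'] intro: DERIV_subset)
qed

lemma has_real_derivative_cong_on:
  assumes "\<And>y. y \<in> S \<Longrightarrow> f y = g y" "x \<in> S"
  shows "(f has_real_derivative d) (at x within S) \<longleftrightarrow> (g has_real_derivative d) (at x within S)"
  using assms by (intro has_field_derivative_cong_eventually)
    (auto simp: eventually_at_filter)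

lemma Cn_on_cong: "(\<And>x. x \<in> S \<Longrightarrow> f x = g x) \<Longrightarrow> Cn_on n f S \<longleftrightarrow> Cn_on n g S"
proof (cases n)
  case 0
  assume "\<And>x. x \<in> S \<Longrightarrow> f x = g x"
  with 0 show ?thesis by (simp cong: continuous_on_cong)
next
  case (Suc m)
  assume "\<And>x. x \<in> S \<Longrightarrow> f x = g x"
  then show ?thesis using Suc has_real_derivative_cong_on[of S f g] by (simp cong: ball_cong)
qed

lemma Cn_on_coinduct:
  assumes "f \<in> F"
    and "\<And>g. g \<in> F \<Longrightarrow> \<exists>g'\<in>F. \<forall>x\<in>S. (g has_real_derivative g' x) (at x within S)"
  shows "Cn_on n f S"
  using assms(1)
proof (induction n arbitrary: f)
  case 0
  with assms(2) show ?case by (metis Cn_on.simps(1) DERIV_continuous_on)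
next
  case (Suc n)
  with assms(2) show ?case by (metis Cn_on.simps(2))
qed

lemma Cn_on_const: "Cn_on n (\<lambda>_. c) S"
  by (rule Cn_on_coinduct[of _ "{f. \<exists>c. f = (\<lambda>_. c)}"]) (auto intro!: exI[of _ "\<lambda>_. 0"])

lemma Cn_on_ident: "Cn_on n (\<lambda>x. x) S"
  by (cases n) (auto intro!: exI[of _ "\<lambda>_. 1"] Cn_on_const)

lemma Cn_on_add: "Cn_on n f S \<Longrightarrow> Cn_on n g S \<Longrightarrow> Cn_on n (\<lambda>x. f x + g x) S"
proof (induction n arbitrary: f g)
  case 0
  then show ?case by (auto intro: continuous_on_add)
next
  case (Suc n)
  then obtain f' g' where
    "\<forall>x\<in>S. (f has_real_derivative f' x) (at x within S)" "Cn_on n f' S"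
    "\<forall>x\<in>S. (g has_real_derivative g' x) (at x within S)" "Cn_on n g' S"
    by auto
  with Suc.IH show ?case
    by (auto intro!: exI[of _ "\<lambda>x. f' x + g' x"] derivative_eq_intros)
qed

lemma Cn_on_mult: "Cn_on n f S \<Longrightarrow> Cn_on n g S \<Longrightarrow> Cn_on n (\<lambda>x. f x * g x) S"
proof (induction n arbitrary: f g)
  case 0
  then show ?case by (auto intro: continuous_on_mult)
next
  case (Suc n)
  then obtain f' g' where *:
    "\<forall>x\<in>S. (f has_real_derivative f' x) (at x within S)" "Cn_on n f' S"
    "\<forall>x\<in>S. (g has_real_derivative g' x) (at x within S)" "Cn_on n g' S"
    by auto
  have "Cn_on n (\<lambda>x. f' x * g x + f x * g' x) S"
    using * Suc.prems[THEN Cn_on_SucD] by (intro Cn_on_add Suc.IH)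
  with * show ?case
    by (auto intro!: exI[of _ "\<lambda>x. f' x * g x + f x * g' x"] derivative_eq_intros)
qed

lemma Cn_on_diff:
  assumes "Cn_on n f S" "Cn_on n g S"
  shows "Cn_on n (\<lambda>x. f x - g x) S"
  using Cn_on_add[OF assms(1) Cn_on_mult[OF Cn_on_const[of n "- 1"] assms(2)]] by simp

lemma Cn_on_compose:
  "Cn_on n f T \<Longrightarrow> Cn_on n g S \<Longrightarrow> g ` S \<subseteq> T \<Longrightarrow> Cn_on n (\<lambda>x. f (g x)) S"
proof (induction n arbitrary: f g)
  case 0
  then show ?case by (auto intro: continuous_on_compose2)
next
  case (Suc n)
  then obtain f' g' where *:
    "\<forall>x\<in>T. (f has_real_derivative f' x) (at x within T)" "Cn_on n f' T"
    "\<forall>x\<in>S. (g has_real_derivative g' x) (at x within S)" "Cn_on n g' S"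
    by auto
  have "Cn_on n (\<lambda>x. f' (g x) * g' x) S"
    by (rule Cn_on_mult[OF Suc.IH[OF *(2) Cn_on_SucD[OF Suc.prems(2)] Suc.prems(3)] *(4)])
  moreover have "((\<lambda>x. f (g x)) has_real_derivative f' (g x) * g' x) (at x within S)"
    if "x \<in> S" for x
  proof -
    have "(f has_real_derivative f' (g x)) (at (g x) within g ` S)"
      using *(1) Suc.prems(3) that by (meson DERIV_subset image_subset_iff)
    from DERIV_image_chain[OF this] *(3) that show ?thesis by (simp add: o_def)
  qed
  ultimately show ?case by (rule Cn_on_SucI[rotated])
qed

lemma Cn_on_inverse: "Cn_on n inverse {0::real<..}"
proof (induction n)
  case 0
  then show ?case by (auto intro!: continuous_intros)
next
  case (Suc n)
  have "Cn_on n (\<lambda>x. - 1 * (inverse x * inverse x)) {0<..}"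
    by (intro Cn_on_mult Cn_on_const Suc)
  moreover have "(inverse has_real_derivative - 1 * (inverse x * inverse x)) (at x within {0<..})"
    if "x \<in> {0<..}" for x :: real
    using DERIV_inverse[of x "{0<..}"] that by (simp add: power2_eq_square)
  ultimately show ?case by (rule Cn_on_SucI[rotated])
qed

lemma Cn_on_divide:
  assumes "Cn_on n f S" "Cn_on n g S" "\<And>x. x \<in> S \<Longrightarrow> g x > 0"
  shows "Cn_on n (\<lambda>x. f x / g x) S"
  using Cn_on_mult[OF assms(1) Cn_on_compose[OF Cn_on_inverse assms(2)]] assms(3)
  by (auto simp: divide_inverse)

lemma Cn_on_exp: "Cn_on n exp S"
proof (rule Cn_on_coinduct[of _ "{exp}"])
  fix g :: "real \<Rightarrow> real" assume "g \<in> {exp}"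
  then show "\<exists>g'\<in>{exp}. \<forall>x\<in>S. (g has_real_derivative g' x) (at x within S)"
    by (simp add: has_field_derivative_at_within[OF DERIV_exp])
qed simp

lemma at_within_atLeast_nontrivial: "(x::real) \<ge> a \<Longrightarrow> at x within {a..} \<noteq> bot"
proof
  assume "x \<ge> a" "at x within {a..} = bot"
  then have "at_right x \<le> bot" using at_le[of "{x<..}" "{a..}" x] by force
  then show False by (simp add: bot_unique)
qed

text \<open>In \<^const>\<open>Cn_on\<close> the derivative is chosen anew for every order; on the half-line it is
  unique, so one choice serves all orders.\<close>

lemma smooth_half_line_derivative:
  assumes "\<And>n. Cn_on n f {0..}"
  obtains f' where "\<And>x. x \<ge> 0 \<Longrightarrow> (f has_real_derivative f' x) (at x within {0..})"
    "\<And>n. Cn_on n f' {0..}"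
proof -
  from assms[of 1] obtain f' where f': "\<forall>x\<in>{0..}. (f has_real_derivative f' x) (at x within {0..})"
    by auto
  have "Cn_on n f' {0..}" for n
  proof -
    from assms[of "Suc n"] obtain g where
      g: "\<forall>x\<in>{0..}. (f has_real_derivative g x) (at x within {0..})" "Cn_on n g {0..}"
      by auto
    have "f' x = g x" if "x \<in> {0..}" for x
      using f' g(1) that at_within_atLeast_nontrivial[of 0 x]
      by (auto intro: has_field_derivative_unique)
    with g(2) show ?thesis using Cn_on_cong[of "{0..}" f' g] by auto
  qed
  with f' that show ?thesis by auto
qed

text \<open>The mean value theorem turns the difference quotient at \<open>x0\<close> into a value
  of \<open>f'\<close> at an intermediate point. This yields derivatives at the end point 0, and at
  the junction of an extension by zero.\<close>

lemma has_real_derivative_limit: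
  fixes f :: "real \<Rightarrow> real"
  assumes cont: "continuous_on S f" and S: "is_interval S" "x0 \<in> S"
    and der: "\<And>x. x \<in> S \<Longrightarrow> x \<noteq> x0 \<Longrightarrow> DERIV f x :> f' x"
    and lim: "(f' \<longlongrightarrow> l) (at x0 within S)"
  shows "(f has_real_derivative l) (at x0 within S)"
  unfolding has_field_derivative_iff
proof (rule tendstoI)
  fix e :: real assume "e > 0"
  from tendstoD[OF lim this] obtain d where d: "d > 0"
    "\<And>x. x \<in> S \<Longrightarrow> x \<noteq> x0 \<Longrightarrow> dist x x0 < d \<Longrightarrow> dist (f' x) l < e"
    unfolding eventually_at by blast
  have "dist ((f x - f x0) / (x - x0)) l < e" if x: "x \<in> S" "x \<noteq> x0" "dist x x0 < d" for x
  proof -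
    have mvt: "\<exists>z. a < z \<and> z < b \<and> f b - f a = (b - a) * f' z"
      if "a < b" "{a..b} \<subseteq> S" "a = x0 \<or> b = x0" for a b
    proof -
      have dz: "DERIV f z :> f' z" if "a < z" "z < b" for z
        using \<open>{a..b} \<subseteq> S\<close> \<open>a = x0 \<or> b = x0\<close> that by (intro der) auto
      obtain l z where z: "a < z" "z < b" "DERIV f z :> l" "f b - f a = (b - a) * l"
        using MVT[OF \<open>a < b\<close> continuous_on_subset[OF cont \<open>{a..b} \<subseteq> S\<close>]] dz
        by (metis real_differentiable_def)
      then show ?thesis using dz[of z] DERIV_unique by blast
    qed
    have sub: "{a..b} \<subseteq> S" if "a \<in> S" "b \<in> S" for a b
      using S(1) that unfolding is_interval_1 by (meson atLeastAtMost_iff subsetI)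
    have "\<exists>z\<in>S. z \<noteq> x0 \<and> dist z x0 < d \<and> (f x - f x0) / (x - x0) = f' z"
    proof (cases "x0 < x")
      case True
      with mvt[of x0 x] sub[OF S(2) x(1)] obtain z where
        z: "x0 < z" "z < x" "f x - f x0 = (x - x0) * f' z" by auto
      with True x sub[OF S(2) x(1)] show ?thesis
        by (intro bexI[of _ z]) (auto simp: dist_real_def)
    next
      case False
      with x(2) have "x < x0" by simp
      with mvt[of x x0] sub[OF x(1) S(2)] obtain z where
        z: "x < z" "z < x0" "f x0 - f x = (x0 - x) * f' z" by auto
      then have "f x - f x0 = (x - x0) * f' z" by (simp add: algebra_simps)
      with z \<open>x < x0\<close> x sub[OF x(1) S(2)] show ?thesis
        by (intro bexI[of _ z]) (auto simp: dist_real_def)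
    qed
    then show ?thesis using d(2) by auto
  qed
  with d(1) show "\<forall>\<^sub>F x in at x0 within S. dist ((f x - f x0) / (x - x0)) l < e"
    unfolding eventually_at by auto
qed

section \<open>Moderate and negligible functions\<close>

text \<open>Orders of growth are measured against the powers of a weight \<open>v\<close>, which is large along
  the filter \<open>F\<close>: together with their first \<open>n\<close> derivatives, moderate functions are
  \<open>O(v\<^sup>N)\<close> for some \<open>N\<close>, and negligible ones are \<open>o(v\<^sup>-\<^sup>N)\<close> for all \<open>N\<close>.\<close>

primrec moderate :: "real filter \<Rightarrow> (real \<Rightarrow> real) \<Rightarrow> nat \<Rightarrow> (real \<Rightarrow> real) \<Rightarrow> bool" where
  "moderate F v 0 f \<longleftrightarrow> (\<exists>N C. \<forall>\<^sub>F y in F. \<bar>f y\<bar> \<le> C * v y ^ N)"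
| "moderate F v (Suc n) f \<longleftrightarrow> (\<exists>N C. \<forall>\<^sub>F y in F. \<bar>f y\<bar> \<le> C * v y ^ N) \<and>
     (\<exists>f'. (\<forall>y. DERIV f y :> f' y) \<and> moderate F v n f')"

primrec negligible :: "real filter \<Rightarrow> (real \<Rightarrow> real) \<Rightarrow> nat \<Rightarrow> (real \<Rightarrow> real) \<Rightarrow> bool" where
  "negligible F v 0 f \<longleftrightarrow> (\<forall>N. ((\<lambda>y. v y ^ N * f y) \<longlongrightarrow> 0) F)"
| "negligible F v (Suc n) f \<longleftrightarrow> (\<forall>N. ((\<lambda>y. v y ^ N * f y) \<longlongrightarrow> 0) F) \<and>
     (\<exists>f'. (\<forall>y. DERIV f y :> f' y) \<and> negligible F v n f')"

text \<open>With weight 1 the exponent is immaterial: boundedness along \<open>F\<close>, together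
  with that of the first \<open>n\<close> derivatives.\<close>

abbreviation tame :: "real filter \<Rightarrow> nat \<Rightarrow> (real \<Rightarrow> real) \<Rightarrow> bool" where
  "tame F \<equiv> moderate F (\<lambda>_. 1)"

lemma moderate_0I: "moderate F v n f \<Longrightarrow> moderate F v 0 f"
  by (cases n) auto

lemma negligible_0I: "negligible F v n f \<Longrightarrow> negligible F v 0 f"
  by (cases n) auto

lemma moderate_SucD: "moderate F v (Suc n) f \<Longrightarrow> moderate F v n f"
proof (induction n arbitrary: f)
  case (Suc n)
  then show ?case by (metis moderate.simps(2))
qed auto

lemma negligible_SucD: "negligible F v (Suc n) f \<Longrightarrow> negligible F v n f"
proof (induction n arbitrary: f)
  case (Suc n)
  then show ?case by (metis negligible.simps(2))
qed auto

lemma moderate_SucI: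
  "moderate F v 0 f \<Longrightarrow> (\<And>y. DERIV f y :> f' y) \<Longrightarrow> moderate F v n f' \<Longrightarrow>
   moderate F v (Suc n) f"
  by auto

lemma negligible_SucI:
  "negligible F v 0 f \<Longrightarrow> (\<And>y. DERIV f y :> f' y) \<Longrightarrow> negligible F v n f' \<Longrightarrow>
   negligible F v (Suc n) f"
  by auto

lemma tame_0: "tame F 0 f \<longleftrightarrow> (\<exists>C. \<forall>\<^sub>F y in F. \<bar>f y\<bar> \<le> C)"
  by simp

lemma tame_imp_moderate:
  assumes "\<forall>\<^sub>F y in F. v y \<ge> 1"
  shows "tame F n f \<Longrightarrow> moderate F v n f"
proof (induction n arbitrary: f)
  case 0
  then obtain C where "\<forall>\<^sub>F y in F. \<bar>f y\<bar> \<le> C" by auto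
  then have "\<forall>\<^sub>F y in F. \<bar>f y\<bar> \<le> C * v y ^ 0" by simp
  then show ?case unfolding moderate.simps by blast
next
  case (Suc n)
  then obtain f' where f': "\<And>y. DERIV f y :> f' y" "tame F n f'"
    by auto
  have "moderate F v 0 f"
    using Suc.IH[of f] moderate_SucD[OF Suc.prems] moderate_0I by blast
  then show ?case by (rule moderate_SucI[OF _ f'(1) Suc.IH[OF f'(2)]])
qed

lemma moderate_const: "moderate F v n (\<lambda>_. c)"
proof -
  have *: "moderate F v 0 (\<lambda>_. c)" for c
    unfolding moderate.simps by (intro exI[of _ 0] exI[of _ "\<bar>c\<bar>"]) simp
  show ?thesis
  proof (induction n arbitrary: c)
    case (Suc n)
    show ?case by (rule moderate_SucI[OF * DERIV_const Suc])
  qed (rule *)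
qed

abbreviation zext :: "(real \<Rightarrow> real) \<Rightarrow> (real \<Rightarrow> real) \<Rightarrow> real \<Rightarrow> real" where
  "zext T Q \<equiv> \<lambda>x. if x > 0 then Q (T x) else 0"

text \<open>Three weights occur: \<open>y\<close> at infinity, where \<open>y = 1 / x\<close>; the
  constant 1, for plain boundedness; and, at minus infinity, the reciprocal of the speed of the base
  field along an orbit.\<close>

locale growth_weight =
  fixes F :: "real filter" and v :: "real \<Rightarrow> real"
  assumes weight_ge_1: "\<forall>\<^sub>F y in F. v y \<ge> 1"
begin

lemma moderate_0_mono:
  assumes "\<forall>\<^sub>F y in F. \<bar>f y\<bar> \<le> C * v y ^ N"
  shows "\<forall>\<^sub>F y in F. \<bar>f y\<bar> \<le> \<bar>C\<bar> * v y ^ (N + M)"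
  using assms weight_ge_1
proof eventually_elim
  case (elim y)
  have "C * v y ^ N \<le> \<bar>C\<bar> * v y ^ (N + M)"
    using elim by (intro mult_mono power_increasing) auto
  with elim show ?case by linarith
qed

lemma moderate_add: "moderate F v n f \<Longrightarrow> moderate F v n g \<Longrightarrow> moderate F v n (\<lambda>y. f y + g y)"
proof (induction n arbitrary: f g)
  case 0
  then obtain N C M D where
    *: "\<forall>\<^sub>F y in F. \<bar>f y\<bar> \<le> C * v y ^ N" "\<forall>\<^sub>F y in F. \<bar>g y\<bar> \<le> D * v y ^ M"
    by auto
  have "\<forall>\<^sub>F y in F. \<bar>f y + g y\<bar> \<le> (\<bar>C\<bar> + \<bar>D\<bar>) * v y ^ (N + M)"
    using moderate_0_mono[OF *(1), of M] moderate_0_mono[OF *(2), of N]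
  proof eventually_elim
    case (elim y)
    then show ?case by (simp add: distrib_right add.commute)
  qed
  then show ?case by auto
next
  case (Suc n)
  from Suc.prems obtain f' g' where
    *: "\<forall>y. DERIV f y :> f' y" "moderate F v n f'"
    "\<forall>y. DERIV g y :> g' y" "moderate F v n g'"
    by auto
  have "moderate F v 0 (\<lambda>y. f y + g y)"
    using Suc.IH[of f g] Suc.prems moderate_0I moderate_SucD by blast
  moreover have "moderate F v n (\<lambda>y. f' y + g' y)" using * Suc.IH by blast
  ultimately show ?case
    using * by (intro moderate_SucI[of _ _ "\<lambda>y. f y + g y" "\<lambda>y. f' y + g' y"] DERIV_add) auto
qed

lemma moderate_mult: "moderate F v n f \<Longrightarrow> moderate F v n g \<Longrightarrow> moderate F v n (\<lambda>y. f y * g y)"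
proof (induction n arbitrary: f g)
  case 0
  then obtain N C M D where
    *: "\<forall>\<^sub>F y in F. \<bar>f y\<bar> \<le> C * v y ^ N" "\<forall>\<^sub>F y in F. \<bar>g y\<bar> \<le> D * v y ^ M"
    by auto
  have "\<forall>\<^sub>F y in F. \<bar>f y * g y\<bar> \<le> (C * D) * v y ^ (N + M)"
    using *
  proof eventually_elim
    case (elim y)
    then have "\<bar>f y\<bar> * \<bar>g y\<bar> \<le> (C * v y ^ N) * (D * v y ^ M)"
      by (intro mult_mono) auto
    then show ?case by (simp add: abs_mult power_add mult_ac)
  qed
  then show ?case by auto
next
  case (Suc n)
  from Suc.prems obtain f' g' where
    *: "\<forall>y. DERIV f y :> f' y" "moderate F v n f'"
    "\<forall>y. DERIV g y :> g' y" "moderate F v n g'"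
    by auto
  have "moderate F v 0 (\<lambda>y. f y * g y)"
    using Suc.IH[of f g] Suc.prems moderate_0I moderate_SucD by blast
  moreover have "moderate F v n (\<lambda>y. f' y * g y + f y * g' y)"
    using * Suc.prems[THEN moderate_SucD] by (intro moderate_add Suc.IH)
  ultimately show ?case
    using * by (intro moderate_SucI[of _ _ "\<lambda>y. f y * g y" "\<lambda>y. f' y * g y + f y * g' y"] DERIV_mult'[THEN DERIV_cong]) auto
qed

lemma negligible_add: "negligible F v n f \<Longrightarrow> negligible F v n g \<Longrightarrow> negligible F v n (\<lambda>y. f y + g y)"
proof (induction n arbitrary: f g)
  case 0
  then show ?case by (auto simp: distrib_left intro: tendsto_add_zero)
next
  case (Suc n)
  from Suc.prems obtain f' g' where
    *: "\<forall>y. DERIV f y :> f' y" "negligible F v n f'"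
    "\<forall>y. DERIV g y :> g' y" "negligible F v n g'"
    by auto
  have "negligible F v 0 (\<lambda>y. f y + g y)"
    using Suc.IH[of f g] Suc.prems negligible_0I negligible_SucD by blast
  moreover have "negligible F v n (\<lambda>y. f' y + g' y)" using * Suc.IH by blast
  ultimately show ?case
    using * by (intro negligible_SucI[of _ _ "\<lambda>y. f y + g y" "\<lambda>y. f' y + g' y"] DERIV_add) auto
qed

lemma negligible_mult: "negligible F v n f \<Longrightarrow> moderate F v n g \<Longrightarrow> negligible F v n (\<lambda>y. f y * g y)"
proof (induction n arbitrary: f g)
  case 0
  then obtain M D where *: "\<forall>\<^sub>F y in F. \<bar>g y\<bar> \<le> D * v y ^ M" by auto
  show ?case unfolding negligible.simps
  proof
    fix N
    have "((\<lambda>y. D * (v y ^ (N + M) * f y)) \<longlongrightarrow> D * 0) F"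
      using 0 by (intro tendsto_mult_left) auto
    then have "((\<lambda>y. D * (v y ^ (N + M) * f y)) \<longlongrightarrow> 0) F" by simp
    then show "((\<lambda>y. v y ^ N * (f y * g y)) \<longlongrightarrow> 0) F"
    proof (rule Lim_null_comparison[OF _ tendsto_rabs_zero, rotated])
      show "\<forall>\<^sub>F y in F. norm (v y ^ N * (f y * g y)) \<le> \<bar>D * (v y ^ (N + M) * f y)\<bar>"
        using * weight_ge_1
      proof eventually_elim
        case (elim y)
        then have "\<bar>g y\<bar> * (v y ^ N * \<bar>f y\<bar>) \<le> D * v y ^ M * (v y ^ N * \<bar>f y\<bar>)"
          by (intro mult_right_mono) auto
        also have "\<dots> \<le> \<bar>D\<bar> * v y ^ M * (v y ^ N * \<bar>f y\<bar>)"
          using elim by (intro mult_right_mono) auto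
        finally show ?case using elim by (simp add: abs_mult power_add mult_ac)
      qed
    qed
  qed
next
  case (Suc n)
  from Suc.prems obtain f' g' where
    *: "\<forall>y. DERIV f y :> f' y" "negligible F v n f'"
    "\<forall>y. DERIV g y :> g' y" "moderate F v n g'"
    by auto
  have "negligible F v 0 (\<lambda>y. f y * g y)"
    using Suc.IH[of f g] Suc.prems negligible_0I negligible_SucD moderate_SucD by blast
  moreover have "negligible F v n (\<lambda>y. f' y * g y + f y * g' y)"
    using * negligible_SucD[OF Suc.prems(1)] moderate_SucD[OF Suc.prems(2)]
    by (intro negligible_add Suc.IH)
  ultimately show ?case
    using * by (intro negligible_SucI[of _ _ "\<lambda>y. f y * g y" "\<lambda>y. f' y * g y + f y * g' y"] DERIV_mult'[THEN DERIV_cong]) auto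
qed

lemma negligible_imp_tame: "negligible F v n f \<Longrightarrow> tame F n f"
proof (induction n arbitrary: f)
  case 0
  then have "((\<lambda>y. v y ^ 0 * f y) \<longlongrightarrow> 0) F" unfolding negligible.simps by blast
  then have "\<forall>\<^sub>F y in F. dist (f y) 0 < 1" by (intro tendstoD) auto
  then have "\<forall>\<^sub>F y in F. \<bar>f y\<bar> \<le> 1 * 1 ^ 0" by (rule eventually_mono) simp
  then show ?case unfolding moderate.simps by blast
next
  case (Suc n)
  then obtain f' where f': "\<And>y. DERIV f y :> f' y" "negligible F v n f'"
    by auto
  have "tame F 0 f"
    using Suc.IH[of f] negligible_SucD[OF Suc.prems] moderate_0I by blast
  then show ?case by (rule moderate_SucI[OF _ f'(1) Suc.IH[OF f'(2)]])
qed

text \<open>Since \<open>(1 / f)' = - f' * (1 / f)\<^sup>2\<close>, a bound on \<open>1 / f\<close>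
  itself propagates to all derivatives.\<close>

lemma moderate_inverse:
  assumes "\<And>y. f y > 0" "moderate F v 0 (\<lambda>y. 1 / f y)" "moderate F v n f"
  shows "moderate F v n (\<lambda>y. 1 / f y)"
  using assms(3)
proof (induction n)
  case 0
  show ?case by (rule assms(2))
next
  case (Suc n)
  then obtain f' where f': "\<forall>y. DERIV f y :> f' y" "moderate F v n f'" by auto
  have "moderate F v n (\<lambda>y. (- 1) * f' y * (1 / f y * (1 / f y)))"
    using Suc.IH[OF moderate_SucD[OF Suc.prems]] f' by (intro moderate_mult moderate_const)
  moreover have "DERIV (\<lambda>y. 1 / f y) y :> (- 1) * f' y * (1 / f y * (1 / f y))" for y
    using DERIV_inverse_fun[of f "f' y" y UNIV] f'(1) assms(1)[of y]
    by (simp add: divide_inverse power2_eq_square mult_ac)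
  ultimately show ?case
    by (intro moderate_SucI[OF assms(2)])
qed

text \<open>Differentiating \<open>Q (T x)\<close> in \<open>x\<close> replaces \<open>Q\<close> by
  \<open>Q' * m\<close>, again negligible because \<open>m\<close> is moderate, so the form of the
  function is preserved. Away from 0 continuity comes from differentiability, which is why
  \<open>Q\<close> is taken one order higher.\<close>

lemma Cn_on_extend_zero:
  assumes T: "filterlim T F (at_right 0)" "\<And>x. x > 0 \<Longrightarrow> DERIV T x :> m (T x)"
    and m: "\<And>n. moderate F v n m"
  shows "negligible F v (Suc n) Q \<Longrightarrow> Cn_on n (zext T Q) UNIV"
proof -
  have lim: "((zext T Q) \<longlongrightarrow> 0) (at 0)" if "negligible F v 0 Q" for Q
  proof -
    from that have "(Q \<longlongrightarrow> 0) F" by (auto dest: spec[of _ 0])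
    with T(1) have "((\<lambda>x. Q (T x)) \<longlongrightarrow> 0) (at_right 0)" by (rule filterlim_compose[rotated])
    then have "((zext T Q) \<longlongrightarrow> 0) (at_right 0)"
      by (rule Lim_transform_eventually) (auto simp: eventually_at_filter)
    moreover have "((zext T Q) \<longlongrightarrow> 0) (at_left 0)"
      by (rule Lim_transform_eventually[OF tendsto_const]) (auto simp: eventually_at_filter)
    ultimately show ?thesis by (simp add: filterlim_at_split)
  qed
  have nz: "DERIV (zext T Q) x :> zext T (\<lambda>y. Q' y * m y) x"
    if "\<And>x. DERIV Q x :> Q' x" "x \<noteq> 0" for Q Q' x
  proof (cases "x > 0")
    case True
    have "DERIV (\<lambda>x. Q (T x)) x :> Q' (T x) * m (T x)"
      by (rule DERIV_chain2[OF that(1) T(2)[OF True]])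
    with True show ?thesis
      by (simp, subst has_field_derivative_cong_ev[where g = "\<lambda>x. Q (T x)"])
        (auto intro!: eventually_mono[OF eventually_nhds_in_open[of "{0<..}" x]])
  next
    case False
    with \<open>x \<noteq> 0\<close> have "x < 0" by simp
    then show ?thesis
      by (simp, subst has_field_derivative_cong_ev[where g = "\<lambda>x. 0"])
        (auto intro!: eventually_mono[OF eventually_nhds_in_open[of "{..<0}" x]])
  qed
  have cont: "continuous_on UNIV (zext T Q)"
    if Q: "negligible F v 0 Q" "\<And>x. DERIV Q x :> Q' x" for Q Q'
  proof (rule continuous_at_imp_continuous_on, intro ballI)
    show "isCont (zext T Q) x" for x
    proof (cases "x = 0")
      case True
      then show ?thesis using lim[OF Q(1)] by (simp add: isCont_def)
    next
      case False
      then show ?thesis by (rule DERIV_isCont[OF nz[OF Q(2)]])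
    qed
  qed
  have der: "DERIV (zext T Q) x :> zext T (\<lambda>y. Q' y * m y) x"
    if Q: "negligible F v 0 Q" "\<And>x. DERIV Q x :> Q' x" "negligible F v 0 Q'" for Q Q' x
  proof -
    show ?thesis
    proof (cases "x = 0")
      case True
      have "negligible F v 0 (\<lambda>y. Q' y * m y)"
        using Q(3) m[of 0] by (rule negligible_mult)
      then have "((zext T (\<lambda>y. Q' y * m y)) \<longlongrightarrow> 0) (at 0 within UNIV)"
        by (rule lim)
      from has_real_derivative_limit[OF cont[OF Q(1,2)] is_interval_univ UNIV_I nz[OF Q(2)] this]
      show ?thesis using True by simp
    qed (rule nz[OF Q(2)])
  qed
  show "negligible F v (Suc n) Q \<Longrightarrow> Cn_on n (zext T Q) UNIV"
  proof (induction n arbitrary: Q)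
    case 0
    then obtain Q' where "\<And>y. DERIV Q y :> Q' y" by auto
    from cont[OF negligible_0I[OF 0] this] show ?case by simp
  next
    case (Suc n)
    then obtain Q' where Q': "\<forall>y. DERIV Q y :> Q' y" "negligible F v (Suc n) Q'"
      by (metis negligible.simps(2))
    have "negligible F v (Suc n) (\<lambda>y. Q' y * m y)" by (intro negligible_mult Q' m)
    then have "Cn_on n (zext T (\<lambda>y. Q' y * m y)) UNIV" by (rule Suc.IH)
    moreover have "DERIV (zext T Q) x :> zext T (\<lambda>y. Q' y * m y) x" for x
      using negligible_0I[OF Suc.prems] Q'(1) negligible_0I[OF Q'(2)] by (intro der) auto
    ultimately show ?case by (intro Cn_on_SucI) auto
  qed
qed

end

section \<open>Flows given by a time coordinate\<close>

lemma Cn_on_1E: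
  assumes "Cn_on 1 f S"
  obtains f' where "\<And>x. x \<in> S \<Longrightarrow> (f has_real_derivative f' x) (at x within S)" "continuous_on S f'"
proof -
  from assms have "\<exists>g'. (\<forall>x\<in>S. (f has_real_derivative g' x) (at x within S)) \<and> continuous_on S g'"
    by simp
  then obtain g' where "\<forall>x\<in>S. (f has_real_derivative g' x) (at x within S)" "continuous_on S g'"
    by (elim exE conjE)
  then show thesis by (intro that[of g']) (erule bspec)
qed

lemma at_half_line: "x > 0 \<Longrightarrow> at x within {0::real..} = at x"
  by (rule at_within_interior) simp

lemma Cr_on_1_iff: "Cr_on 1 f S \<longleftrightarrow> Cn_on 1 f S"
  using Cn_on_mono[of 1 f S] by (auto simp: Cr_on_def one_enat_def simp del: Cn_on.simps)

text \<open>Gronwall's argument: \<open>\<mu>\<close> is Lipschitz on a compact interval containing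
  both trajectories, so their squared distance \<open>z\<close> satisfies
  \<open>z' \<le> k * z\<close>. Rescaling the time by \<open>t\<close> to [0, 1] treats both signs
  of \<open>t\<close> at once.\<close>

lemma ODE_unique_C1:
  fixes \<mu> :: "real \<Rightarrow> real"
  assumes C1: "Cn_on 1 \<mu> {0..}"
    and u: "\<And>t. u t \<ge> 0" "\<And>t. DERIV u t :> \<mu> (u t)"
    and w: "\<And>t. w t \<ge> 0" "\<And>t. DERIV w t :> \<mu> (w t)"
    and init: "u 0 = w 0"
  shows "u t = w t"
proof -
  obtain \<mu>' where \<mu>': "\<And>x. x \<in> {0..} \<Longrightarrow> (\<mu> has_real_derivative \<mu>' x) (at x within {0..})"
    "continuous_on {0..} \<mu>'" by (rule Cn_on_1E[OF C1], rule that)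
  define U W where "U s = u (t * s)" and "W s = w (t * s)" for s
  have U': "DERIV U s :> t * \<mu> (U s)" and W': "DERIV W s :> t * \<mu> (W s)" for s
    unfolding U_def[abs_def] W_def[abs_def] mult.commute[of t "\<mu> _"]
    by (rule DERIV_chain2[OF u(2) DERIV_cmult_Id] DERIV_chain2[OF w(2) DERIV_cmult_Id])+
  have "continuous_on {0..1} U" "continuous_on {0..1} W"
    by (rule DERIV_continuous_on, rule has_field_derivative_at_within, rule U' W')+
  then have "bounded (U ` {0..1} \<union> W ` {0..1})"
    by (intro bounded_Un[THEN iffD2] conjI compact_imp_bounded compact_continuous_image) auto
  then obtain B where B: "\<And>s. s \<in> {0..1} \<Longrightarrow> U s \<le> B \<and> W s \<le> B"
    unfolding bounded_real by (metis UnI1 UnI2 abs_le_D1 image_eqI)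
  have "bounded (\<mu>' ` {0..B})"
    using \<mu>'(2) by (intro compact_imp_bounded compact_continuous_image) (auto intro: continuous_on_subset)
  then obtain L where L: "\<And>x. x \<in> {0..B} \<Longrightarrow> \<bar>\<mu>' x\<bar> \<le> L"
    unfolding bounded_real by blast
  have lip: "\<bar>\<mu> x - \<mu> y\<bar> \<le> L * \<bar>x - y\<bar>" if "x \<in> {0..B}" "y \<in> {0..B}" for x y
  proof -
    have "norm (\<mu> x - \<mu> y) \<le> L * norm (x - y)"
    proof (rule field_differentiable_bound[of "{0..B}"])
      show "(\<mu> has_field_derivative \<mu>' z) (at z within {0..B})" if "z \<in> {0..B}" for z
        using \<mu>'(1)[of z] that by (auto intro: DERIV_subset)
    qed (use L that in auto)
    then show ?thesis by simp
  qed
  define k where "k = 2 * (\<bar>t\<bar> * L)"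
  define z where "z s = (U s - W s)\<^sup>2" for s
  have z': "DERIV z s :> 2 * (U s - W s) * (t * (\<mu> (U s) - \<mu> (W s)))" for s
    unfolding z_def by (rule derivative_eq_intros U' W' refl)+ (simp add: algebra_simps)
  have bound: "2 * (U s - W s) * (t * (\<mu> (U s) - \<mu> (W s))) \<le> k * z s" if "s \<in> {0..1}" for s
  proof -
    have "\<bar>\<mu> (U s) - \<mu> (W s)\<bar> \<le> L * \<bar>U s - W s\<bar>"
      using B[OF that] u(1) w(1) by (intro lip) (auto simp: U_def W_def)
    then have "2 * \<bar>U s - W s\<bar> * (\<bar>t\<bar> * \<bar>\<mu> (U s) - \<mu> (W s)\<bar>) \<le> 2 * \<bar>U s - W s\<bar> * (\<bar>t\<bar> * (L * \<bar>U s - W s\<bar>))"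
      by (intro mult_left_mono) auto
    also have "\<dots> = k * (\<bar>U s - W s\<bar> * \<bar>U s - W s\<bar>)" by (simp add: k_def mult_ac)
    also have "\<dots> = k * z s" by (simp only: z_def power2_eq_square abs_mult_self_eq)
    finally have "\<bar>2 * (U s - W s) * (t * (\<mu> (U s) - \<mu> (W s)))\<bar> \<le> k * z s"
      by (simp only: abs_mult abs_numeral)
    then show ?thesis by (rule abs_le_D1)
  qed
  have "z 1 * exp (- k * 1) \<le> z 0 * exp (- k * 0)"
  proof (rule DERIV_nonpos_imp_nonincreasing[of 0 1 "\<lambda>s. z s * exp (- k * s)"])
    fix s :: real assume s: "0 \<le> s" "s \<le> 1"
    have "DERIV (\<lambda>s. z s * exp (- k * s)) s :>
        (2 * (U s - W s) * (t * (\<mu> (U s) - \<mu> (W s))) - k * z s) * exp (- k * s)"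
      by (rule derivative_eq_intros z' refl)+ (simp add: algebra_simps)
    moreover have "(2 * (U s - W s) * (t * (\<mu> (U s) - \<mu> (W s))) - k * z s) * exp (- k * s) \<le> 0"
      using bound[of s] s by (intro mult_nonpos_nonneg) auto
    ultimately show "\<exists>y. DERIV (\<lambda>s. z s * exp (- k * s)) s :> y \<and> y \<le> 0" by blast
  qed simp
  then have "z 1 \<le> 0" using init by (simp add: z_def U_def W_def mult_le_0_iff not_le[symmetric])
  then show ?thesis by (simp add: z_def U_def W_def)
qed

text \<open>In the coordinate \<open>x = \<psi> s\<close> the field has the value
  \<open>\<psi>1 s\<close> and the derivative \<open>\<psi>2 s / \<psi>1 s\<close>. Thus
  \<open>lim1\<close> and \<open>lim2\<close> say that the field is C1 up to the origin and vanishes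
  there together with its derivative.\<close>

locale time_coordinate =
  fixes \<psi> \<psi>1 \<psi>2 :: "real \<Rightarrow> real"
  assumes der: "\<And>s. DERIV \<psi> s :> \<psi>1 s"
    and der1: "\<And>s. (\<psi>1 has_real_derivative \<psi>2 s) (at s)"
    and cont2: "continuous_on UNIV \<psi>2"
    and pos: "\<And>s. \<psi> s > 0" and pos1: "\<And>s. \<psi>1 s > 0"
    and lim_bot: "(\<psi> \<longlongrightarrow> 0) at_bot" and lim_top: "filterlim \<psi> at_top at_top"
    and lim1: "(\<psi>1 \<longlongrightarrow> 0) at_bot"
    and lim2: "((\<lambda>s. \<psi>2 s / \<psi>1 s) \<longlongrightarrow> 0) at_bot"
begin

lemma strict_mono_psi: "strict_mono \<psi>"
  using der pos1 by (intro strict_monoI) (metis DERIV_pos_imp_increasing)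

lemma psi_eq_iff [simp]: "\<psi> s = \<psi> t \<longleftrightarrow> s = t"
  using strict_mono_eq[OF strict_mono_psi] .

lemma isCont_psi: "isCont \<psi> s" and isCont_psi1: "isCont \<psi>1 s" and isCont_psi2: "isCont \<psi>2 s"
  using der der1 cont2 by (auto intro: DERIV_isCont simp: continuous_on_eq_continuous_at)

lemma psi_surj: assumes "x > 0" obtains s where "\<psi> s = x"
proof -
  have "\<forall>\<^sub>F s in at_bot. \<psi> s < x"
    using order_tendstoD(2)[OF lim_bot assms] .
  then obtain a where a: "\<psi> a < x" unfolding eventually_at_bot_linorder by blast
  have "\<forall>\<^sub>F s in at_top. \<psi> s \<ge> x" using lim_top unfolding filterlim_at_top by blast
  then obtain b where b: "\<psi> b \<ge> x" unfolding eventually_at_top_linorder by blast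
  have "a \<le> b" using a b strict_mono_less_eq[OF strict_mono_psi] by fastforce
  then show ?thesis
    using IVT[of \<psi> a x b] a b isCont_psi that by auto
qed

definition \<tau> :: "real \<Rightarrow> real" where "\<tau> x = (THE s. \<psi> s = x)"

lemma tau_psi [simp]: "\<tau> (\<psi> s) = s"
  unfolding \<tau>_def by auto

lemma psi_tau [simp]: "x > 0 \<Longrightarrow> \<psi> (\<tau> x) = x"
  by (metis psi_surj tau_psi)

lemma DERIV_tau:
  assumes "x > 0" shows "DERIV \<tau> x :> 1 / \<psi>1 (\<tau> x)"
proof -
  have "isCont \<tau> x"
  proof -
    have "isCont \<tau> (\<psi> (\<tau> x))"
      by (rule isCont_inverse_function[of 1]) (use isCont_psi in auto)
    with assms show ?thesis by simp
  qed
  then have "DERIV \<tau> x :> inverse (\<psi>1 (\<tau> x))"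
    using assms pos1[of "\<tau> x"]
    by (intro DERIV_inverse_function[where f=\<psi> and a=0 and b="x+1"] der) auto
  then show ?thesis by (simp add: divide_inverse)
qed

lemma isCont_tau: "x > 0 \<Longrightarrow> isCont \<tau> x"
  using DERIV_tau DERIV_isCont by blast

lemma tau_at_bot: "filterlim \<tau> at_bot (at_right 0)"
  unfolding filterlim_at_bot
proof
  fix Z
  have "\<forall>\<^sub>F x in at_right 0. x \<in> {0<..<\<psi> Z}" by (rule eventually_at_right_real) (rule pos)
  then show "\<forall>\<^sub>F x in at_right 0. \<tau> x \<le> Z"
  proof eventually_elim
    case (elim x)
    then have "\<psi> (\<tau> x) \<le> \<psi> Z" by simp
    then show ?case using strict_mono_less_eq[OF strict_mono_psi] by blast
  qed
qed

lemma psi_at_right: "filterlim \<psi> (at_right 0) at_bot"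
  using lim_bot pos by (intro tendsto_imp_filterlim_at_right) auto

definition fl :: "real \<Rightarrow> real \<Rightarrow> real" where
  "fl t x = (if x < 0 then undefined else if x = 0 then 0 else \<psi> (\<tau> x + t))"

definition \<nu> :: "real \<Rightarrow> real" where
  "\<nu> x = (if x < 0 then undefined else if x = 0 then 0 else \<psi>1 (\<tau> x))"

lemma fl_zero [simp]: "fl t 0 = 0" and nu_zero [simp]: "\<nu> 0 = 0"
  and fl_psi [simp]: "fl t (\<psi> s) = \<psi> (s + t)" and nu_psi [simp]: "\<nu> (\<psi> s) = \<psi>1 s"
  using pos[of s] by (auto simp: fl_def \<nu>_def)

lemma half_line_cases:
  assumes "x \<ge> 0" obtains "x = 0" | s where "x = \<psi> s"
  using assms psi_surj by (metis less_eq_real_def)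

lemma fl_nonneg: "x \<ge> 0 \<Longrightarrow> fl t x \<ge> 0"
  using pos by (auto elim!: half_line_cases intro: less_imp_le)

lemma fl_fl: "x \<ge> 0 \<Longrightarrow> fl s (fl t x) = fl (s + t) x"
  by (auto elim!: half_line_cases simp: add_ac)

lemma fl_0: "x \<ge> 0 \<Longrightarrow> fl 0 x = x"
  by (auto elim!: half_line_cases)

lemma fl_inj: assumes "fl s = fl t" shows "s = t"
proof -
  have "fl s (\<psi> 0) = fl t (\<psi> 0)" using assms by simp
  then show ?thesis by simp
qed

lemma fl_ext: "fl t \<in> extensional {0..}"
  by (auto simp: extensional_def fl_def)

lemma fl_compose: "compose {0..} (fl s) (fl t) = fl (s + t)"
  by (rule extensionalityI[of _ "{0..}"]) (auto simp: compose_eq fl_ext fl_fl compose_extensional)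

lemma fl_Bij: "fl t \<in> Bij {0..}"
  unfolding Bij_def
proof (intro IntI CollectI fl_ext)
  show "bij_betw (fl t) {0..} {0..}"
    by (rule bij_betw_byWitness[where f' = "fl (- t)"]) (auto simp: fl_fl fl_0 fl_nonneg)
qed

lemma inv_into_fl: "x \<ge> 0 \<Longrightarrow> inv_into {0..} (fl t) x = fl (- t) x"
  using fl_Bij[of t]
  by (intro inv_into_f_eq) (auto simp: Bij_def bij_betw_def fl_nonneg fl_fl fl_0)

lemma is_flow_fl: "is_flow \<nu> fl"
  unfolding is_flow_def
proof (intro conjI allI impI fl_ext)
  fix x t :: real assume "x \<ge> 0"
  then show "fl 0 x = x" "fl t x \<ge> 0" by (auto simp: fl_0 fl_nonneg)
  from \<open>x \<ge> 0\<close> show "DERIV (\<lambda>s. fl s x) t :> \<nu> (fl t x)"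
  proof (cases rule: half_line_cases)
    case (2 s)
    have "DERIV (\<lambda>t. \<psi> (s + t)) t :> \<psi>1 (s + t)"
      using DERIV_shift[of \<psi> "\<psi>1 (s + t)" t s] der[of "s + t"] by (simp add: add.commute)
    with 2 show ?thesis by simp
  qed simp
qed

lemma nu_DERIV:
  assumes "x > 0" shows "DERIV \<nu> x :> \<psi>2 (\<tau> x) / \<psi>1 (\<tau> x)"
proof -
  have "DERIV (\<lambda>x. \<psi>1 (\<tau> x)) x :> \<psi>2 (\<tau> x) * (1 / \<psi>1 (\<tau> x))"
    by (rule DERIV_chain2[OF der1 DERIV_tau[OF assms]])
  moreover have "\<forall>\<^sub>F y in nhds x. \<psi>1 (\<tau> y) = \<nu> y"
    using eventually_nhds_in_open[of "{0<..}" x] assms by (auto simp: \<nu>_def elim: eventually_mono)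
  ultimately show ?thesis by (simp add: DERIV_cong_ev)
qed

lemma at_0_half_line: "at 0 within {0::real..} = at_right 0"
  by (simp add: at_within_Ici_at_right)

lemma half_line_contI:
  assumes "\<And>x. x > 0 \<Longrightarrow> isCont f x" "(f \<longlongrightarrow> f 0) (at_right 0)"
  shows "continuous_on {0::real..} f"
proof (rule continuous_on_eq_continuous_within[THEN iffD2], intro ballI)
  fix x :: real assume "x \<in> {0..}"
  then consider "x = 0" | "x > 0" by force
  then show "continuous (at x within {0..}) f"
    using assms continuous_at_imp_continuous_at_within
    by cases (auto simp: continuous_within at_0_half_line)
qed

lemma Cn_on_1I:
  assumes f: "\<And>x. x > 0 \<Longrightarrow> DERIV f x :> g x" and g: "\<And>x. x > 0 \<Longrightarrow> isCont g x"
    and lim: "(f \<longlongrightarrow> f 0) (at_right 0)" "(g \<longlongrightarrow> l) (at_right 0)"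
  shows "Cn_on 1 f {0..}"
proof -
  have cf: "continuous_on {0..} f" by (rule half_line_contI[OF DERIV_isCont[OF f] lim(1)])
  have d0: "(f has_real_derivative l) (at 0 within {0..})"
    using f lim by (intro has_real_derivative_limit[OF cf, of 0 g])
      (auto simp: at_0_half_line is_interval_ci)
  have "continuous_on {0..} (\<lambda>x. if x = 0 then l else g x)"
  proof (rule half_line_contI)
    fix x :: real assume "x > 0"
    then have "\<forall>\<^sub>F y in nhds x. y \<in> {0<..}" by (intro eventually_nhds_in_open) auto
    then have "\<forall>\<^sub>F y in nhds x. (if y = 0 then l else g y) = g y" by (rule eventually_mono) simp
    then show "isCont (\<lambda>x. if x = 0 then l else g x) x"
      using g[OF \<open>x > 0\<close>] by (rule isCont_cong[THEN iffD2])
  next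
    have "((\<lambda>x. if x = 0 then l else g x) \<longlongrightarrow> l) (at_right 0)"
      by (rule Lim_transform_eventually[OF lim(2)]) (auto simp: eventually_at_filter)
    then show "((\<lambda>x. if x = 0 then l else g x) \<longlongrightarrow> (if 0 = 0 then l else g 0)) (at_right (0::real))" by simp
  qed
  then have "Cn_on 0 (\<lambda>x. if x = 0 then l else g x) {0..}" by simp
  then have "Cn_on (Suc 0) f {0..}"
    by (rule Cn_on_SucI[rotated]) (use f d0 in \<open>auto simp: less_le has_field_derivative_at_within\<close>)
  then show ?thesis by simp
qed

lemma nu_C1: "Cn_on 1 \<nu> {0..}"
proof -
  have 1: "isCont (\<lambda>x. \<psi>2 (\<tau> x) / \<psi>1 (\<tau> x)) x" if "x > 0" for x
    using isCont_o2[OF isCont_tau[OF that] isCont_psi2] isCont_o2[OF isCont_tau[OF that] isCont_psi1]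
      pos1[of "\<tau> x"] by (intro continuous_divide) auto
  have "((\<lambda>x. \<psi>1 (\<tau> x)) \<longlongrightarrow> 0) (at_right 0)"
    by (rule filterlim_compose[OF lim1 tau_at_bot])
  then have 2: "(\<nu> \<longlongrightarrow> \<nu> 0) (at_right 0)"
    unfolding nu_zero by (rule Lim_transform_eventually) (auto simp: eventually_at_filter \<nu>_def)
  have 3: "((\<lambda>x. \<psi>2 (\<tau> x) / \<psi>1 (\<tau> x)) \<longlongrightarrow> 0) (at_right 0)"
    by (rule filterlim_compose[OF lim2 tau_at_bot])
  show ?thesis by (rule Cn_on_1I[OF nu_DERIV 1 2 3]; assumption)
qed

text \<open>The derivative \<open>\<psi>2 / \<psi>1\<close> of \<open>ln \<psi>1\<close> tends to 0,
  hence so does the increment of \<open>ln \<psi>1\<close> over a bounded shift. Consequently every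
  time-\<open>t\<close> map has derivative 1 at the origin.\<close>

lemma psi1_ratio: "((\<lambda>s. \<psi>1 (s + a) / \<psi>1 s) \<longlongrightarrow> 1) at_bot"
proof -
  have "((\<lambda>s. ln (\<psi>1 (s + a)) - ln (\<psi>1 s)) \<longlongrightarrow> 0) at_bot"
  proof (rule tendstoI)
    fix e :: real assume e: "e > 0"
    define e' where "e' = e / (\<bar>a\<bar> + 1)"
    have "e' > 0" using e by (simp add: e'_def)
    from tendstoD[OF lim2 this] obtain B where "\<forall>s\<le>B. dist (\<psi>2 s / \<psi>1 s) 0 < e'"
      unfolding eventually_at_bot_linorder by blast
    then have B: "\<bar>\<psi>2 s / \<psi>1 s\<bar> \<le> e'" if "s \<le> B" for s
      using that by (auto simp: dist_real_def less_imp_le)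
    have "dist (ln (\<psi>1 (s + a)) - ln (\<psi>1 s)) 0 < e" if s: "s \<le> B - \<bar>a\<bar>" for s
    proof -
      have "norm (ln (\<psi>1 (s + a)) - ln (\<psi>1 s)) \<le> e' * norm ((s + a) - s)"
      proof (rule field_differentiable_bound[of "{..B}"])
        show "((\<lambda>s. ln (\<psi>1 s)) has_real_derivative \<psi>2 z / \<psi>1 z) (at z within {..B})" for z
          using DERIV_chain2[where f=ln and g=\<psi>1, OF DERIV_ln_divide[OF pos1] der1, of z]
          by (rule has_field_derivative_at_within[OF DERIV_cong]) simp
      qed (use B s in auto)
      also have "\<dots> < e"
        using e by (simp add: e'_def field_simps)
      finally show ?thesis by (simp add: dist_real_def)
    qed
    then show "\<forall>\<^sub>F s in at_bot. dist (ln (\<psi>1 (s + a)) - ln (\<psi>1 s)) 0 < e"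
      unfolding eventually_at_bot_linorder by blast
  qed
  from tendsto_exp[OF this] show ?thesis
    using pos1 by (simp add: exp_diff)
qed

lemma fl_DERIV:
  assumes "x > 0" shows "DERIV (fl t) x :> \<psi>1 (\<tau> x + t) / \<psi>1 (\<tau> x)"
proof -
  have "DERIV (\<lambda>x. \<psi> (\<tau> x + t)) x :> \<psi>1 (\<tau> x + t) * (1 / \<psi>1 (\<tau> x))"
    by (rule DERIV_chain2[OF der]) (use DERIV_add[OF DERIV_tau[OF assms] DERIV_const] in simp)
  moreover have "\<forall>\<^sub>F y in nhds x. \<psi> (\<tau> y + t) = fl t y"
    using eventually_nhds_in_open[of "{0<..}" x] assms by (auto simp: fl_def elim: eventually_mono)
  ultimately show ?thesis by (simp add: DERIV_cong_ev)
qed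

lemma filterlim_add_at_bot: "filterlim (\<lambda>s. s + a) at_bot (at_bot :: real filter)"
  unfolding filterlim_at_bot
proof
  fix Z :: real
  show "\<forall>\<^sub>F s in at_bot. s + a \<le> Z"
    using eventually_le_at_bot[of "Z - a"] by (rule eventually_mono) simp
qed

lemma fl_C1: "Cn_on 1 (fl t) {0..}"
proof -
  have 1: "isCont (\<lambda>x. \<psi>1 (\<tau> x + t) / \<psi>1 (\<tau> x)) x" if "x > 0" for x
    using isCont_o2[OF continuous_add[OF isCont_tau[OF that] continuous_const] isCont_psi1]
      isCont_o2[OF isCont_tau[OF that] isCont_psi1]
      pos1[of "\<tau> x"] by (intro continuous_divide) auto
  have "((\<lambda>x. \<psi> (\<tau> x + t)) \<longlongrightarrow> 0) (at_right 0)"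
    by (rule filterlim_compose[OF lim_bot filterlim_compose[OF filterlim_add_at_bot tau_at_bot]])
  then have 2: "(fl t \<longlongrightarrow> fl t 0) (at_right 0)"
    unfolding fl_zero by (rule Lim_transform_eventually) (auto simp: eventually_at_filter fl_def)
  have 3: "((\<lambda>x. \<psi>1 (\<tau> x + t) / \<psi>1 (\<tau> x)) \<longlongrightarrow> 1) (at_right 0)"
    by (rule filterlim_compose[OF psi1_ratio tau_at_bot])
  show ?thesis by (rule Cn_on_1I[OF fl_DERIV 1 2 3]; assumption)
qed

lemma fl_Diff_iff: "fl t \<in> Diff r \<longleftrightarrow> Cr_on r (fl t) {0..} \<and> Cr_on r (fl (- t)) {0..}"
proof -
  have "Cn_on n (inv_into {0..} (fl t)) {0..} \<longleftrightarrow> Cn_on n (fl (- t)) {0..}" for n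
    by (rule Cn_on_cong) (simp add: inv_into_fl)
  then show ?thesis by (simp add: Diff_def fl_Bij Cr_on_def)
qed

lemma fl_Diff_1: "fl t \<in> Diff 1"
  by (simp only: fl_Diff_iff Cr_on_1_iff fl_C1)

lemma fl_centralizer_iff: "fl t \<in> centralizer r (fl 1) \<longleftrightarrow> fl t \<in> Diff r"
  by (simp add: centralizer_def fl_compose add.commute)

subsection \<open>Kopell's lemma\<close>

text \<open>In the time coordinate, an element of the centralizer becomes a map \<open>H\<close> commuting with
  the unit translation. Comparing \<open>H'\<close> at \<open>s\<close> and at \<open>s - n\<close> for \<open>n \<rightarrow> \<infinity>\<close> shows that it is
  everywhere equal to the derivative of the element at \<open>0\<close>.\<close>

lemma filterlim_minus_real_at_bot: "filterlim (\<lambda>n. s - real n) at_bot sequentially"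
  unfolding filterlim_at_bot
proof
  fix Z :: real
  obtain N where N: "s - Z \<le> real N" using real_arch_simple by blast
  show "\<forall>\<^sub>F n in sequentially. s - real n \<le> Z"
    using eventually_ge_at_top[of N] by eventually_elim (use N in linarith)
qed

lemma centralizer_1_subset:
  assumes g: "g \<in> centralizer 1 (fl 1)" shows "\<exists>t. g = fl t"
proof -
  from g have gB: "g \<in> Bij {0..}" and C1: "Cn_on 1 g {0..}"
    and comm: "compose {0..} g (fl 1) = compose {0..} (fl 1) g"
    by (auto simp: centralizer_def Diff_def Cr_on_1_iff simp del: Cn_on.simps)
  have g_ext: "g \<in> extensional {0..}" and g_bij: "bij_betw g {0..} {0..}"
    using gB by (auto simp: Bij_def)
  have g_nonneg: "g x \<ge> 0" if "x \<ge> 0" for x using g_bij that by (auto simp: bij_betw_def)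
  have g_comm: "g (fl 1 x) = fl 1 (g x)" if "x \<ge> 0" for x
    using fun_cong[OF comm, of x] that by (simp add: compose_eq)
  have fix0: "x = 0" if "x \<ge> 0" "fl 1 x = x" for x
    using that by (auto elim!: half_line_cases)
  have g0: "g 0 = 0" using g_comm[of 0] fix0[of "g 0"] g_nonneg[of 0] by simp
  have g_pos: "g x > 0" if "x > 0" for x
  proof -
    have "g x \<noteq> g 0" using g_bij that by (auto simp: bij_betw_def inj_on_eq_iff)
    then show ?thesis using g0 g_nonneg[of x] that by simp
  qed
  obtain g' where g': "\<And>x. x \<in> {0..} \<Longrightarrow> (g has_real_derivative g' x) (at x within {0..})"
    "continuous_on {0..} g'" by (rule Cn_on_1E[OF C1], rule that)
  have g'_at: "DERIV g x :> g' x" if "x > 0" for x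
    using g'(1)[of x] that at_half_line[OF that] by simp
  define H where "H s = \<tau> (g (\<psi> s))" for s
  have psiH: "\<psi> (H s) = g (\<psi> s)" for s using g_pos[OF pos] by (simp add: H_def)
  have H': "DERIV H s :> g' (\<psi> s) * \<psi>1 s / \<psi>1 (H s)" for s
  proof -
    have "DERIV H s :> 1 / \<psi>1 (\<tau> (g (\<psi> s))) * (g' (\<psi> s) * \<psi>1 s)"
      unfolding H_def by (rule DERIV_chain2[OF DERIV_tau[OF g_pos[OF pos]] DERIV_chain2[OF g'_at[OF pos] der]])
    then show ?thesis by (simp add: H_def)
  qed
  have H_shift1: "H (s + 1) = H s + 1" for s
  proof -
    have "\<psi> (H (s + 1)) = g (fl 1 (\<psi> s))" by (simp add: psiH)
    also have "\<dots> = \<psi> (H s + 1)" using pos[of s] by (subst g_comm) (auto simp flip: psiH)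
    finally show ?thesis by simp
  qed
  have H_shift: "H (s - real n) = H s - real n" for s n
  proof (induction n)
    case (Suc n)
    then show ?case using H_shift1[of "s - real (Suc n)"] by (simp add: algebra_simps)
  qed simp
  have H'_eq: "DERIV H s :> g' 0" for s
  proof -
    define D where "D s = g' (\<psi> s) * \<psi>1 s / \<psi>1 (H s)" for s
    have "D (s - real n) = D s" for n
    proof -
      have "DERIV (\<lambda>s. H (s - real n)) s :> D (s - real n)"
        using H'[of "s - real n"] DERIV_shift[of H "D (s - real n)" s "- real n"] by (simp add: D_def)
      moreover have "DERIV (\<lambda>s. H s - real n) s :> D s"
        using DERIV_diff[OF H'[of s] DERIV_const[of "real n"]] by (simp add: D_def)
      ultimately show ?thesis using DERIV_unique by (fastforce simp: H_shift)
    qed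
    then have "(\<lambda>n. D (s - real n)) \<longlonglongrightarrow> D s" by simp
    moreover have "(\<lambda>n. D (s - real n)) \<longlonglongrightarrow> g' 0"
    proof -
      have "(g' \<longlongrightarrow> g' 0) (at_right 0)"
        using g'(2)[unfolded continuous_on_def, rule_format, of 0] by (simp add: at_0_half_line)
      then have "((\<lambda>s. g' (\<psi> s)) \<longlongrightarrow> g' 0) at_bot" by (rule filterlim_compose[OF _ psi_at_right])
      \<comment> \<open>\<open>H\<close> moves \<open>s - n\<close> by the same amount
        \<open>H s - s\<close> for every \<open>n\<close>, so the two values of
        \<open>\<psi>1\<close> in \<open>D (s - n)\<close> are taken at a fixed distance and
        \<open>psi1_ratio\<close> applies.\<close>
      then have "((\<lambda>s. g' (\<psi> s) / (\<psi>1 (s + (H s0 - s0)) / \<psi>1 s)) \<longlongrightarrow> g' 0 / 1) at_bot" for s0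
        by (intro tendsto_divide psi1_ratio) auto
      from filterlim_compose[OF this[of s] filterlim_minus_real_at_bot[of s]]
      have "(\<lambda>n. g' (\<psi> (s - real n)) / (\<psi>1 (s - real n + (H s - s)) / \<psi>1 (s - real n))) \<longlonglongrightarrow> g' 0"
        by simp
      moreover have "s - real n + (H s - s) = H (s - real n)" for n by (simp add: H_shift)
      ultimately show ?thesis by (simp add: D_def)
    qed
    ultimately have "D s = g' 0" by (rule LIMSEQ_unique)
    with H'[of s] show ?thesis by (simp add: D_def)
  qed
  have "DERIV (\<lambda>s. H s - g' 0 * s) s :> 0" for s
    using DERIV_diff[OF H'_eq[of s] DERIV_cmult_Id[of "g' 0"]] by simp
  then have *: "H s - g' 0 * s = H 0 - g' 0 * 0" for s
    using DERIV_isconst_all[of "\<lambda>s. H s - g' 0 * s" s 0] by blast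
  \<comment> \<open>An affine map commuting with the unit translation has slope 1.\<close>
  have "g' 0 = 1" using *[of 1] H_shift1[of 0] by simp
  then have Hs: "H s = s + H 0" for s using *[of s] by simp
  have "g x = fl (H 0) x" if "x \<in> {0..}" for x
  proof -
    from that have "x \<ge> 0" by simp
    then show ?thesis
    proof (cases rule: half_line_cases)
      case (2 s)
      then show ?thesis using psiH[of s] Hs[of s] by simp
    qed (simp add: g0)
  qed
  then have "g = fl (H 0)" by (intro extensionalityI[OF g_ext fl_ext])
  then show ?thesis ..
qed

lemma centralizer_1_eq: "centralizer 1 (fl 1) = range fl"
  using centralizer_1_subset fl_centralizer_iff fl_Diff_1 by blast

section \<open>Uniqueness of the flow and of the field\<close>

lemma flow_unique: assumes "is_flow \<nu> \<phi>" shows "\<phi> = fl"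
proof (rule ext)
  fix t
  show "\<phi> t = fl t"
  proof (rule extensionalityI[OF _ fl_ext])
    show "\<phi> t \<in> extensional {0..}" using assms by (simp add: is_flow_def)
    fix x :: real assume x: "x \<in> {0..}"
    show "\<phi> t x = fl t x"
      by (rule ODE_unique_C1[OF nu_C1, of "\<lambda>t. \<phi> t x" "\<lambda>t. fl t x"])
        (use assms is_flow_fl x in \<open>auto simp: is_flow_def\<close>)
  qed
qed

text \<open>The quotient \<open>\<rho>\<close> of the two fields in the time coordinate is
  1-periodic, because \<open>fl 1\<close> preserves both. Its derivative is periodic too and tends
  to \<open>\<mu>' 0\<close> at minus infinity, so it is constant, and by periodicity it is 0. Hence
  \<open>\<mu> = \<rho> 0 * \<nu>\<close>, and comparing the time-1 maps at \<open>\<psi> 0\<close>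
  gives \<open>\<rho> 0 = 1\<close>.\<close>

lemma field_unique:
  assumes ext: "\<mu> \<in> extensional {0..}" and C1: "Cr_on 1 \<mu> {0..}"
    and flow: "is_flow \<mu> \<phi>" and time1: "\<phi> 1 = fl 1"
  shows "\<mu> = \<nu>"
proof -
  have C1': "Cn_on 1 \<mu> {0..}" using C1 by (simp only: Cr_on_1_iff)
  have ph: "\<phi> 0 x = x" "\<phi> t x \<ge> 0" "DERIV (\<lambda>s. \<phi> s x) t :> \<mu> (\<phi> t x)"
    if "x \<ge> 0" for x t using flow that by (auto simp: is_flow_def)
  have shift: "\<phi> (s + t) x = \<phi> s (\<phi> t x)" if "x \<ge> 0" for s t x
  proof (rule ODE_unique_C1[OF C1', of "\<lambda>s. \<phi> (s + t) x" "\<lambda>s. \<phi> s (\<phi> t x)"])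
    fix s
    show "DERIV (\<lambda>s. \<phi> (s + t) x) s :> \<mu> (\<phi> (s + t) x)"
      using ph(3)[OF that, of "s + t"] DERIV_shift[of "\<lambda>s. \<phi> s x" "\<mu> (\<phi> (s + t) x)" s t] by simp
  qed (use ph that in auto)
  have comm: "\<phi> t (fl 1 x) = fl 1 (\<phi> t x)" if "x \<ge> 0" for t x
    using shift[OF that, of t 1] shift[OF that, of 1 t] time1 by (simp add: add.commute)
  \<comment> \<open>The orbit of 0 never becomes negative, so it has a minimum at time 0.\<close>
  have mu0: "\<mu> 0 = 0"
  proof -
    have "\<mu> (\<phi> 0 0) = 0"
      by (rule DERIV_local_min[OF ph(3)[of 0 0], of 1]) (use ph in auto)
    with ph(1) show ?thesis by simp
  qed
  define \<rho> where "\<rho> s = \<mu> (\<psi> s) / \<psi>1 s" for s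
  have mu_psi: "\<mu> (\<psi> s) = \<rho> s * \<psi>1 s" for s using pos1[of s] by (simp add: \<rho>_def)
  \<comment> \<open>Both sides of \<open>\<phi> t (fl 1 x) = fl 1 (\<phi> t x)\<close> are
    differentiated at \<open>t = 0\<close>.\<close>
  have rho1: "\<rho> (s + 1) = \<rho> s" for s
  proof -
    have p: "\<psi> s \<ge> 0" using pos[of s] by simp
    have "DERIV (\<lambda>t. \<phi> t (fl 1 (\<psi> s))) 0 :> \<mu> (\<phi> 0 (fl 1 (\<psi> s)))"
      by (rule ph(3)) (rule fl_nonneg[OF p])
    then have d1: "DERIV (\<lambda>t. fl 1 (\<phi> t (\<psi> s))) 0 :> \<mu> (\<psi> (s + 1))"
      using ph(1)[OF fl_nonneg[OF p]] by (simp add: comm[OF p, unfolded fl_psi] ph(1)[OF p])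
    have "DERIV (\<lambda>t. \<phi> t (\<psi> s)) 0 :> \<mu> (\<psi> s)"
      using ph(3)[OF p, of 0] ph(1)[OF p] by simp
    moreover have "(fl 1 has_real_derivative \<psi>1 (s + 1) / \<psi>1 s) (at (\<phi> 0 (\<psi> s)))"
      using fl_DERIV[OF pos, of 1 s] ph(1)[OF p] by simp
    ultimately have "DERIV (\<lambda>t. fl 1 (\<phi> t (\<psi> s))) 0 :> \<psi>1 (s + 1) / \<psi>1 s * \<mu> (\<psi> s)"
      by (rule DERIV_chain2[rotated])
    with d1 have "\<mu> (\<psi> (s + 1)) = \<psi>1 (s + 1) / \<psi>1 s * \<mu> (\<psi> s)" by (rule DERIV_unique)
    then show ?thesis using pos1[of "s + 1"] by (simp add: \<rho>_def field_simps)
  qed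
  have rho_n: "\<rho> (s - real n) = \<rho> s" for s n
  proof (induction n)
    case (Suc n)
    then show ?case using rho1[of "s - real (Suc n)"] by (simp add: algebra_simps)
  qed simp
  obtain \<mu>' where \<mu>': "\<And>x. x \<in> {0..} \<Longrightarrow> (\<mu> has_real_derivative \<mu>' x) (at x within {0..})"
    "continuous_on {0..} \<mu>'" by (rule Cn_on_1E[OF C1'], rule that)
  have mu'_at: "DERIV \<mu> x :> \<mu>' x" if "x > 0" for x
    using \<mu>'(1)[of x] that at_half_line[OF that] by simp
  define D where "D s = \<mu>' (\<psi> s) - \<rho> s * (\<psi>2 s / \<psi>1 s)" for s
  have rho': "DERIV \<rho> s :> D s" for s
  proof -
    have "DERIV \<rho> s :> (\<mu>' (\<psi> s) * \<psi>1 s * \<psi>1 s - \<mu> (\<psi> s) * \<psi>2 s) / (\<psi>1 s * \<psi>1 s)"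
      unfolding \<rho>_def using pos1[of s]
      by (intro DERIV_divide DERIV_chain2[OF mu'_at[OF pos] der] der1) simp
    moreover have "(\<mu>' (\<psi> s) * \<psi>1 s * \<psi>1 s - \<mu> (\<psi> s) * \<psi>2 s) / (\<psi>1 s * \<psi>1 s) = D s"
      using pos1[of s] by (simp add: D_def \<rho>_def field_simps)
    ultimately show ?thesis by simp
  qed
  have D_eq: "D s = \<mu>' 0" for s
  proof -
    have "D (s - real n) = D s" for n
    proof -
      have "DERIV (\<lambda>s. \<rho> (s - real n)) s :> D (s - real n)"
        using rho'[of "s - real n"] DERIV_shift[of \<rho> "D (s - real n)" s "- real n"] by simp
      with rho'[of s] show ?thesis using DERIV_unique by (fastforce simp: rho_n)
    qed
    then have "(\<lambda>n. D (s - real n)) \<longlonglongrightarrow> D s" by simp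
    moreover have "(\<lambda>n. D (s - real n)) \<longlonglongrightarrow> \<mu>' 0"
    proof -
      have "(\<mu>' \<longlongrightarrow> \<mu>' 0) (at_right 0)"
        using \<mu>'(2)[unfolded continuous_on_def, rule_format, of 0] by (simp add: at_0_half_line)
      then have "((\<lambda>s. \<mu>' (\<psi> s)) \<longlongrightarrow> \<mu>' 0) at_bot" by (rule filterlim_compose[OF _ psi_at_right])
      then have "((\<lambda>z. \<mu>' (\<psi> z) - \<rho> s * (\<psi>2 z / \<psi>1 z)) \<longlongrightarrow> \<mu>' 0 - \<rho> s * 0) at_bot"
        by (intro tendsto_diff tendsto_mult_left lim2)
      from filterlim_compose[OF this filterlim_minus_real_at_bot[of s]]
      show ?thesis by (simp add: D_def rho_n)
    qed
    ultimately show ?thesis by (rule LIMSEQ_unique)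
  qed
  have "DERIV (\<lambda>s. \<rho> s - \<mu>' 0 * s) s :> 0" for s
    using DERIV_diff[OF rho'[of s] DERIV_cmult_Id[of "\<mu>' 0"]] by (simp add: D_eq)
  then have *: "\<rho> s - \<mu>' 0 * s = \<rho> 0 - \<mu>' 0 * 0" for s
    using DERIV_isconst_all[of "\<lambda>s. \<rho> s - \<mu>' 0 * s" s 0] by blast
  have "\<mu>' 0 = 0" using *[of 1] rho1[of 0] by simp
  then have rho_const: "\<rho> s = \<rho> 0" for s using *[of s] by simp
  have mu_nu: "\<mu> x = \<rho> 0 * \<nu> x" if "x \<ge> 0" for x
    using that
  proof (cases rule: half_line_cases)
    case (2 s)
    then show ?thesis using mu_psi[of s] rho_const[of s] by simp
  qed (simp add: mu0)
  have "\<phi> t x = fl (\<rho> 0 * t) x" if "x \<ge> 0" for t x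
  proof (rule ODE_unique_C1[OF C1', of "\<lambda>t. \<phi> t x" "\<lambda>t. fl (\<rho> 0 * t) x"])
    fix t
    have "DERIV (\<lambda>t. fl (\<rho> 0 * t) x) t :> \<nu> (fl (\<rho> 0 * t) x) * \<rho> 0"
      by (rule DERIV_chain2[of "\<lambda>t. fl t x"])
        (use is_flow_fl that DERIV_cmult_Id in \<open>auto simp: is_flow_def\<close>)
    then show "DERIV (\<lambda>t. fl (\<rho> 0 * t) x) t :> \<mu> (fl (\<rho> 0 * t) x)"
      using mu_nu[OF fl_nonneg[OF that]] by (simp add: mult.commute)
  qed (use ph that fl_nonneg fl_0 in auto)
  from this[of "\<psi> 0" 1] time1 have "\<rho> 0 = 1" using pos[of 0] by (simp add: less_imp_le)
  with mu_nu show ?thesis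
    by (intro extensionalityI[OF ext]) (auto simp: extensional_def \<nu>_def)
qed

lemma szekeres_field_eq: "szekeres_field (fl 1) = \<nu>"
  unfolding szekeres_field_def
proof (rule the_equality)
  show "\<nu> \<in> extensional {0..} \<and> Cr_on 1 \<nu> {0..} \<and> (\<exists>\<phi>. is_flow \<nu> \<phi> \<and> \<phi> 1 = fl 1)"
    using is_flow_fl nu_C1 by (auto simp: extensional_def \<nu>_def Cr_on_1_iff simp del: Cn_on.simps)
qed (use field_unique in blast)

lemma szekeres_flow_eq: "szekeres_flow (fl 1) = fl"
  unfolding szekeres_flow_def szekeres_field_eq
  by (rule the_equality[where P = "is_flow \<nu>", OF is_flow_fl flow_unique])

lemma centralizer_times_eq: "centralizer_times r (fl 1) = {t. fl t \<in> Diff r}"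
  by (simp add: centralizer_times_def szekeres_flow_eq fl_centralizer_iff)

subsection \<open>The centralizers as groups\<close>

abbreviation Z1 :: "(real \<Rightarrow> real) monoid" where "Z1 \<equiv> centralizer_group 1 (fl 1)"

lemma centralizer_group_simps [simp]:
  "carrier Z1 = range fl"
  "fl s \<otimes>\<^bsub>Z1\<^esub> fl t = fl (s + t)"
  "\<one>\<^bsub>Z1\<^esub> = fl 0"
proof -
  show "\<one>\<^bsub>Z1\<^esub> = fl 0"
    by (rule extensionalityI[of _ "{0..}"])
      (auto simp: centralizer_group_def BijGroup_def fl_ext fl_0)
qed (simp_all add: centralizer_group_def centralizer_1_eq BijGroup_def fl_Bij fl_compose)

lemma group_centralizer_group: "group Z1"
proof (rule groupI)
  fix x assume "x \<in> carrier Z1"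
  then obtain t where "x = fl t" by auto
  then show "\<exists>y\<in>carrier Z1. y \<otimes>\<^bsub>Z1\<^esub> x = \<one>\<^bsub>Z1\<^esub>"
    by (intro bexI[of _ "fl (- t)"]) auto
qed (auto simp: add_ac)

lemma inv_centralizer_group: "inv\<^bsub>Z1\<^esub> (fl t) = fl (- t)"
  by (rule group.inv_equality[OF group_centralizer_group]) auto

lemma fl_iso: "fl \<in> iso real_group Z1"
  by (auto simp: iso_def hom_def real_group_def bij_betw_def inj_on_def dest: fl_inj)

lemma Cr_on_fl_add: "Cr_on r (fl s) {0..} \<Longrightarrow> Cr_on r (fl t) {0..} \<Longrightarrow> Cr_on r (fl (s + t)) {0..}"
  unfolding Cr_on_def
proof (intro allI impI)
  fix n assume "\<forall>n. enat n \<le> r \<longrightarrow> Cn_on n (fl s) {0..}" "\<forall>n. enat n \<le> r \<longrightarrow> Cn_on n (fl t) {0..}"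
    "enat n \<le> r"
  then have st: "Cn_on n (fl s) {0..}" "Cn_on n (fl t) {0..}" by blast+
  have "Cn_on n (\<lambda>x. fl s (fl t x)) {0..}"
    by (rule Cn_on_compose[OF st]) (auto simp: fl_nonneg)
  then show "Cn_on n (fl (s + t)) {0..}"
    by (rule Cn_on_cong[THEN iffD1, rotated]) (simp add: fl_fl)
qed

lemma centralizer_subgroup:
  assumes "1 \<le> r" shows "subgroup (centralizer r (fl 1)) Z1"
proof -
  have "Diff r \<subseteq> Diff 1" using assms by (auto simp: Diff_def Cr_on_def)
  then have sub: "centralizer r (fl 1) \<subseteq> range fl"
    unfolding centralizer_1_eq[symmetric] by (auto simp: centralizer_def)
  have eq: "fl t \<in> centralizer r (fl 1) \<longleftrightarrow> Cr_on r (fl t) {0..} \<and> Cr_on r (fl (- t)) {0..}" for t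
    by (simp add: fl_centralizer_iff fl_Diff_iff)
  have id: "Cr_on r (fl 0) {0..}"
    unfolding Cr_on_def using Cn_on_cong[of "{0..}" "fl 0" "\<lambda>x. x"] by (simp add: fl_0 Cn_on_ident)
  show ?thesis
  proof (rule subgroup.intro)
    fix x y assume "x \<in> centralizer r (fl 1)" "y \<in> centralizer r (fl 1)"
    moreover from this sub obtain s t where "x = fl s" "y = fl t" by blast
    ultimately show "x \<otimes>\<^bsub>Z1\<^esub> y \<in> centralizer r (fl 1)"
      using Cr_on_fl_add[of r "- s" "- t"] by (simp add: eq Cr_on_fl_add)
  next
    fix x assume "x \<in> centralizer r (fl 1)"
    moreover from this sub obtain t where "x = fl t" by blast
    ultimately show "inv\<^bsub>Z1\<^esub> x \<in> centralizer r (fl 1)"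
      by (simp add: inv_centralizer_group eq)
  qed (use sub eq[of 0] id in auto)
qed

end

subsection \<open>Smoothness of flows\<close>

abbreviation strip :: "(real \<times> real) set" where "strip \<equiv> {0..1} \<times> {0..}"

abbreviation slice_deriv :: "(real \<Rightarrow> real \<Rightarrow> real) \<Rightarrow> (real \<Rightarrow> real \<Rightarrow> real) \<Rightarrow> bool" where
  "slice_deriv a a' \<equiv>
     \<forall>r\<in>{0..1}. \<forall>x\<in>{0..}. (a r has_real_derivative a' r x) (at x within {0..})"

text \<open>Joint continuity on the strip, with derivatives in \<open>x\<close> alone. The parameter
  \<open>r\<close> is a fraction of the flow time; it enters because the derivative of a flow in
  \<open>x\<close> contains an integral over intermediate times.\<close>

primrec param_Cn :: "nat \<Rightarrow> (real \<Rightarrow> real \<Rightarrow> real) \<Rightarrow> bool" where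
  "param_Cn 0 a \<longleftrightarrow> continuous_on strip (case_prod a)"
| "param_Cn (Suc n) a \<longleftrightarrow> continuous_on strip (case_prod a) \<and>
     (\<exists>a'. slice_deriv a a' \<and> param_Cn n a')"

lemma param_Cn_cont: "param_Cn n a \<Longrightarrow> continuous_on strip (case_prod a)"
  by (cases n) auto

lemma param_Cn_SucI:
  "continuous_on strip (case_prod a) \<Longrightarrow>
   (\<And>r x. r \<in> {0..1} \<Longrightarrow> x \<in> {0..} \<Longrightarrow> (a r has_real_derivative a' r x) (at x within {0..})) \<Longrightarrow>
   param_Cn n a' \<Longrightarrow> param_Cn (Suc n) a"
  unfolding param_Cn.simps by (intro conjI exI[of _ a'] ballI)

lemma param_Cn_SucE:
  assumes "param_Cn (Suc n) a"
  obtains a' where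
    "slice_deriv a a'"
    "param_Cn n a'"
proof -
  from assms obtain a' where "slice_deriv a a'" "param_Cn n a'"
    unfolding param_Cn.simps by (elim exE conjE)
  then show thesis by (rule that)
qed

lemma param_Cn_SucD: "param_Cn (Suc n) a \<Longrightarrow> param_Cn n a"
proof (induction n arbitrary: a)
  case (Suc n)
  obtain a' where a': "slice_deriv a a'"
    "param_Cn (Suc n) a'" by (rule param_Cn_SucE[OF Suc.prems], rule that)
  show ?case
    by (rule param_Cn_SucI[OF param_Cn_cont[OF Suc.prems] a'(1)[rule_format] Suc.IH[OF a'(2)]])
qed simp

lemma param_Cn_slice: "param_Cn n a \<Longrightarrow> r \<in> {0..1} \<Longrightarrow> Cn_on n (a r) {0..}"
proof (induction n arbitrary: a)
  case 0
  have "continuous_on {0..} (\<lambda>x. (case_prod a) (r, x))"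
    by (rule continuous_on_compose2[OF 0(1)[unfolded param_Cn.simps]])
      (use 0 in \<open>auto intro!: continuous_intros\<close>)
  then show ?case by simp
next
  case (Suc n)
  obtain a' where a': "slice_deriv a a'"
    "param_Cn n a'" by (rule param_Cn_SucE[OF Suc.prems(1)], rule that)
  show ?case
    by (rule Cn_on_SucI[OF a'(1)[rule_format, OF Suc.prems(2)] Suc.IH[OF a'(2) Suc.prems(2)]])
qed

lemma param_Cn_const_param: "Cn_on n A {0..} \<Longrightarrow> param_Cn n (\<lambda>r. A)"
proof (induction n arbitrary: A)
  case 0
  have "continuous_on strip (\<lambda>p::real \<times> real. A (snd p))"
    by (rule continuous_on_compose2[OF 0[unfolded Cn_on.simps]]) (auto intro!: continuous_intros)
  then show ?case by (simp add: case_prod_beta)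
next
  case (Suc n)
  then obtain A' where A': "\<forall>x\<in>{0..}. (A has_real_derivative A' x) (at x within {0..})" "Cn_on n A' {0..}"
    unfolding Cn_on.simps by (elim exE conjE)
  have "continuous_on strip (\<lambda>p::real \<times> real. A (snd p))"
    by (rule continuous_on_compose2[OF Cn_on_cont[OF Suc.prems]]) (auto intro!: continuous_intros)
  then show ?case
    by (intro param_Cn_SucI[OF _ _ Suc.IH[OF A'(2)]])
      (use A'(1) in \<open>auto simp: case_prod_beta\<close>)
qed

lemma param_Cn_param: "param_Cn n (\<lambda>r x. r)"
proof (cases n)
  case (Suc m)
  show ?thesis unfolding Suc
    by (rule param_Cn_SucI[OF _ _ param_Cn_const_param[OF Cn_on_const[of m 0]]])
      (auto simp: case_prod_beta intro!: continuous_intros)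
qed (auto simp: case_prod_beta intro!: continuous_intros)

lemma param_continuous_add:
  assumes "continuous_on D (case_prod a)" "continuous_on D (case_prod b)"
  shows "continuous_on D (\<lambda>(r, x). a r x + b r x :: real)"
  using continuous_on_add[OF assms] by (simp add: case_prod_beta)

lemma param_continuous_mult:
  assumes "continuous_on D (case_prod a)" "continuous_on D (case_prod b)"
  shows "continuous_on D (\<lambda>(r, x). a r x * b r x :: real)"
  using continuous_on_mult[OF assms] by (simp add: case_prod_beta)

lemma param_Cn_add: "param_Cn n a \<Longrightarrow> param_Cn n b \<Longrightarrow> param_Cn n (\<lambda>r x. a r x + b r x)"
proof (induction n arbitrary: a b)
  case 0
  then show ?case by (simp add: param_continuous_add)
next
  case (Suc n)
  obtain a' where a': "slice_deriv a a'"
    "param_Cn n a'" by (rule param_Cn_SucE[OF Suc.prems(1)], rule that)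
  obtain b' where b': "slice_deriv b b'"
    "param_Cn n b'" by (rule param_Cn_SucE[OF Suc.prems(2)], rule that)
  show ?case
    by (rule param_Cn_SucI[OF param_continuous_add[OF Suc.prems[THEN param_Cn_cont]]
          DERIV_add[OF a'(1)[rule_format] b'(1)[rule_format]] Suc.IH[OF a'(2) b'(2)]])
qed

lemma param_Cn_mult: "param_Cn n a \<Longrightarrow> param_Cn n b \<Longrightarrow> param_Cn n (\<lambda>r x. a r x * b r x)"
proof (induction n arbitrary: a b)
  case 0
  then show ?case by (simp add: param_continuous_mult)
next
  case (Suc n)
  obtain a' where a': "slice_deriv a a'"
    "param_Cn n a'" by (rule param_Cn_SucE[OF Suc.prems(1)], rule that)
  obtain b' where b': "slice_deriv b b'"
    "param_Cn n b'" by (rule param_Cn_SucE[OF Suc.prems(2)], rule that)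
  show ?case
    by (rule param_Cn_SucI[OF param_continuous_mult[OF Suc.prems[THEN param_Cn_cont]]
          DERIV_mult'[OF a'(1)[rule_format] b'(1)[rule_format]]
          param_Cn_add[OF Suc.IH[OF param_Cn_SucD[OF Suc.prems(1)] b'(2)]
            Suc.IH[OF a'(2) param_Cn_SucD[OF Suc.prems(2)]]]])
qed

lemma param_Cn_compose:
  "Cn_on n u T \<Longrightarrow> param_Cn n a \<Longrightarrow> (\<And>r x. r \<in> {0..1} \<Longrightarrow> x \<in> {0..} \<Longrightarrow> a r x \<in> T) \<Longrightarrow>
   param_Cn n (\<lambda>r x. u (a r x))"
proof (induction n arbitrary: u a)
  case 0
  have "continuous_on strip (\<lambda>p. u ((case_prod a) p))"
    by (rule continuous_on_compose2[OF Cn_on_cont[OF 0(1)] param_Cn_cont[OF 0(2)]])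
      (use 0(3) in auto)
  then show ?case by (simp add: case_prod_beta)
next
  case (Suc n)
  obtain u' where u': "\<forall>x\<in>T. (u has_real_derivative u' x) (at x within T)" "Cn_on n u' T"
    using Suc.prems(1) unfolding Cn_on.simps by (elim exE conjE)
  obtain a' where a': "slice_deriv a a'"
    "param_Cn n a'" by (rule param_Cn_SucE[OF Suc.prems(2)], rule that)
  have "continuous_on strip (\<lambda>p. u ((case_prod a) p))"
    by (rule continuous_on_compose2[OF Cn_on_cont[OF Suc.prems(1)]
            param_Cn_cont[OF Suc.prems(2)]])
      (use Suc.prems(3) in auto)
  then have c: "continuous_on strip (\<lambda>(r, x). u (a r x))" by (simp add: case_prod_beta)
  have d: "((\<lambda>x. u (a r x)) has_real_derivative u' (a r x) * a' r x) (at x within {0..})"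
    if "r \<in> {0..1}" "x \<in> {0..}" for r x
  proof -
    have "(u has_real_derivative u' (a r x)) (at (a r x) within T)" using u'(1) Suc.prems(3) that by blast
    moreover have "a r ` {0..} \<subseteq> T" using Suc.prems(3) that(1) by blast
    ultimately have "(u has_real_derivative u' (a r x)) (at (a r x) within a r ` {0..})"
      by (rule DERIV_subset)
    from DERIV_image_chain[OF this a'(1)[rule_format, OF that]] show ?thesis by (simp add: o_def)
  qed
  show ?case
    by (rule param_Cn_SucI[OF c d param_Cn_mult[OF
          Suc.IH[OF u'(2) param_Cn_SucD[OF Suc.prems(2)] Suc.prems(3)] a'(2)]])
qed

text \<open>Differentiation under the integral sign. The product \<open>r * u\<close> stays in
  [0, 1], so the integrand is only evaluated on the strip.\<close>

lemma param_Cn_integral: "param_Cn n b \<Longrightarrow> param_Cn n (\<lambda>r x. integral {0..1} (\<lambda>u. b (r * u) x))"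
proof -
  have c: "continuous_on strip (\<lambda>(r, x). integral {0..1} (\<lambda>u. b (r * u) x))"
    if "continuous_on strip (case_prod b)" for b :: "real \<Rightarrow> real \<Rightarrow> real"
  proof -
    have "continuous_on ((strip) \<times> cbox (0::real) 1) (\<lambda>q. (case_prod b) (fst (fst q) * snd q, snd (fst q)))"
      by (rule continuous_on_compose2[OF that])
        (auto intro!: continuous_intros mult_nonneg_nonneg mult_le_one)
    then have "continuous_on strip (\<lambda>p. integral (cbox 0 1) (\<lambda>u. b (fst p * u) (snd p)))"
      by (intro integral_continuous_on_param) (simp add: case_prod_beta)
    then show ?thesis by (simp add: case_prod_beta)
  qed
  have c2: "continuous_on ({0..} \<times> {0..1}) (\<lambda>(x, t). b (r * t) x)"
    if "continuous_on strip (case_prod b)" "r \<in> {0..1}" for b :: "real \<Rightarrow> real \<Rightarrow> real" and r :: real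
  proof -
    have "continuous_on ({0..} \<times> {0..1}) (\<lambda>q. (case_prod b) (r * snd q, fst q))"
      by (rule continuous_on_compose2[OF that(1)])
        (use that(2) in \<open>auto intro!: continuous_intros mult_nonneg_nonneg mult_le_one\<close>)
    then show ?thesis by (simp add: case_prod_beta)
  qed
  show "param_Cn n b \<Longrightarrow> param_Cn n (\<lambda>r x. integral {0..1} (\<lambda>u. b (r * u) x))"
  proof (induction n arbitrary: b)
    case 0
    then show ?case using c by simp
  next
    case (Suc n)
    obtain b' where b': "slice_deriv b b'"
      "param_Cn n b'" by (rule param_Cn_SucE[OF Suc.prems(1)], rule that)
    note cb = param_Cn_cont[OF Suc.prems] param_Cn_cont[OF b'(2)]
    have "((\<lambda>x. integral {0..1} (\<lambda>u. b (r * u) x)) has_real_derivative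
        integral {0..1} (\<lambda>u. b' (r * u) x)) (at x within {0..})" if r: "r \<in> {0..1}" and x: "x \<in> {0..}" for r x
      unfolding interval_cbox
    proof (rule leibniz_rule_field_derivative)
      show "continuous_on ({0..} \<times> cbox 0 1) (\<lambda>(x, t). b' (r * t) x)"
        using c2[OF cb(2) r] by simp
      fix y :: real assume y: "y \<in> {0..}"
      show "(\<lambda>u. b (r * u) y) integrable_on cbox 0 1"
      proof (rule integrable_continuous)
        have "continuous_on (cbox 0 1) (\<lambda>u. (\<lambda>(x, t). b (r * t) x) (y, u))"
          by (rule continuous_on_compose2[OF c2[OF cb(1) r]]) (use y in \<open>auto intro!: continuous_intros\<close>)
        then show "continuous_on (cbox 0 1) (\<lambda>u. b (r * u) y)" by simp
      qed
      fix t :: real assume t: "t \<in> cbox 0 1"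
      have "r * t \<in> {0..1}" using r t by (auto intro: mult_nonneg_nonneg mult_le_one)
      then show "((\<lambda>x. b (r * t) x) has_real_derivative b' (r * t) y) (at y within {0..})"
        using b'(1) y by blast
    qed (use x in auto)
    then show ?case
      by (intro param_Cn_SucI[OF c[OF cb(1)] _ Suc.IH[OF b'(2)]])
  qed
qed

context time_coordinate
begin

text \<open>With \<open>a r x = fl (r * A x) x\<close>, the variational equation gives
  \<open>\<partial>\<^sub>x a = r A' \<nu>(a) + exp (r A \<integral> \<nu>'(a (r u) x) du)\<close>, so that \<open>a\<close> gains a derivative at each turn.\<close>

lemma smooth_fl_variable_time:
  assumes nu: "\<And>n. Cn_on n \<nu> {0..}" and A: "\<And>n. Cn_on n A {0..}"
  shows "Cn_on n (\<lambda>x. fl (A x) x) {0..}"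
proof -
  obtain \<nu>' where \<nu>': "\<And>x. x \<ge> 0 \<Longrightarrow> (\<nu> has_real_derivative \<nu>' x) (at x within {0..})"
    "\<And>n. Cn_on n \<nu>' {0..}" by (rule smooth_half_line_derivative[OF nu], rule that)
  obtain A' where A': "\<And>x. x \<ge> 0 \<Longrightarrow> (A has_real_derivative A' x) (at x within {0..})"
    "\<And>n. Cn_on n A' {0..}" by (rule smooth_half_line_derivative[OF A], rule that)
  have nu'_psi: "\<nu>' (\<psi> s) = \<psi>2 s / \<psi>1 s" for s
    using \<nu>'(1)[OF less_imp_le[OF pos[of s]]] nu_DERIV[OF pos[of s]]
    by (auto simp: at_half_line[OF pos] intro: DERIV_unique)
  define a where "a r x = fl (r * A x) x" for r x
  have a_nonneg: "a r x \<in> {0..}" if "x \<in> {0..}" for r x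
    using fl_nonneg that by (simp add: a_def)
  have cont: "continuous_on strip (case_prod a)"
  proof (rule continuous_on_eq_continuous_within[THEN iffD2], intro ballI)
    fix p :: "real \<times> real" assume p: "p \<in> strip"
    obtain r0 x0 where p_eq: "p = (r0, x0)" by (cases p)
    show "continuous (at p within strip) (case_prod a)"
    proof (cases "x0 > 0")
      case True
      have ct: "continuous_on ({0..1} \<times> {0<..}) (\<lambda>p::real\<times>real. \<tau> (snd p))"
        by (rule continuous_on_compose2[of "{0<..}" \<tau>])
          (auto intro!: continuous_intros continuous_at_imp_continuous_on isCont_tau)
      have cA: "continuous_on ({0..1} \<times> {0<..}) (\<lambda>p::real\<times>real. A (snd p))"
        by (rule continuous_on_compose2[OF Cn_on_cont[OF A[of 0]]])
          (auto intro!: continuous_intros)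
      have "continuous_on ({0..1} \<times> {0<..}) (\<lambda>p. \<psi> (\<tau> (snd p) + fst p * A (snd p)))"
        by (rule continuous_on_compose2[OF continuous_at_imp_continuous_on[of UNIV \<psi>]])
          (auto intro!: continuous_intros ct cA isCont_psi)
      then have "continuous_on ({0..1} \<times> {0<..}) (case_prod a)"
        by (rule continuous_on_eq) (auto simp: a_def fl_def)
      moreover have "p \<in> {0..1} \<times> {0<..}" using p p_eq True by auto
      ultimately have "continuous (at p within {0..1} \<times> {0<..}) (case_prod a)"
        by (simp only: continuous_on_eq_continuous_within)
      moreover have "at p within {0..1} \<times> {0<..} = at p within strip"
        by (rule at_within_nhd[of _ "UNIV \<times> {0<..}"]) (use p_eq True in \<open>auto intro!: open_Times\<close>)
      ultimately show ?thesis by simp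
    next
      case False
      with p p_eq have x0: "x0 = 0" by auto
      \<comment> \<open>For \<open>x \<le> 1\<close> all times \<open>r * A x\<close> are at most
        \<open>M\<close>, so by monotonicity of \<open>\<psi>\<close> the value of \<open>a\<close>
        is at most \<open>\<psi> (\<tau> x + M)\<close>, which tends to 0 with \<open>x\<close>,
        uniformly in \<open>r\<close>.\<close>
      have "bounded (A ` {0..1})"
        by (intro compact_imp_bounded compact_continuous_image continuous_on_subset[OF Cn_on_cont[OF A[of 0]]]) auto
      then obtain M where M: "\<And>x. x \<in> {0..1} \<Longrightarrow> \<bar>A x\<bar> \<le> M" unfolding bounded_real by blast
      have lim: "((\<lambda>x. \<psi> (\<tau> x + M)) \<longlongrightarrow> 0) (at_right 0)"
        by (rule filterlim_compose[OF lim_bot filterlim_compose[OF filterlim_add_at_bot tau_at_bot]])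
      have "((case_prod a) \<longlongrightarrow> 0) (at p within strip)"
      proof (rule tendstoI)
        fix e :: real assume "e > 0"
        from order_tendstoD(2)[OF lim this] obtain d where d: "d > 0" "\<And>x. 0 < x \<Longrightarrow> x < d \<Longrightarrow> \<psi> (\<tau> x + M) < e"
          unfolding eventually_at_right_field by blast
        have "dist (a r x) 0 < e" if rx: "r \<in> {0..1}" "x \<in> {0..}" "dist (r, x) p < min d 1" for r x
        proof (cases "x = 0")
          case True
          then show ?thesis using \<open>e > 0\<close> by (simp add: a_def)
        next
          case False
          have "\<bar>x\<bar> \<le> dist (r, x) p" using dist_snd_le[of "(r, x)" p] p_eq x0 by (simp add: dist_real_def)
          with rx False have x: "0 < x" "x < d" "x \<le> 1" by auto
          have "\<bar>r * A x\<bar> \<le> 1 * M" unfolding abs_mult using rx x M[of x] by (intro mult_mono) auto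
          then have "\<psi> (\<tau> x + r * A x) \<le> \<psi> (\<tau> x + M)"
            by (simp add: strict_mono_less_eq[OF strict_mono_psi])
          also have "\<dots> < e" using d(2) x by blast
          finally show ?thesis using x(1) pos[of "\<tau> x + r * A x"] by (simp add: a_def fl_def)
        qed
        then show "\<forall>\<^sub>F q in at p within strip. dist (case q of (r, x) \<Rightarrow> a r x) 0 < e"
          unfolding eventually_at using d(1) by (intro exI[of _ "min d 1"]) auto
      qed
      then show ?thesis using p_eq x0 by (simp add: continuous_within a_def)
    qed
  qed
  define R where "R r x = r * A' x * \<nu> (a r x) +
      exp (r * A x * integral {0..1} (\<lambda>u. \<nu>' (a (r * u) x)))" for r x
  have R_Cn: "param_Cn n R" if "param_Cn n a" for n
  proof -
    have "param_Cn n (\<lambda>r x. r * A x * integral {0..1} (\<lambda>u. \<nu>' (a (r * u) x)))"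
      by (rule param_Cn_mult[OF param_Cn_mult[OF param_Cn_param param_Cn_const_param[OF A]]
            param_Cn_integral[OF param_Cn_compose[OF \<nu>'(2) that a_nonneg]]])
    from param_Cn_add[OF param_Cn_mult[OF param_Cn_mult[OF param_Cn_param param_Cn_const_param[OF A'(2)]]
          param_Cn_compose[OF nu that a_nonneg]] param_Cn_compose[OF Cn_on_exp[of n UNIV] this]]
    show ?thesis unfolding R_def by simp
  qed
  have der_pos: "DERIV (a r) x :> R r x" if x: "x > 0" for r x
  proof -
    define s where "s = \<tau> x"
    have xs: "x = \<psi> s" using x by (simp add: s_def)
    have "DERIV (\<lambda>x. \<psi> (\<tau> x + r * A x)) x :> \<psi>1 (s + r * A x) * (1 / \<psi>1 s + r * A' x)"
    proof (rule DERIV_chain2[where f = \<psi>])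
      show "DERIV \<psi> (\<tau> x + r * A x) :> \<psi>1 (s + r * A x)" using der by (simp add: s_def)
      have "DERIV A x :> A' x" using A'(1)[of x] x by (simp add: at_half_line[OF x])
      from DERIV_add[OF DERIV_tau[OF x] DERIV_cmult[OF this, of r]]
      show "DERIV (\<lambda>x. \<tau> x + r * A x) x :> 1 / \<psi>1 s + r * A' x" by (simp add: s_def)
    qed
    moreover have "\<forall>\<^sub>F y in nhds x. \<psi> (\<tau> y + r * A y) = a r y"
      using eventually_nhds_in_open[of "{0<..}" x] x by (auto simp: a_def fl_def elim: eventually_mono)
    ultimately have d: "DERIV (a r) x :> \<psi>1 (s + r * A x) * (1 / \<psi>1 s + r * A' x)"
      by (simp add: DERIV_cong_ev)
    \<comment> \<open>The integrand is the derivative of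
      \<open>ln (\<psi>1 (s + u * (r * A x)))\<close> in \<open>u\<close>. So the exponential in
      \<open>R\<close> equals \<open>\<psi>1 (s + r * A x) / \<psi>1 s\<close>, the space derivative
      of the flow at a fixed time; unlike this quotient, it makes sense and is continuous up to
      \<open>x = 0\<close>.\<close>
    have "((\<lambda>u. r * A x * \<nu>' (a (r * u) x)) has_integral
        ln (\<psi>1 (s + 1 * (r * A x))) - ln (\<psi>1 (s + 0 * (r * A x)))) {0..1}"
    proof (rule fundamental_theorem_of_calculus)
      fix u :: real
      have "DERIV (\<lambda>u. ln (\<psi>1 (s + u * (r * A x)))) u :> 1 / \<psi>1 (s + u * (r * A x)) * (\<psi>2 (s + u * (r * A x)) * (r * A x))"
        by (rule DERIV_chain2[where f = ln and g = "\<lambda>u. \<psi>1 (s + u * (r * A x))", OF DERIV_ln_divide[OF pos1]],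
            rule DERIV_chain2[where f = \<psi>1, OF der1])
          (auto intro!: derivative_eq_intros)
      moreover have "1 / \<psi>1 (s + u * (r * A x)) * (\<psi>2 (s + u * (r * A x)) * (r * A x)) = r * A x * \<nu>' (a (r * u) x)"
      proof -
        have "a (r * u) x = \<psi> (s + u * (r * A x))" by (simp add: a_def xs mult_ac)
        then show ?thesis by (simp add: nu'_psi)
      qed
      ultimately show "((\<lambda>u. ln (\<psi>1 (s + u * (r * A x)))) has_vector_derivative r * A x * \<nu>' (a (r * u) x))
          (at u within {0..1})"
        by (simp add: has_real_derivative_iff_has_vector_derivative[symmetric] has_field_derivative_at_within)
    qed simp
    then have "((\<lambda>u. r * A x * \<nu>' (a (r * u) x)) has_integral
        ln (\<psi>1 (s + r * A x)) - ln (\<psi>1 s)) {0..1}" by simp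
    from integral_unique[OF this]
    have "r * A x * integral {0..1} (\<lambda>u. \<nu>' (a (r * u) x)) = ln (\<psi>1 (s + r * A x)) - ln (\<psi>1 s)"
      by (simp only: integral_mult_right)
    then have "exp (r * A x * integral {0..1} (\<lambda>u. \<nu>' (a (r * u) x))) = \<psi>1 (s + r * A x) / \<psi>1 s"
      using pos1 by (simp add: exp_diff)
    moreover have "\<nu> (a r x) = \<psi>1 (s + r * A x)" by (simp add: a_def xs)
    ultimately have "R r x = \<psi>1 (s + r * A x) * (1 / \<psi>1 s + r * A' x)"
      by (simp add: R_def algebra_simps)
    with d show ?thesis by simp
  qed
  have slice: "continuous_on {0..} (f r)" if "continuous_on strip (case_prod f)" "r \<in> {0..1}"
    for f :: "real \<Rightarrow> real \<Rightarrow> real" and r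
    using param_Cn_slice[of 0 f r] that by simp
  have der: "(a r has_real_derivative R r x) (at x within {0..})" if r: "r \<in> {0..1}" and x: "x \<in> {0..}" for r x
  proof (cases "x = 0")
    case True
    have "param_Cn 0 R" by (rule R_Cn) (use cont in simp)
    then have "continuous_on {0..} (R r)" using slice[of R] r by simp
    then have "(R r \<longlongrightarrow> R r 0) (at 0 within {0..})" unfolding continuous_on_def by simp
    with True show ?thesis
      by (intro has_real_derivative_limit[OF slice[OF cont r], of x "R r"])
        (auto simp: is_interval_ci intro: der_pos)
  next
    case False
    with x show ?thesis using der_pos[of x r] by (simp add: has_field_derivative_at_within)
  qed
  have "param_Cn n a" for n
  proof (induction n)
    case (Suc n)
    show ?case by (rule param_Cn_SucI[OF cont der R_Cn[OF Suc]])
  qed (use cont in simp)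
  from param_Cn_slice[OF this, of 1] show ?thesis by (simp add: a_def[abs_def])
qed

end

section \<open>Good rational approximations of a Liouville number\<close>

text \<open>The diophantine condition fails with exponent \<open>k\<close> and a constant small
  enough to exclude all denominators up to \<open>N\<close>. Reducing the fraction lowers the
  denominator, and as the exponent is negative the estimate survives.\<close>

lemma Liouville_approximation:
  assumes "Liouville \<alpha>"
  shows "\<exists>p q. coprime p (int q) \<and> q > N \<and> \<bar>real q * \<alpha> - of_int p\<bar> \<le> 1 / real q ^ k"
proof -
  have irr: "\<alpha> \<notin> \<rat>" and nd: "\<not> diophantine \<alpha>" using assms by (auto simp: Liouville_def)
  have nz: "real q * \<alpha> \<noteq> of_int p" if "q > 0" for q :: nat and p :: int
  proof
    assume "real q * \<alpha> = of_int p"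
    then have "\<alpha> = of_int p / of_nat q" using that by (simp add: field_simps)
    then have "\<alpha> \<in> \<rat>" by simp
    with irr show False by simp
  qed
  define d where "d q = \<bar>real q * \<alpha> - of_int (round (real q * \<alpha>))\<bar> / real q" for q :: nat
  \<comment> \<open>The least distance from \<open>\<alpha>\<close> to a fraction with denominator
    at most \<open>N\<close>, positive by irrationality; the cap 1 lets \<open>c\<close> be dropped
    from the final bound.\<close>
  define c where "c = Min (insert 1 (d ` {1..N}))"
  have "c > 0" unfolding c_def using nz by (subst Min_gr_iff) (auto simp: d_def)
  have cd: "c \<le> d q" if "q \<in> {1..N}" for q
    using that unfolding c_def by (intro Min_le) auto
  have c1: "c \<le> 1" unfolding c_def by (intro Min_le) auto
  have "\<exists>p q :: int. q \<ge> 1 \<and> \<bar>\<alpha> - of_int p / of_int q\<bar> < c * of_int q powr (- 2 - real k)"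
    using nd \<open>c > 0\<close> unfolding diophantine_def
    by (metis not_le of_nat_0_le_iff)
  then obtain p0 q0 :: int where q0: "q0 \<ge> 1"
    and less0: "\<bar>\<alpha> - of_int p0 / of_int q0\<bar> < c * of_int q0 powr (- 2 - real k)" by blast
  define g where "g = gcd p0 q0"
  define p q' where "p = p0 div g" and "q' = q0 div g"
  have g: "g > 0" using q0 by (simp add: g_def)
  have eqs: "p0 = g * p" "q0 = g * q'" by (auto simp: p_def q'_def g_def)
  have q'1: "q' \<ge> 1" using eqs(2) q0 g by (simp add: zero_less_mult_iff int_one_le_iff_zero_less)
  have cop: "coprime p q'"
    unfolding p_def q'_def g_def using q0 by (intro div_gcd_coprime) auto
  define q where "q = nat q'"
  have q: "q' = int q" "q \<ge> 1" using q'1 by (auto simp: q_def)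
  have frac_eq: "of_int p0 / of_int q0 = (of_int p / real q :: real)"
    using g by (simp add: eqs q(1))
  have "of_int q0 powr (- 2 - real k) \<le> real q powr (- 2 - real k)"
  proof (rule powr_mono2')
    have "q' * 1 \<le> q' * g" using g q'1 by (intro mult_left_mono) auto
    then have "q' \<le> q0" using eqs(2) by (simp add: mult.commute)
    then have "real_of_int q' \<le> of_int q0" by (simp only: of_int_le_iff)
    then show "real q \<le> of_int q0" using q(1) by simp
  qed (use q in auto)
  then have "c * of_int q0 powr (- 2 - real k) \<le> c * real q powr (- 2 - real k)"
    using \<open>c > 0\<close> by (intro mult_left_mono) auto
  then have less: "\<bar>\<alpha> - of_int p / real q\<bar> < c * real q powr (- 2 - real k)"
    using less0 unfolding frac_eq by linarith
  have eq: "\<bar>\<alpha> - of_int p / real q\<bar> = \<bar>real q * \<alpha> - of_int p\<bar> / real q"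
  proof -
    have "\<alpha> - of_int p / real q = (real q * \<alpha> - of_int p) / real q" using q by (simp add: field_simps)
    then show ?thesis using q by (simp add: abs_divide)
  qed
  have "q > N"
  proof (rule ccontr)
    assume "\<not> q > N"
    then have "c \<le> d q" using q by (intro cd) auto
    also have "\<dots> \<le> \<bar>\<alpha> - of_int p / real q\<bar>"
      unfolding eq d_def by (intro divide_right_mono round_diff_minimal) auto
    also have "\<dots> < c * real q powr (- 2 - real k)" by (rule less)
    also have "\<dots> \<le> c * 1"
    proof (rule mult_left_mono)
      have "real q powr (- 2 - real k) \<le> real q powr 0" using q by (intro powr_mono) auto
      then show "real q powr (- 2 - real k) \<le> 1" using q by simp
    qed (use \<open>c > 0\<close> in simp)
    finally show False by simp
  qed
  moreover have "\<bar>real q * \<alpha> - of_int p\<bar> \<le> 1 / real q ^ k"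
  proof -
    have "\<bar>real q * \<alpha> - of_int p\<bar> \<le> real q * (c * real q powr (- 2 - real k))"
      using less q unfolding eq by (simp add: field_simps)
    also have "\<dots> \<le> real q * (1 * real q powr (- 1 - real k))"
      using c1 q by (intro mult_mono mult_left_mono powr_mono) auto
    also have "real q * (1 * real q powr (- 1 - real k)) = real q powr (1 + (- 1 - real k))"
      using q unfolding powr_add by simp
    also have "\<dots> = 1 / real q ^ k"
      using q by (simp add: powr_minus powr_realpow divide_inverse)
    finally show ?thesis .
  qed
  ultimately show ?thesis using cop q(1) by blast
qed

text \<open>In the exponent, \<open>(n + 1)\<^sup>2\<close> is what smoothness requires. Of the four
  extra powers, one absorbs a factor \<open>q n\<close>, and three make the errors summable when
  many approximations are added up.\<close>

lemma Liouville_sequence: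
  assumes "Liouville \<alpha>"
  obtains p :: "nat \<Rightarrow> int" and q :: "nat \<Rightarrow> nat" where
    "\<And>n. coprime (p n) (int (q n))" "\<And>n. real (q n) \<ge> 4 ^ (n + 1)" "\<And>n. real (q n) \<ge> B"
    "\<And>n. q n \<le> q (Suc n)" "\<And>n. \<bar>real (q n) * \<alpha> - of_int (p n)\<bar> \<le> 1 / real (q n) ^ ((n + 1)\<^sup>2 + 4)"
proof -
  define good where "good n x \<longleftrightarrow> coprime (fst x) (int (snd x)) \<and> real (snd x) \<ge> 4 ^ (n + 1) \<and>
    real (snd x) \<ge> B \<and> \<bar>real (snd x) * \<alpha> - of_int (fst x)\<bar> \<le> 1 / real (snd x) ^ ((n + 1)\<^sup>2 + 4)"
    for n and x :: "int \<times> nat"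
  have ex: "\<exists>x. good n x \<and> m \<le> snd x" for n m
  proof -
    from Liouville_approximation[OF assms, of "max m (max (4 ^ (n + 1)) (nat \<lceil>B\<rceil>))" "(n + 1)\<^sup>2 + 4"]
    obtain p q where pq: "coprime p (int q)" "q > m" "q > 4 ^ (n + 1)" "q > nat \<lceil>B\<rceil>"
      "\<bar>real q * \<alpha> - of_int p\<bar> \<le> 1 / real q ^ ((n + 1)\<^sup>2 + 4)" by auto
    have "real q \<ge> 4 ^ (n + 1)" using pq(3) by (metis less_imp_le of_nat_le_iff of_nat_numeral of_nat_power)
    moreover have "real q \<ge> B" using pq(4) by linarith
    ultimately show ?thesis using pq by (intro exI[of _ "(p, q)"]) (auto simp: good_def)
  qed
  obtain x where x: "\<And>n. good n (x n)" "\<And>n. snd (x n) \<le> snd (x (Suc n))"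
    using dependent_nat_choice[of good "\<lambda>n x y. snd x \<le> snd y"] ex by metis
  show ?thesis
    by (rule that[of "\<lambda>n. fst (x n)" "\<lambda>n. snd (x n)"]) (use x in \<open>auto simp: good_def\<close>)
qed

section \<open>Smooth steps\<close>

lemma moderate_0_ident: "moderate at_top (\<lambda>y. y) 0 (\<lambda>y. y)"
  unfolding moderate.simps
  by (intro exI[of _ 1] exI[of _ 1] eventually_mono[OF eventually_ge_at_top[of 0]]) auto

lemma moderate_ident: "moderate at_top (\<lambda>y. y) n (\<lambda>y. y)"
proof (cases n)
  case (Suc m)
  show ?thesis unfolding Suc by (rule moderate_SucI[OF moderate_0_ident DERIV_ident moderate_const])
qed (use moderate_0_ident in simp)

interpretation top_weight: growth_weight at_top "\<lambda>y. y"
  by standard (rule eventually_ge_at_top)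

interpretation unit_weight: growth_weight F "\<lambda>_. 1" for F
  by standard simp

lemma moderate_minus_square: "moderate at_top (\<lambda>y. y) n (\<lambda>y. - 1 * (y * y))"
  by (intro top_weight.moderate_mult moderate_const moderate_ident)

lemma negligible_exp_minus: "negligible at_top (\<lambda>y. y) n (\<lambda>y. exp (- y))"
proof -
  have 0: "negligible at_top (\<lambda>y. y) 0 (\<lambda>y. exp (- y))"
    using tendsto_power_div_exp_0 by (simp add: exp_minus divide_inverse)
  show ?thesis
  proof (induction n)
    case (Suc n)
    have d: "DERIV (\<lambda>y. exp (- y)) y :> exp (- y) * - 1" for y :: real
      by (auto intro!: derivative_eq_intros)
    show ?case
      by (rule negligible_SucI[OF 0 d top_weight.negligible_mult[OF Suc moderate_const]])
  qed (rule 0)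
qed

lemma DERIV_one_div: "x > 0 \<Longrightarrow> DERIV (\<lambda>x. 1 / x) x :> - 1 * (1 / x * (1 / x))" for x :: real
  by (auto intro!: derivative_eq_intros simp: power2_eq_square)

text \<open>In the coordinate \<open>y = 1 / x\<close> the operator \<open>d/dx\<close> is
  \<open>- y\<^sup>2 d/dy\<close>, whose coefficient is polynomial.\<close>

lemma smooth_one_div_coordinate:
  assumes "\<And>n. negligible at_top (\<lambda>y. y) n Q"
  shows "Cn_on n (\<lambda>x. if x > 0 then Q (1 / x) else 0) UNIV"
proof (rule top_weight.Cn_on_extend_zero[of "\<lambda>x. 1 / x", OF _ DERIV_one_div moderate_minus_square assms])
  show "filterlim (\<lambda>x::real. 1 / x) at_top (at_right 0)"
    using filterlim_inverse_at_top_right by (simp add: divide_inverse)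
qed

text \<open>The usual quotient built from \<open>exp (- 1 / x)\<close>. Its denominator is positive
  because \<open>u\<close> and \<open>1 / 2 - u\<close> are never both nonpositive.\<close>

lemma smooth_step_exists:
  obtains st :: "real \<Rightarrow> real" where "\<And>n. Cn_on n st UNIV" "\<And>u. u \<le> 0 \<Longrightarrow> st u = 0"
    "\<And>u. u \<ge> 1 / 2 \<Longrightarrow> st u = 1" "\<And>u. 0 \<le> st u" "\<And>u. st u \<le> 1"
proof -
  define e where "e x = (if x > 0 then exp (- (1 / x)) else 0)" for x :: real
  have e: "Cn_on n e UNIV" for n
    unfolding e_def by (rule smooth_one_div_coordinate[where Q = "\<lambda>y. exp (- y)"]) (rule negligible_exp_minus)
  have e_nonneg: "e x \<ge> 0" for x by (simp add: e_def)
  have pos: "e u + e (1 / 2 - u) > 0" for u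
    by (cases "u > 0") (auto simp: e_def add_pos_nonneg)
  have e2: "Cn_on n (\<lambda>u. e (1 / 2 - u)) UNIV" for n
    by (rule Cn_on_compose[OF e Cn_on_diff[OF Cn_on_const Cn_on_ident]]) simp
  show ?thesis
  proof (rule that[of "\<lambda>u. e u / (e u + e (1 / 2 - u))"])
    show "Cn_on n (\<lambda>u. e u / (e u + e (1 / 2 - u))) UNIV" for n
      by (rule Cn_on_divide[OF e Cn_on_add[OF e e2] pos])
    show "e u / (e u + e (1 / 2 - u)) = 1" if "u \<ge> 1 / 2" for u
      using that pos[of u] by (simp add: e_def)
    show "e u / (e u + e (1 / 2 - u)) \<le> 1" for u
      using pos[of u] e_nonneg[of "1 / 2 - u"] by (simp add: divide_le_eq)
  qed (use e_nonneg in \<open>auto simp: e_def\<close>)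
qed

section \<open>Composites with bounded derivatives\<close>

text \<open>A derivative written as a sine with phase advanced by \<open>pi / 2\<close> stays in the
  same family, which makes the induction work.\<close>

lemma moderate_sin: "tame F n (\<lambda>y. C * sin (k * y + b))"
proof -
  have 0: "tame F 0 (\<lambda>y. C * sin (k * y + b))" for C b
  proof -
    have "\<bar>C * sin (k * y + b)\<bar> \<le> \<bar>C\<bar> * 1 ^ 0" for y
      by (simp add: abs_mult mult_left_le)
    then show ?thesis unfolding moderate.simps by (intro exI[of _ 0] exI[of _ "\<bar>C\<bar>"]) simp
  qed
  show ?thesis
  proof (induction n arbitrary: C b)
    case (Suc n)
    have "DERIV (\<lambda>y. C * sin (k * y + b)) y :> (C * k) * sin (k * y + (b + pi / 2))" for y
    proof -
      have "sin (k * y + (b + pi / 2)) = cos (k * y + b)" by (simp add: sin_add add.assoc[symmetric])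
      then show ?thesis by (auto intro!: derivative_eq_intros)
    qed
    then show ?case by (rule moderate_SucI[OF 0 _ Suc])
  qed (rule 0)
qed

lemma tame_compose_smooth:
  assumes T: "\<forall>\<^sub>F y in F. \<bar>T y\<bar> \<le> R" "\<And>y. DERIV T y :> T' y"
  shows "Cn_on n a UNIV \<Longrightarrow> tame F n T' \<Longrightarrow> tame F n (\<lambda>y. a (T y))"
proof -
  have 0: "tame F 0 (\<lambda>y. a (T y))" if "continuous_on UNIV a" for a
  proof -
    have "bounded (a ` {-R..R})"
      using that by (intro compact_imp_bounded compact_continuous_image) (auto intro: continuous_on_subset)
    then obtain C where C: "\<And>x. x \<in> {-R..R} \<Longrightarrow> \<bar>a x\<bar> \<le> C" unfolding bounded_real by blast
    have "\<forall>\<^sub>F y in F. \<bar>a (T y)\<bar> \<le> C"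
      using T(1) by (rule eventually_mono) (intro C, simp add: abs_le_iff)
    then show ?thesis unfolding tame_0 by blast
  qed
  show "Cn_on n a UNIV \<Longrightarrow> tame F n T' \<Longrightarrow> tame F n (\<lambda>y. a (T y))"
  proof (induction n arbitrary: a)
    case (Suc n)
    obtain a' where a': "\<forall>x\<in>UNIV. (a has_real_derivative a' x) (at x within UNIV)" "Cn_on n a' UNIV"
      using Suc.prems(1) unfolding Cn_on.simps by (elim exE conjE)
    have m: "tame F n T'" using Suc.prems(2) by (rule moderate_SucD)
    have "DERIV (\<lambda>y. a (T y)) y :> a' (T y) * T' y" for y
      using a'(1) T(2) by (intro DERIV_chain2[of a]) auto
    then show ?case
      by (rule moderate_SucI[OF 0[OF Cn_on_cont[OF Suc.prems(1)]] _
            unit_weight.moderate_mult[OF Suc.IH[OF a'(2) m] m]])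
  qed (use 0 in simp)
qed

text \<open>Meant for coordinates that run off along \<open>G\<close>, such as \<open>1 / x\<close>
  along an orbit, so \<open>T\<close> itself need not be bounded. It satisfies a differential
  equation with tame right-hand side, and each derivative only brings in \<open>w (T y)\<close> and
  \<open>z y\<close>.\<close>

lemma tame_compose_coord:
  assumes T: "filterlim T G F" "\<And>y. DERIV T y :> w (T y) * z y"
    and w: "\<And>n. tame G n w"
  shows "tame G n B \<Longrightarrow> tame F n z \<Longrightarrow> tame F n (\<lambda>y. B (T y))"
proof -
  have 0: "tame F 0 (\<lambda>y. B (T y))" if "tame G 0 B" for B
  proof -
    from that obtain C where "\<forall>\<^sub>F y in G. \<bar>B y\<bar> \<le> C" unfolding tame_0 by blast
    then have "\<forall>\<^sub>F y in F. \<bar>B (T y)\<bar> \<le> C" using T(1) by (rule eventually_compose_filterlim)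
    then show ?thesis unfolding tame_0 by blast
  qed
  show "tame G n B \<Longrightarrow> tame F n z \<Longrightarrow> tame F n (\<lambda>y. B (T y))"
  proof (induction n arbitrary: B)
    case (Suc n)
    obtain B' where B': "\<And>y. DERIV B y :> B' y" "tame G n B'"
      using Suc.prems(1) by auto
    have d: "DERIV (\<lambda>y. B (T y)) y :> B' (T y) * w (T y) * z y" for y
      using DERIV_chain2[OF B'(1) T(2)] by (simp add: mult_ac)
    have z: "tame F n z" using Suc.prems(2) by (rule moderate_SucD)
    show ?case
      by (rule moderate_SucI[OF 0[OF moderate_0I[OF Suc.prems(1)]] d
            unit_weight.moderate_mult[OF Suc.IH[OF unit_weight.moderate_mult[OF B'(2) w] z] z]])
  qed (use 0 in simp)
qed

section \<open>Oscillating fields\<close>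

text \<open>For \<open>y = 1 / x\<close>: the index \<open>n\<close> of the core around
  \<open>x = 1 / n\<close> to which the point is assigned.\<close>

definition idx :: "real \<Rightarrow> nat" where "idx y = nat (round y)"

lemma idx_ge: "real (idx y) \<ge> y - 1 / 2"
  using of_int_round_ge[of y] by (simp add: idx_def)

text \<open>The nearest integer jumps only at half-integers, which are exactly the points with
  cosine \<open>- 1\<close>.\<close>

lemma eventually_idx_const:
  assumes "isCont Y s" "cos (2 * pi * Y s) > - 1"
  shows "\<forall>\<^sub>F r in nhds s. idx (Y r) = idx (Y s)"
proof -
  have "Y s + 1 / 2 \<notin> \<int>"
  proof
    assume "Y s + 1 / 2 \<in> \<int>"
    then obtain k where "Y s + 1 / 2 = of_int k" by (auto elim: Ints_cases)
    then have Ys: "Y s = of_int k - 1 / 2" by linarith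
    have "2 * pi * Y s = 2 * pi * of_int k - pi" unfolding Ys by (simp add: algebra_simps)
    then have "cos (2 * pi * Y s) = cos (2 * pi * of_int k - pi)" by simp
    also have "\<dots> = - 1" by (simp add: cos_diff)
    finally show False using assms(2) by simp
  qed
  moreover have "((\<lambda>r. Y r + 1 / 2) \<longlongrightarrow> Y s + 1 / 2) (nhds s)"
    using assms(1) by (intro tendsto_add tendsto_const) (simp add: isCont_def tendsto_at_iff_tendsto_nhds)
  ultimately have "\<forall>\<^sub>F r in nhds s. \<lfloor>Y r + 1 / 2\<rfloor> = \<lfloor>Y s + 1 / 2\<rfloor>"
    by (intro eventually_floor_eq)
  then show ?thesis by (rule eventually_mono) (simp add: idx_def round_def)
qed

lemma eventually_cos_less:
  assumes "isCont Y s" "cos (2 * pi * Y s) < c"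
  shows "\<forall>\<^sub>F r in nhds s. cos (2 * pi * Y r) < c"
  using assms by (intro order_tendstoD(2)[of _ "cos (2 * pi * Y s)"] tendsto_intros)
    (simp_all add: isCont_def tendsto_at_iff_tendsto_nhds)

lemma eventually_cos_greater:
  assumes "isCont Y s" "cos (2 * pi * Y s) > c"
  shows "\<forall>\<^sub>F r in nhds s. cos (2 * pi * Y r) > c"
  using assms by (intro order_tendstoD(1)[of _ "cos (2 * pi * Y s)"] tendsto_intros)
    (simp_all add: isCont_def tendsto_at_iff_tendsto_nhds)

lemma DERIV_eventually_const:
  assumes "\<forall>\<^sub>F r in nhds s. f r = (k::real)" "DERIV f s :> d"
  shows "d = 0"
proof -
  have "DERIV f s :> 0"
    using DERIV_cong_ev[OF refl assms(1) refl, of 0] by simp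
  with assms(2) show ?thesis by (rule DERIV_unique)
qed

text \<open>Where \<open>idx\<close> jumps, \<open>f\<close> vanishes on a neighbourhood; elsewhere
  \<open>idx\<close> is locally constant. So \<open>c (idx y)\<close> is differentiated like a
  constant, and it is at most \<open>exp (- y)\<close> because
  \<open>idx y \<ge> y - 1 / 2\<close>.\<close>

lemma negligible_idx:
  assumes c: "\<And>n. \<bar>c n\<bar> \<le> exp (- (real n + 1))"
  shows "tame at_top n f \<Longrightarrow> (\<And>y. cos (2 * pi * y) < 0 \<Longrightarrow> f y = 0) \<Longrightarrow>
    negligible at_top (\<lambda>y. y) n (\<lambda>y. c (idx y) * f y)"
proof -
  have c': "\<bar>c (idx y)\<bar> \<le> exp (- y)" for y
  proof -
    have "- (real (idx y) + 1) \<le> - y" using idx_ge[of y] by linarith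
    then have "exp (- (real (idx y) + 1)) \<le> exp (- y)" by (simp only: exp_le_cancel_iff)
    with c[of "idx y"] show ?thesis by linarith
  qed
  have 0: "negligible at_top (\<lambda>y. y) 0 (\<lambda>y. c (idx y) * f y)" if "tame at_top 0 f" for f
  proof -
    have "negligible at_top (\<lambda>y. y) 0 (\<lambda>y. exp (- y) * f y)"
      by (intro top_weight.negligible_mult negligible_exp_minus
          tame_imp_moderate[OF top_weight.weight_ge_1] that)
    then have lim: "((\<lambda>y. y ^ N * (exp (- y) * f y)) \<longlongrightarrow> 0) at_top" for N by simp
    show ?thesis unfolding negligible.simps
    proof
      fix N
      show "((\<lambda>y. y ^ N * (c (idx y) * f y)) \<longlongrightarrow> 0) at_top"
      proof (rule Lim_null_comparison[OF _ tendsto_rabs_zero[OF lim[of N]]], rule eventuallyI)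
        fix y
        have "\<bar>y ^ N * f y\<bar> * \<bar>c (idx y)\<bar> \<le> \<bar>y ^ N * f y\<bar> * exp (- y)"
          by (intro mult_left_mono c') simp
        then show "norm (y ^ N * (c (idx y) * f y)) \<le> \<bar>y ^ N * (exp (- y) * f y)\<bar>"
          by (simp add: abs_mult mult_ac)
      qed
    qed
  qed
  show "tame at_top n f \<Longrightarrow> (\<And>y. cos (2 * pi * y) < 0 \<Longrightarrow> f y = 0) \<Longrightarrow>
    negligible at_top (\<lambda>y. y) n (\<lambda>y. c (idx y) * f y)"
  proof (induction n arbitrary: f)
    case (Suc n)
    obtain f' where f': "\<And>y. DERIV f y :> f' y" "tame at_top n f'"
      using Suc.prems(1) by auto
    have ev0: "\<forall>\<^sub>F r in nhds y. f r = 0" if "cos (2 * pi * y) < 0" for y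
      using eventually_cos_less[OF continuous_ident that] by (rule eventually_mono) (rule Suc.prems(2))
    have f'0: "f' y = 0" if "cos (2 * pi * y) < 0" for y
      using DERIV_eventually_const[OF ev0[OF that] f'(1)] .
    have "DERIV (\<lambda>y. c (idx y) * f y) y :> c (idx y) * f' y" for y
    proof (cases "cos (2 * pi * y) < 0")
      case True
      have "\<forall>\<^sub>F r in nhds y. c (idx r) * f r = 0"
        using ev0[OF True] by (rule eventually_mono) simp
      then show ?thesis
        by (rule DERIV_cong_ev[OF refl _ refl, THEN iffD2]) (simp add: f'0[OF True])
    next
      case False
      have "\<forall>\<^sub>F r in nhds y. idx r = idx y"
        by (rule eventually_idx_const[where Y = "\<lambda>y. y"]) (use False in auto)
      then have "\<forall>\<^sub>F r in nhds y. c (idx r) * f r = c (idx y) * f r"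
        by (rule eventually_mono) simp
      then show ?thesis
        by (rule DERIV_cong_ev[OF refl _ refl, THEN iffD2]) (rule DERIV_cmult[OF f'(1)])
    qed
    then show ?case
      by (rule negligible_SucI[OF 0[OF moderate_0I[OF Suc.prems(1)]] _ Suc.IH[OF f'(2) f'0]])
  qed (use 0 in simp)
qed

text \<open>\<open>M\<close> bounds the slope in \<open>y\<close> of the cutoff that becomes the
  amplitude of the perturbation. The bound \<open>4 * M + 32\<close> will keep the derivative of the
  perturbation below \<open>1 / 2\<close>; the bound \<open>4 ^ (n + 1)\<close> gives geometric
  decay and \<open>q n \<ge> exp (n + 1)\<close>.\<close>

locale oscillating_field =
  fixes st :: "real \<Rightarrow> real" and q :: "nat \<Rightarrow> nat" and M :: real
  assumes st_smooth: "\<And>n. Cn_on n st UNIV"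
    and st_0: "\<And>u. u \<le> 0 \<Longrightarrow> st u = 0" and st_1: "\<And>u. u \<ge> 1 / 2 \<Longrightarrow> st u = 1"
    and st_nonneg: "\<And>u. 0 \<le> st u" and st_le_1: "\<And>u. st u \<le> 1"
    and st_deriv: "\<And>y d. DERIV (\<lambda>y. st (cos (2 * pi * y) + 1 / 2)) y :> d \<Longrightarrow> \<bar>d\<bar> \<le> M"
    and q_ge_4: "\<And>n. real (q n) \<ge> 4 ^ (n + 1)" and q_ge_M: "\<And>n. real (q n) \<ge> 4 * M + 32"
    and M_nonneg: "M \<ge> 0"
begin

abbreviation qr :: "nat \<Rightarrow> real" where "qr n \<equiv> real (q n)"

text \<open>The field has speed \<open>lam n\<close> in the \<open>n\<close>-th core, where \<open>eps n = lam n / (q n)\<^sup>2\<close> makes the second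
  derivative of the perturbation of size \<open>eps n * (om n)\<^sup>2 / lam n = 4 \<pi>\<^sup>2\<close>. The perturbation is switched on
  and off where the speed is at least \<open>1 / q n\<close>, and there \<open>eps n\<close> is negligible. Finally \<open>eta n\<close> is
  negligible even with respect to powers of \<open>lam n\<close>.\<close>

definition lam :: "nat \<Rightarrow> real" where "lam n = 1 / qr n ^ (n + 1)"
definition eps :: "nat \<Rightarrow> real" where "eps n = 1 / qr n ^ (n + 3)"
definition om :: "nat \<Rightarrow> real" where "om n = 2 * pi * qr n"
definition eta :: "nat \<Rightarrow> real" where "eta n = 1 / qr n ^ (n + 1)\<^sup>2"

text \<open>Cutoffs around the integers: \<open>Th\<close>, for the field, rises while the cosine
  goes from \<open>1 / 4\<close> to \<open>3 / 4\<close>, and \<open>Th2\<close>, for the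
  perturbation, while it goes from \<open>- 1 / 2\<close> to 0. The gap between 0 and
  \<open>1 / 4\<close> absorbs the small displacements of \<open>y\<close> caused by bounded time
  shifts.\<close>

definition Th :: "real \<Rightarrow> real" where "Th y = st (cos (2 * pi * y) - 1 / 4)"
definition Th2 :: "real \<Rightarrow> real" where "Th2 y = st (cos (2 * pi * y) + 1 / 2)"
definition u :: "real \<Rightarrow> real" where "u y = exp (- y) * (1 - Th y) + lam (idx y) * Th y"
definition nu0 :: "real \<Rightarrow> real" where "nu0 x = (if x > 0 then u (1 / x) else 0)"
text \<open>The velocity of \<open>y = 1 / x\<close> along the flow of \<open>nu0\<close>.\<close>

definition w :: "real \<Rightarrow> real" where "w y = - 1 * (y * y) * u y"

lemma q_ge: "qr n \<ge> 4" "qr n \<ge> exp (real n + 1)"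
proof -
  have "(4::real) ^ 1 \<le> 4 ^ (n + 1)" by (intro power_increasing) auto
  then show "qr n \<ge> 4" using q_ge_4[of n] by (simp only: power_one_right)
  have "exp (real n + 1) = exp 1 ^ (n + 1)"
    using exp_of_nat_mult[of "n + 1" "1 :: real"] by (simp add: add.commute)
  also have "\<dots> \<le> 4 ^ (n + 1)" using exp_le by (intro power_mono) auto
  finally show "qr n \<ge> exp (real n + 1)" using q_ge_4[of n] by simp
qed

lemma lam_pos: "lam n > 0"
  using q_ge(1)[of n] by (auto simp: lam_def intro!: divide_pos_pos zero_less_power)

lemma lam_le: "lam n \<le> exp (- (real n + 1))"
proof -
  have "exp (real n + 1) \<le> qr n ^ 1" using q_ge[of n] by simp
  also have "\<dots> \<le> qr n ^ (n + 1)" using q_ge[of n] by (intro power_increasing) auto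
  finally have "1 / qr n ^ (n + 1) \<le> 1 / exp (real n + 1)"
    using q_ge(1)[of n] by (intro divide_left_mono mult_pos_pos zero_less_power) auto
  then show ?thesis unfolding lam_def exp_minus inverse_eq_divide .
qed

lemma moderate_st_cos: "tame at_top n (\<lambda>y. st (cos (2 * pi * y) + c))"
proof (rule tame_compose_smooth[OF _ _ st_smooth])
  show "\<forall>\<^sub>F y in at_top. \<bar>cos (2 * pi * y) + c\<bar> \<le> 1 + \<bar>c\<bar>"
    by (intro always_eventually allI order_trans[OF abs_triangle_ineq] add_right_mono) simp
  show "DERIV (\<lambda>y. cos (2 * pi * y) + c) y :> (- 2 * pi) * sin (2 * pi * y + 0)" for y
    by (auto intro!: derivative_eq_intros)
qed (rule moderate_sin)

lemma moderate_Th: "tame at_top n Th" and moderate_Th2: "tame at_top n Th2"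
  using moderate_st_cos[of n "- 1 / 4"] moderate_st_cos[of n "1 / 2"]
  by (simp_all add: Th_def[abs_def] Th2_def[abs_def])

lemma negligible_u: "negligible at_top (\<lambda>y. y) n u"
proof -
  have "tame at_top n (\<lambda>y. 1 + (- 1) * Th y)"
    by (intro unit_weight.moderate_add unit_weight.moderate_mult moderate_const moderate_Th)
  then have 1: "moderate at_top (\<lambda>y. y) n (\<lambda>y. 1 - Th y)"
    using tame_imp_moderate[OF top_weight.weight_ge_1] by simp
  have 2: "negligible at_top (\<lambda>y. y) n (\<lambda>y. lam (idx y) * Th y)"
    by (rule negligible_idx[OF _ moderate_Th]) (use lam_le lam_pos st_0 in \<open>auto simp: Th_def less_imp_le\<close>)
  show ?thesis
    unfolding u_def[abs_def]
    by (rule top_weight.negligible_add[OF top_weight.negligible_mult[OF negligible_exp_minus 1] 2])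
qed

lemma nu0_smooth: "Cn_on n nu0 UNIV"
  unfolding nu0_def[abs_def] by (rule smooth_one_div_coordinate[OF negligible_u])

lemma negligible_w: "negligible at_top (\<lambda>y. y) n w"
  using top_weight.negligible_mult[OF negligible_u moderate_minus_square, of n]
  by (simp add: w_def[abs_def] mult_ac)

lemma Th_range: "0 \<le> Th y" "Th y \<le> 1"
  using st_nonneg st_le_1 by (auto simp: Th_def)

lemma lam_idx_le: "lam (idx y) \<le> exp (- y)"
  using lam_le[of "idx y"] idx_ge[of y] by (rule_tac order_trans) auto

lemma u_pos: "u y > 0"
proof (cases "Th y = 1")
  case False
  then have "exp (- y) * (1 - Th y) > 0" using Th_range[of y] by simp
  moreover have "lam (idx y) * Th y \<ge> 0" using lam_pos[of "idx y"] Th_range[of y] by simp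
  ultimately show ?thesis by (simp add: u_def)
qed (simp add: u_def lam_pos)

text \<open>\<open>u y\<close> is a convex combination of \<open>exp (- y)\<close> and
  \<open>lam (idx y)\<close>, and the latter is no larger.\<close>

lemma u_le: "u y \<le> exp (- y)"
proof -
  have "lam (idx y) * Th y \<le> exp (- y) * Th y" using lam_idx_le Th_range by (intro mult_right_mono) auto
  then show ?thesis by (simp add: u_def algebra_simps)
qed

lemma u_ge_lam: "u y \<ge> lam (idx y)"
proof -
  have "lam (idx y) * (1 - Th y) \<le> exp (- y) * (1 - Th y)" using lam_idx_le Th_range by (intro mult_right_mono) auto
  then show ?thesis by (simp add: u_def algebra_simps)
qed

lemma u_outside: "cos (2 * pi * y) \<le> 1 / 4 \<Longrightarrow> u y = exp (- y)"
  by (simp add: u_def Th_def st_0)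

lemma u_inside: "cos (2 * pi * y) \<ge> 3 / 4 \<Longrightarrow> u y = lam (idx y)"
  by (simp add: u_def Th_def st_1)

lemma w_bound: assumes "y > 0" shows "\<bar>w y\<bar> \<le> 2"
proof -
  have "y\<^sup>2 \<le> 2 * exp y" using exp_lower_Taylor_quadratic[of y] assms by simp
  then have "y\<^sup>2 * exp (- y) \<le> 2" by (simp add: exp_minus field_simps)
  moreover have "y\<^sup>2 * u y \<le> y\<^sup>2 * exp (- y)" by (intro mult_left_mono u_le) simp
  ultimately show ?thesis using u_pos[of y] by (simp add: w_def abs_mult power2_eq_square)
qed

lemma nu0_pos: "x > 0 \<Longrightarrow> nu0 x > 0" by (simp add: nu0_def u_pos)

text \<open>The first bound prevents escape to infinity in finite time, the second prevents reaching
  0 in finite time.\<close>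

lemma nu0_le: assumes "x > 0" shows "nu0 x \<le> 1" "nu0 x \<le> x"
proof -
  have "nu0 x \<le> exp (- (1 / x))" using u_le[of "1 / x"] assms by (simp add: nu0_def)
  also have "exp (- (1 / x)) \<le> 1" using assms by simp
  finally show "nu0 x \<le> 1" .
  have "1 / x \<le> exp (1 / x)" using exp_ge_add_one_self[of "1 / x"] by linarith
  then have "exp (- (1 / x)) \<le> x" using assms by (simp add: exp_minus field_simps)
  with \<open>nu0 x \<le> exp (- (1 / x))\<close> show "nu0 x \<le> x" by simp
qed

end

section \<open>Elementary estimates for sine and cosine\<close>

lemma sin_lipschitz: "\<bar>sin x - sin y\<bar> \<le> \<bar>x - y\<bar>" for x y :: real
proof -
  have "norm (sin x - sin y) \<le> 1 * norm (x - y)"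
    by (rule field_differentiable_bound[of UNIV sin cos]) auto
  then show ?thesis by simp
qed

lemma cos_lipschitz: "\<bar>cos x - cos y\<bar> \<le> \<bar>x - y\<bar>" for x y :: real
  using sin_lipschitz[of "x + pi / 2" "y + pi / 2"] by (simp add: sin_add)

lemma cos_shift_int: "cos (2 * pi * (y - of_int k)) = cos (2 * pi * y)"
  by (simp add: right_diff_distrib cos_diff)

lemma cos_pos_imp_near_round:
  assumes "cos (2 * pi * y) > 0" shows "\<bar>y - of_int (round y)\<bar> < 1 / 4"
proof (rule ccontr)
  define z where "z = \<bar>y - of_int (round y)\<bar>"
  assume "\<not> \<bar>y - of_int (round y)\<bar> < 1 / 4"
  then have z: "1 / 4 \<le> z" "z \<le> 1 / 2"
    using of_int_round_abs_le[of y] by (auto simp: z_def abs_minus_commute)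
  have "2 * pi * z \<le> pi" using z(2) by simp
  moreover have "pi / 2 \<le> 2 * pi * z" using z(1) by simp
  ultimately have "cos (2 * pi * z) \<le> cos (pi / 2)" by (intro cos_monotone_0_pi_le) auto
  moreover have "cos (2 * pi * z) = cos (2 * pi * (y - of_int (round y)))"
    by (simp add: z_def abs_if right_diff_distrib cos_diff)
  ultimately show False using assms cos_shift_int[of y "round y"] by simp
qed

lemma cos_near_int: assumes "\<bar>y - of_int k\<bar> \<le> 1 / 32" shows "cos (2 * pi * y) > 3 / 4"
proof -
  have "\<bar>cos (2 * pi * (y - of_int k)) - cos 0\<bar> \<le> \<bar>2 * pi * (y - of_int k) - 0\<bar>" by (rule cos_lipschitz)
  also have "\<dots> = 2 * pi * \<bar>y - of_int k\<bar>" by (simp add: abs_mult)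
  also have "\<dots> \<le> 2 * pi * (1 / 32)" using assms by (intro mult_left_mono) auto
  also have "\<dots> < 1 / 4" using pi_less_4 by simp
  finally show ?thesis unfolding cos_shift_int by simp
qed

section \<open>The time coordinate of the base field\<close>

context oscillating_field
begin

lemma nu0_zero [simp]: "nu0 0 = 0" by (simp add: nu0_def)

lemma nu0_nonneg: "nu0 x \<ge> 0"
  using nu0_pos[of x] by (cases "x > 0") (auto simp: nu0_def)

lemma DERIV_nu0: "DERIV nu0 x :> deriv nu0 x"
  and continuous_deriv_nu0: "continuous_on UNIV (deriv nu0)"
  and deriv_nu0_0: "deriv nu0 0 = 0"
proof -
  obtain f' where f': "\<And>x. x \<in> UNIV \<Longrightarrow> (nu0 has_real_derivative f' x) (at x within UNIV)" "continuous_on UNIV f'"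
    by (rule Cn_on_1E[OF nu0_smooth], rule that)
  have "deriv nu0 = f'" using f'(1) by (intro ext DERIV_imp_deriv) auto
  with f' show *: "DERIV nu0 x :> deriv nu0 x" "continuous_on UNIV (deriv nu0)" for x by auto
  show "deriv nu0 0 = 0"
    by (rule DERIV_local_min[OF *(1) zero_less_one]) (simp add: nu0_nonneg)
qed

text \<open>\<open>psi0\<close> is the inverse of an antiderivative \<open>F\<close> of
  \<open>1 / nu0\<close>. Since \<open>1 / nu0\<close> is at least 1, and at least
  \<open>1 / x\<close>, \<open>F\<close> grows at least linearly at infinity and falls at least like
  \<open>ln x\<close> at 0, so it takes every real value.\<close>

lemma base_coordinate_exists:
  obtains psi0 where "\<And>s. psi0 s > 0" "\<And>s. DERIV psi0 s :> nu0 (psi0 s)"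
    "(psi0 \<longlongrightarrow> 0) at_bot" "filterlim psi0 at_top at_top"
proof -
  have "isCont (\<lambda>x. 1 / nu0 x) x" if "x > 0" for x
    using DERIV_isCont[OF DERIV_nu0[of x]] nu0_pos[OF that] by (intro continuous_divide) auto
  then have "\<exists>F. \<forall>x::real. ereal 0 < ereal x \<longrightarrow> ereal x < \<infinity> \<longrightarrow> (F has_vector_derivative 1 / nu0 x) (at x)"
    by (intro einterval_antiderivative) auto
  then obtain F where F: "\<And>x. x > 0 \<Longrightarrow> DERIV F x :> 1 / nu0 x"
    by (auto simp: has_real_derivative_iff_has_vector_derivative)
  have contF: "isCont F x" if "x > 0" for x using F[OF that] by (rule DERIV_isCont)
  have monoF: "F x < F y" if "0 < x" "x < y" for x y
  proof (rule DERIV_pos_imp_increasing[OF that(2)])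
    fix z assume "x \<le> z" "z \<le> y"
    then have "z > 0" using that by simp
    then show "\<exists>d. DERIV F z :> d \<and> d > 0"
      using F[of z] nu0_pos[of z] by (intro exI[of _ "1 / nu0 z"]) auto
  qed
  have eqF: "x = y" if "0 < x" "0 < y" "F x = F y" for x y
    using monoF[of x y] monoF[of y x] that by (cases x y rule: linorder_cases) auto
  have up: "F b \<ge> F 1 + (b - 1)" if "b \<ge> 1" for b
  proof -
    have "F 1 - 1 \<le> F b - b"
    proof (rule DERIV_nonneg_imp_nondecreasing[OF that])
      fix x :: real assume "1 \<le> x"
      then have "DERIV (\<lambda>x. F x - x) x :> 1 / nu0 x - 1" "1 / nu0 x - 1 \<ge> 0"
        using F[of x] nu0_pos[of x] nu0_le(1)[of x] by (auto intro!: derivative_eq_intros)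
      then show "\<exists>d. DERIV (\<lambda>x. F x - x) x :> d \<and> d \<ge> 0" by blast
    qed
    then show ?thesis by simp
  qed
  have down: "F a \<le> F 1 + ln a" if "a > 0" "a \<le> 1" for a
  proof -
    have "F a - ln a \<le> F 1 - ln 1"
    proof (rule DERIV_nonneg_imp_nondecreasing[OF that(2)])
      fix x :: real assume "a \<le> x"
      then have x: "x > 0" using that by simp
      then have "1 / nu0 x - 1 / x \<ge> 0"
        using nu0_pos[OF x] nu0_le(2)[OF x] by (simp add: frac_le)
      moreover have "DERIV (\<lambda>x. F x - ln x) x :> 1 / nu0 x - 1 / x"
        by (rule DERIV_diff[OF F[OF x] DERIV_ln_divide[OF x]])
      ultimately show "\<exists>d. DERIV (\<lambda>x. F x - ln x) x :> d \<and> d \<ge> 0" by blast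
    qed
    then show ?thesis by simp
  qed
  have surj: "\<exists>x>0. F x = s" for s
  proof -
    \<comment> \<open>Chosen so that \<open>F 1 + ln a \<le> s \<le> F 1 + (b - 1)\<close>.\<close>
    define a b where "a = exp (- (\<bar>s\<bar> + \<bar>F 1\<bar>))" and "b = 1 + \<bar>s\<bar> + \<bar>F 1\<bar>"
    have a: "a > 0" "a \<le> 1" and b: "b \<ge> 1" by (auto simp: a_def b_def)
    have "F a \<le> s" using down[OF a] by (simp add: a_def)
    moreover have "s \<le> F b" using up[OF b] by (simp add: b_def)
    ultimately obtain x where "a \<le> x" "x \<le> b" "F x = s"
      using IVT[of F a s b] a b contF by auto
    then show ?thesis using a by (intro exI[of _ x]) auto
  qed
  define psi0 where "psi0 s = (THE x. x > 0 \<and> F x = s)" for s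
  have psi0: "psi0 s > 0 \<and> F (psi0 s) = s" for s
    unfolding psi0_def by (rule theI') (use surj eqF in metis)
  have psi0_F: "psi0 (F x) = x" if "x > 0" for x
    using psi0[of "F x"] eqF that by blast
  have mono_psi0: "psi0 s < x \<longleftrightarrow> s < F x" if "x > 0" for s x
    using monoF[of "psi0 s" x] monoF[of x "psi0 s"] psi0[of s] that
    by (cases "psi0 s" x rule: linorder_cases) auto
  show thesis
  proof (rule that[of psi0])
    fix s
    define x where "x = psi0 s"
    have x: "x > 0" "F x = s" using psi0[of s] by (auto simp: x_def)
    have zpos: "z > 0" if "\<bar>z - x\<bar> \<le> x / 2" for z using that x(1) by linarith
    have "isCont psi0 (F x)"
      by (rule isCont_inverse_function[where d = "x / 2" and f = F and g = psi0 and x = x])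
        (use x(1) in \<open>auto intro!: psi0_F contF zpos\<close>)
    then have c: "isCont psi0 s" using x by simp
    have "DERIV F (psi0 s) :> 1 / nu0 x" using F[OF x(1)] by (simp add: x_def)
    then have "DERIV psi0 s :> inverse (1 / nu0 x)"
      by (rule DERIV_inverse_function[where a = "s - 1" and b = "s + 1"])
        (use nu0_pos[OF x(1)] psi0 c in auto)
    then show "DERIV psi0 s :> nu0 (psi0 s)" by (simp add: x_def)
  next
    show "(psi0 \<longlongrightarrow> 0) at_bot"
    proof (rule order_tendstoI)
      fix e :: real assume "e > 0"
      have "\<forall>\<^sub>F s in at_bot. s < F e" by (rule eventually_gt_at_bot)
      then show "\<forall>\<^sub>F s in at_bot. psi0 s < e" by (rule eventually_mono) (simp add: mono_psi0[OF \<open>e > 0\<close>])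
    next
      fix e :: real assume "e < 0"
      then show "\<forall>\<^sub>F s in at_bot. e < psi0 s" using psi0 by (intro always_eventually allI) (meson less_trans)
    qed
    show "filterlim psi0 at_top at_top"
      unfolding filterlim_at_top_gt[where c = 0]
    proof (intro allI impI)
      fix Z :: real assume "Z > 0"
      have "\<forall>\<^sub>F s in at_top. F Z \<le> s" by (rule eventually_ge_at_top)
      then show "\<forall>\<^sub>F s in at_top. Z \<le> psi0 s"
        by (rule eventually_mono) (use mono_psi0[OF \<open>Z > 0\<close>] in \<open>simp add: not_less[symmetric]\<close>)
    qed
  qed (use psi0 in blast)
qed

end

section \<open>The base flow and the slow drift of \<open>1 / x\<close> along its orbits\<close>

locale oscillating_flow = oscillating_field +
  fixes psi0 :: "real \<Rightarrow> real"
  assumes psi0_pos: "\<And>s. psi0 s > 0" and DERIV_psi0: "\<And>s. DERIV psi0 s :> nu0 (psi0 s)"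
    and psi0_bot: "(psi0 \<longlongrightarrow> 0) at_bot" and psi0_top: "filterlim psi0 at_top at_top"
begin

lemma DERIV_nu0_psi0: "DERIV (\<lambda>s. nu0 (psi0 s)) s :> deriv nu0 (psi0 s) * nu0 (psi0 s)"
  by (rule DERIV_chain2[OF DERIV_nu0 DERIV_psi0])

lemma isCont_psi0: "isCont psi0 s"
  using DERIV_psi0 by (rule DERIV_isCont)

lemma isCont_deriv_nu0: "isCont (deriv nu0) x"
  using continuous_deriv_nu0 by (simp add: continuous_on_eq_continuous_at)

lemma nu0_psi0_bot: "((\<lambda>s. nu0 (psi0 s)) \<longlongrightarrow> 0) at_bot"
proof -
  have "isCont nu0 0" using DERIV_nu0 by (rule DERIV_isCont)
  then have "(nu0 \<longlongrightarrow> nu0 0) (nhds 0)" by (simp only: isCont_def tendsto_at_iff_tendsto_nhds)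
  from filterlim_compose[OF this psi0_bot] show ?thesis by (simp add: nu0_def)
qed

lemma deriv_nu0_psi0_bot: "((\<lambda>s. deriv nu0 (psi0 s)) \<longlongrightarrow> 0) at_bot"
proof -
  have "(deriv nu0 \<longlongrightarrow> deriv nu0 0) (nhds 0)"
    using isCont_deriv_nu0[of 0] by (simp only: isCont_def tendsto_at_iff_tendsto_nhds)
  from filterlim_compose[OF this psi0_bot] show ?thesis by (simp add: deriv_nu0_0)
qed

sublocale base: time_coordinate psi0 "\<lambda>s. nu0 (psi0 s)" "\<lambda>s. deriv nu0 (psi0 s) * nu0 (psi0 s)"
proof
  have "nu0 (psi0 s) \<noteq> 0" for s using nu0_pos[OF psi0_pos[of s]] by simp
  then show "((\<lambda>s. deriv nu0 (psi0 s) * nu0 (psi0 s) / nu0 (psi0 s)) \<longlongrightarrow> 0) at_bot"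
    using deriv_nu0_psi0_bot by simp
  show "continuous_on UNIV (\<lambda>s. deriv nu0 (psi0 s) * nu0 (psi0 s))"
    by (intro continuous_on_mult continuous_at_imp_continuous_on ballI
        isCont_o2[OF isCont_psi0 isCont_deriv_nu0] DERIV_isCont[OF DERIV_nu0_psi0])
qed (fact psi0_pos DERIV_psi0 DERIV_nu0_psi0 psi0_bot psi0_top nu0_psi0_bot nu0_pos[OF psi0_pos])+

lemma base_nu_smooth: "Cn_on n base.\<nu> {0..}"
proof (rule Cn_on_cong[THEN iffD1, OF _ Cn_on_subset[OF nu0_smooth]])
  fix x :: real assume "x \<in> {0..}"
  then have "x \<ge> 0" by simp
  then show "nu0 x = base.\<nu> x"
    by (cases rule: base.half_line_cases) auto
qed simp

definition Y :: "real \<Rightarrow> real" where "Y s = 1 / psi0 s"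

abbreviation cY :: "real \<Rightarrow> real" where "cY s \<equiv> cos (2 * pi * Y s)"

lemma Y_pos: "Y s > 0" using psi0_pos by (simp add: Y_def)

lemma nu0_psi0: "nu0 (psi0 s) = u (Y s)" using psi0_pos[of s] by (simp add: nu0_def Y_def)

lemma DERIV_Y: "DERIV Y s :> w (Y s)"
proof -
  have "DERIV Y s :> - 1 * (1 / psi0 s * (1 / psi0 s)) * nu0 (psi0 s)"
    unfolding Y_def[abs_def] by (rule DERIV_chain2[OF DERIV_one_div[OF psi0_pos] DERIV_psi0])
  then show ?thesis by (simp add: w_def nu0_psi0[unfolded Y_def] Y_def)
qed

lemma isCont_Y: "isCont Y s" using DERIV_Y by (rule DERIV_isCont)

lemma Y_bot: "filterlim Y at_top at_bot"
proof -
  have "filterlim (\<lambda>s. inverse (psi0 s)) at_top at_bot"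
    by (rule filterlim_inverse_at_top[OF psi0_bot]) (use psi0_pos in \<open>auto intro: always_eventually\<close>)
  then show ?thesis by (simp add: Y_def[abs_def] divide_inverse)
qed

lemma idx_Y_bot: "filterlim (\<lambda>s. idx (Y (s + t))) at_top at_bot"
proof -
  have 1: "filterlim (\<lambda>s. Y (s + t)) at_top at_bot"
    by (rule filterlim_compose[OF Y_bot base.filterlim_add_at_bot])
  show ?thesis unfolding filterlim_at_top
  proof
    fix Z
    have "\<forall>\<^sub>F s in at_bot. Y (s + t) \<ge> real Z + 1" using 1 unfolding filterlim_at_top by blast
    then show "\<forall>\<^sub>F s in at_bot. idx (Y (s + t)) \<ge> Z"
    proof (rule eventually_mono)
      fix s assume "Y (s + t) \<ge> real Z + 1"
      then have "real Z \<le> real (idx (Y (s + t)))" using idx_ge[of "Y (s + t)"] by linarith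
      then show "Z \<le> idx (Y (s + t))" by simp
    qed
  qed
qed

text \<open>The velocity \<open>w (Y s)\<close> of \<open>Y\<close> tends to 0 in the far past.
  Hence a shift by \<open>t\<close>, or the bounded displacement made by the perturbation, hardly
  changes the position relative to the cores.\<close>

lemma Y_move:
  assumes "D \<ge> 0" "\<delta> > 0"
  shows "\<forall>\<^sub>F s in at_bot. \<forall>r. \<bar>r - s\<bar> \<le> D \<longrightarrow> \<bar>Y r - Y s\<bar> \<le> \<delta>"
proof -
  have "(w \<longlongrightarrow> 0) at_top" using negligible_w[of 0] by (auto dest: spec[of _ 0])
  then have "((\<lambda>s. w (Y s)) \<longlongrightarrow> 0) at_bot" using Y_bot by (rule filterlim_compose)
  moreover have "\<delta> / (D + 1) > 0" using assms by simp
  ultimately have "\<forall>\<^sub>F s in at_bot. dist (w (Y s)) 0 < \<delta> / (D + 1)" by (rule tendstoD)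
  then obtain B where B: "\<And>s. s \<le> B \<Longrightarrow> \<bar>w (Y s)\<bar> \<le> \<delta> / (D + 1)"
    unfolding eventually_at_bot_linorder dist_real_def by (auto intro: less_imp_le)
  have "\<bar>Y r - Y s\<bar> \<le> \<delta>" if "s \<le> B - D" "\<bar>r - s\<bar> \<le> D" for r s
  proof -
    have "norm (Y r - Y s) \<le> \<delta> / (D + 1) * norm (r - s)"
    proof (rule field_differentiable_bound[of "{..B}"])
      show "(Y has_real_derivative w (Y z)) (at z within {..B})" for z
        by (rule has_field_derivative_at_within[OF DERIV_Y])
    qed (use B that assms(1) in auto)
    also have "\<dots> \<le> \<delta> / (D + 1) * (D + 1)"
      using that assms by (intro mult_left_mono) auto
    also have "\<dots> = \<delta>" using assms by simp
    finally show ?thesis by simp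
  qed
  then show ?thesis unfolding eventually_at_bot_linorder by blast
qed

subsection \<open>The oscillating perturbation\<close>

text \<open>Coefficient, amplitude and phase are left free so that the derivative of such a function
  is a sum of two functions of the same kind.\<close>

definition osc :: "(nat \<Rightarrow> real) \<Rightarrow> (real \<Rightarrow> real) \<Rightarrow> real \<Rightarrow> real \<Rightarrow> real" where
  "osc c a b s = c (idx (Y s)) * (a s * sin (om (idx (Y s)) * s + b))"

text \<open>Decay faster than every fixed power of \<open>1 / q n\<close>. The free exponent
  \<open>i\<close> makes the class stable under multiplication by \<open>om n\<close>, the price of
  differentiating the sine.\<close>

definition coeff :: "(nat \<Rightarrow> real) \<Rightarrow> bool" where
  "coeff c \<longleftrightarrow> (\<exists>i C. \<forall>n. \<bar>c n\<bar> * qr n ^ n \<le> C * qr n ^ i)"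

text \<open>The amplitude vanishes near the half-integers, where the index jumps, and is constant on
  a region containing all points at which the field is slowed down.\<close>

definition admissible :: "nat \<Rightarrow> (real \<Rightarrow> real) \<Rightarrow> bool" where
  "admissible n a \<longleftrightarrow> tame at_bot n a \<and> (\<forall>s. cY s < - 1 / 2 \<longrightarrow> a s = 0) \<and>
     (\<exists>k. \<forall>s. cY s > 0 \<longrightarrow> a s = k)"

lemma q_pos: "qr n > 0" using q_ge(1)[of n] by simp

lemma coeff_eps: "coeff eps"
  unfolding coeff_def
proof (rule exI[of _ 0], rule exI[of _ 1], rule allI)
  fix n
  have "1 / qr n ^ (n + 3) * qr n ^ n = 1 / qr n ^ 3"
    using q_pos[of n] by (simp add: power_add)
  also have "\<dots> \<le> 1" using q_ge(1)[of n] by (simp add: one_le_power)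
  finally show "\<bar>eps n\<bar> * qr n ^ n \<le> 1 * qr n ^ 0" by (simp add: eps_def)
qed

abbreviation omc :: "(nat \<Rightarrow> real) \<Rightarrow> nat \<Rightarrow> real" where "omc c \<equiv> \<lambda>n. c n * om n"

lemma coeff_om: assumes "coeff c" shows "coeff (omc c)"
proof -
  from assms obtain i C where C: "\<And>n. \<bar>c n\<bar> * qr n ^ n \<le> C * qr n ^ i" unfolding coeff_def by blast
  have "\<bar>c n * om n\<bar> * qr n ^ n \<le> 2 * pi * C * qr n ^ Suc i" for n
  proof -
    have "\<bar>c n\<bar> * qr n ^ n * (2 * pi * qr n) \<le> C * qr n ^ i * (2 * pi * qr n)"
      using C by (intro mult_right_mono) auto
    then show ?thesis by (simp add: om_def abs_mult mult_ac)
  qed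
  then show ?thesis unfolding coeff_def by blast
qed

lemma q_power_ratio: assumes "k < m" shows "qr n ^ k / qr n ^ m \<le> (1 / 4) ^ n"
proof -
  have "qr n ^ k / qr n ^ m = 1 / qr n ^ (m - k)"
    using assms q_pos[of n] by (simp add: power_diff)
  also have "\<dots> \<le> 1 / 4 ^ n"
  proof (intro divide_left_mono mult_pos_pos zero_less_power q_pos)
    have "(4::real) ^ n \<le> 4 ^ (n + 1)" by (intro power_increasing) auto
    also have "\<dots> \<le> qr n ^ 1" using q_ge_4[of n] by simp
    also have "\<dots> \<le> qr n ^ (m - k)" using assms q_ge(1)[of n] by (intro power_increasing) auto
    finally show "4 ^ n \<le> qr n ^ (m - k)" .
  qed auto
  finally show ?thesis by (simp add: power_one_over)
qed

text \<open>The first limit serves where the reciprocal speed is at most \<open>q n\<close>, the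
  second where it may reach \<open>1 / lam n = (q n) ^ (n + 1)\<close>. In the second,
  \<open>eta n\<close> wins because \<open>(n + 1)\<^sup>2\<close> exceeds
  \<open>(n + 1) * N + i\<close> for large \<open>n\<close>.\<close>

lemma coeff_lim:
  assumes "coeff c"
  shows "(\<lambda>n. \<bar>c n\<bar> * qr n ^ N) \<longlonglongrightarrow> 0"
    and "(\<lambda>n. \<bar>c n\<bar> * eta n * qr n ^ ((n + 1) * N)) \<longlonglongrightarrow> 0"
proof -
  from assms obtain i C where C: "\<And>n. \<bar>c n\<bar> * qr n ^ n \<le> C * qr n ^ i" unfolding coeff_def by blast
  have C0: "C \<ge> 0"
  proof -
    have "0 \<le> \<bar>c 0\<bar> * real (q 0) ^ 0" by simp
    also have "\<dots> \<le> C * real (q 0) ^ i" by (rule C)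
    finally show ?thesis using zero_less_power[OF q_pos[of 0], of i] mult_neg_pos[of C "real (q 0) ^ i"]
      by linarith
  qed
  have g: "(\<lambda>n. C * (1 / 4) ^ n) \<longlonglongrightarrow> 0"
    by (rule tendsto_mult_right_zero) (rule LIMSEQ_realpow_zero, auto)
  show "(\<lambda>n. \<bar>c n\<bar> * qr n ^ N) \<longlonglongrightarrow> 0"
  proof (rule Lim_null_comparison[OF _ g], rule eventually_sequentiallyI[of "i + N + 1"])
    fix n assume n: "i + N + 1 \<le> n"
    have "\<bar>c n\<bar> * qr n ^ N = (\<bar>c n\<bar> * qr n ^ n) * (qr n ^ N / qr n ^ n)"
      using q_pos[of n] by simp
    also have "\<dots> \<le> (C * qr n ^ i) * (qr n ^ N / qr n ^ n)"
      by (intro mult_right_mono C) auto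
    also have "\<dots> = C * (qr n ^ (i + N) / qr n ^ n)" by (simp add: power_add)
    also have "\<dots> \<le> C * (1 / 4) ^ n" using n C0 by (intro mult_left_mono q_power_ratio) auto
    finally show "norm (\<bar>c n\<bar> * qr n ^ N) \<le> C * (1 / 4) ^ n" by simp
  qed
  show "(\<lambda>n. \<bar>c n\<bar> * eta n * qr n ^ ((n + 1) * N)) \<longlonglongrightarrow> 0"
  proof (rule Lim_null_comparison[OF _ g], rule eventually_sequentiallyI[of "i + N"])
    fix n assume n: "i + N \<le> n"
    have "(n + 1) * N \<le> (n + 1) * n" using n by (intro mult_le_mono2) simp
    moreover have "(n + 1)\<^sup>2 = (n + 1) * n + (n + 1)" by (simp add: power2_eq_square)
    ultimately have lt: "i + (n + 1) * N < (n + 1)\<^sup>2" using n by linarith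
    have "\<bar>c n\<bar> * 1 \<le> \<bar>c n\<bar> * qr n ^ n"
      using q_ge(1)[of n] by (intro mult_left_mono one_le_power) auto
    also have "\<dots> \<le> C * qr n ^ i" by (rule C)
    finally have "\<bar>c n\<bar> \<le> C * qr n ^ i" by simp
    then have "\<bar>c n\<bar> * (qr n ^ ((n + 1) * N) / qr n ^ (n + 1)\<^sup>2)
        \<le> C * qr n ^ i * (qr n ^ ((n + 1) * N) / qr n ^ (n + 1)\<^sup>2)"
      by (intro mult_right_mono) auto
    also have "\<dots> = C * (qr n ^ (i + (n + 1) * N) / qr n ^ (n + 1)\<^sup>2)"
      by (simp only: power_add mult.assoc times_divide_eq_right)
    also have "\<dots> \<le> C * (1 / 4) ^ n" using lt C0 by (intro mult_left_mono q_power_ratio) auto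
    finally show "norm (\<bar>c n\<bar> * eta n * qr n ^ ((n + 1) * N)) \<le> C * (1 / 4) ^ n"
      by (simp add: eta_def abs_mult del: power_Suc add_Suc mult_Suc One_nat_def)
  qed
qed

lemma admissible_bounded: "admissible n a \<Longrightarrow> \<exists>K\<ge>0. \<forall>\<^sub>F s in at_bot. \<bar>a s\<bar> \<le> K"
proof -
  assume "admissible n a"
  then have "tame at_bot 0 a" unfolding admissible_def by (blast intro: moderate_0I)
  then obtain K where "\<forall>\<^sub>F s in at_bot. \<bar>a s\<bar> \<le> K" unfolding tame_0 by blast
  then have "\<forall>\<^sub>F s in at_bot. \<bar>a s\<bar> \<le> \<bar>K\<bar>" by (rule eventually_mono) simp
  then show ?thesis by (intro exI[of _ "\<bar>K\<bar>"]) simp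
qed

lemma admissible_SucD: "admissible (Suc n) a \<Longrightarrow> admissible n a"
  unfolding admissible_def using moderate_SucD by blast

lemma admissible_0I: "admissible n a \<Longrightarrow> admissible 0 a"
  unfolding admissible_def using moderate_0I by blast

lemma admissible_SucE:
  assumes "admissible (Suc n) a"
  obtains a' where "\<And>s. DERIV a s :> a' s" "admissible n a'"
    "\<And>s. cY s < - 1 / 2 \<Longrightarrow> a' s = 0" "\<And>s. cY s > 0 \<Longrightarrow> a' s = 0"
proof -
  from assms have "tame at_bot (Suc n) a" by (simp add: admissible_def)
  then obtain a' where a': "\<And>s. DERIV a s :> a' s" "tame at_bot n a'" by auto
  from assms obtain k where k: "\<And>s. cY s > 0 \<Longrightarrow> a s = k" unfolding admissible_def by blast
  have 1: "a' s = 0" if "cY s < - 1 / 2" for s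
  proof (rule DERIV_eventually_const[OF _ a'(1)])
    show "\<forall>\<^sub>F r in nhds s. a r = 0"
      using eventually_cos_less[OF isCont_Y that] by (rule eventually_mono) (use assms in \<open>simp add: admissible_def\<close>)
  qed
  have 2: "a' s = 0" if "cY s > 0" for s
  proof (rule DERIV_eventually_const[OF _ a'(1)])
    show "\<forall>\<^sub>F r in nhds s. a r = k"
      using eventually_cos_greater[OF isCont_Y that] by (rule eventually_mono) (rule k)
  qed
  show thesis
    by (rule that[of a']) (use a' 1 2 in \<open>auto simp: admissible_def\<close>)
qed

text \<open>If \<open>cY s < - 1 / 2\<close>, everything vanishes near \<open>s\<close>; otherwise
  the index is locally constant and the product rule applies, the cosine being rewritten as a sine
  with advanced phase.\<close>

lemma osc_DERIV:
  assumes a: "\<And>s. DERIV a s :> a' s"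
    and 0: "\<And>s. cY s < - 1 / 2 \<Longrightarrow> a s = 0"
  shows "(osc c a b has_real_derivative osc c a' b s + osc (omc c) a (b + pi / 2) s) (at s)"
proof (cases "cY s < - 1 / 2")
  case True
  have ev: "\<forall>\<^sub>F r in nhds s. a r = 0"
    using eventually_cos_less[OF isCont_Y True] by (rule eventually_mono) (rule 0)
  have a'0: "a' s = 0" by (rule DERIV_eventually_const[OF ev a])
  have ev': "\<forall>\<^sub>F r in nhds s. osc c a b r = 0"
    using ev by (rule eventually_mono) (simp add: osc_def)
  show ?thesis
    by (rule DERIV_cong_ev[OF refl ev' refl, THEN iffD2]) (simp add: osc_def 0[OF True] a'0)
next
  case False
  define n where "n = idx (Y s)"
  have "\<forall>\<^sub>F r in nhds s. idx (Y r) = n"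
    unfolding n_def by (rule eventually_idx_const[OF isCont_Y]) (use False in auto)
  then have ev: "\<forall>\<^sub>F r in nhds s. osc c a b r = c n * (a r * sin (om n * r + b))"
    by (rule eventually_mono) (simp add: osc_def)
  have "sin (om n * s + (b + pi / 2)) = cos (om n * s + b)"
    by (simp add: sin_add add.assoc[symmetric])
  moreover have "DERIV (\<lambda>r. sin (om n * r + b)) s :> om n * cos (om n * s + b)"
    by (auto intro!: derivative_eq_intros)
  from DERIV_cmult[OF DERIV_mult'[OF a[of s] this], of "c n"]
  have "DERIV (\<lambda>r. c n * (a r * sin (om n * r + b))) s :> c n * (a s * (om n * cos (om n * s + b)) + a' s * sin (om n * s + b))" by simp
  ultimately have "DERIV (\<lambda>r. c n * (a r * sin (om n * r + b))) s :> osc c a' b s + osc (omc c) a (b + pi / 2) s"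
    by (simp add: osc_def n_def[symmetric] algebra_simps)
  then show ?thesis by (rule DERIV_cong_ev[OF refl ev refl, THEN iffD2])
qed

lemma osc_le: "\<bar>osc c a b s\<bar> \<le> \<bar>c (idx (Y s))\<bar> * \<bar>a s\<bar>"
  unfolding osc_def abs_mult by (intro mult_left_mono mult_left_le) auto

lemma osc_bot: assumes "coeff c" "admissible n a" shows "(osc c a b \<longlongrightarrow> 0) at_bot"
proof -
  from admissible_bounded[OF assms(2)] obtain K where K: "K \<ge> 0" "\<forall>\<^sub>F s in at_bot. \<bar>a s\<bar> \<le> K" by blast
  have "((\<lambda>s. \<bar>c (idx (Y (s + 0)))\<bar> * real (q (idx (Y (s + 0)))) ^ 0) \<longlongrightarrow> 0) at_bot"
    by (rule filterlim_compose[OF coeff_lim(1)[OF assms(1)] idx_Y_bot])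
  then have lim: "((\<lambda>s. K * \<bar>c (idx (Y s))\<bar>) \<longlongrightarrow> 0) at_bot"
    by (intro tendsto_mult_right_zero) simp
  show ?thesis
  proof (rule Lim_null_comparison[OF _ lim])
    show "\<forall>\<^sub>F s in at_bot. norm (osc c a b s) \<le> K * \<bar>c (idx (Y s))\<bar>"
      using K(2)
    proof (rule eventually_mono)
      fix s assume "\<bar>a s\<bar> \<le> K"
      then have "\<bar>c (idx (Y s))\<bar> * \<bar>a s\<bar> \<le> \<bar>c (idx (Y s))\<bar> * K" by (intro mult_left_mono) auto
      with osc_le[of c a b s] show "norm (osc c a b s) \<le> K * \<bar>c (idx (Y s))\<bar>" by (simp add: mult.commute)
    qed
  qed
qed

lemma osc_moderate: "coeff c \<Longrightarrow> admissible n a \<Longrightarrow> tame at_bot n (osc c a b)"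
proof (induction n arbitrary: c a b)
  case 0
  then have "\<forall>\<^sub>F s in at_bot. dist (osc c a b s) 0 < 1" by (intro tendstoD osc_bot) auto
  then have "\<forall>\<^sub>F s in at_bot. \<bar>osc c a b s\<bar> \<le> 1" by (rule eventually_mono) simp
  then show ?case unfolding tame_0 by blast
next
  case (Suc n)
  obtain a' where a': "\<And>s. DERIV a s :> a' s" "admissible n a'"
    by (rule admissible_SucE[OF Suc.prems(2)]) (rule that)
  have z: "a s = 0" if "cY s < - 1 / 2" for s
    using Suc.prems(2) that by (auto simp: admissible_def)
  have 0: "tame at_bot 0 (osc c a b)"
    by (rule moderate_0I[OF Suc.IH[OF Suc.prems(1) admissible_SucD[OF Suc.prems(2)]]])
  show ?case
    by (rule moderate_SucI[OF 0 osc_DERIV[OF a'(1) z] unit_weight.moderate_add[OF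
        Suc.IH[OF Suc.prems(1) a'(2)] Suc.IH[OF coeff_om[OF Suc.prems(1)] admissible_SucD[OF Suc.prems(2)]]]])
qed

definition A :: "real \<Rightarrow> real" where "A s = Th2 (Y s)"

lemma A_range: "0 \<le> A s" "A s \<le> 1"
  using st_nonneg st_le_1 by (auto simp: A_def Th2_def)

lemma A_admissible: "admissible n A"
  unfolding admissible_def
proof (intro conjI exI[of _ 1] allI impI)
  show "tame at_bot n A"
    unfolding A_def[abs_def]
    by (rule tame_compose_coord[OF Y_bot _ top_weight.negligible_imp_tame[OF negligible_w] moderate_Th2 moderate_const[of _ _ _ 1]])
      (use DERIV_Y in simp)
qed (auto simp: A_def Th2_def st_0 st_1)

text \<open>\<open>admissible\<close> chooses a derivative anew for every order; here the single
  function \<open>deriv a\<close> serves all orders.\<close>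

lemma admissible_deriv:
  assumes "\<And>n. admissible n a"
  shows "DERIV a s :> deriv a s" "admissible n (deriv a)"
    "cY s > 0 \<Longrightarrow> deriv a s = 0" "cY s < - 1 / 2 \<Longrightarrow> deriv a s = 0"
proof -
  obtain a' where a': "\<And>s. DERIV a s :> a' s" "admissible n a'"
    "\<And>s. cY s < - 1 / 2 \<Longrightarrow> a' s = 0" "\<And>s. cY s > 0 \<Longrightarrow> a' s = 0"
    by (rule admissible_SucE[OF assms[of "Suc n"]]) (rule that)
  have "deriv a = a'" using a'(1) by (intro ext DERIV_imp_deriv)
  with a' show "DERIV a s :> deriv a s" "admissible n (deriv a)"
    "cY s > 0 \<Longrightarrow> deriv a s = 0" "cY s < - 1 / 2 \<Longrightarrow> deriv a s = 0" by auto
qed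

lemma deriv_A_bound: "\<bar>deriv A s\<bar> \<le> 2 * M"
proof -
  obtain f' where f': "\<And>y. DERIV Th2 y :> f' y" using moderate_Th2[of "Suc 0"] by auto
  have "DERIV A s :> f' (Y s) * w (Y s)"
    unfolding A_def[abs_def] by (rule DERIV_chain2[OF f' DERIV_Y])
  then have "deriv A s = f' (Y s) * w (Y s)" by (rule DERIV_imp_deriv)
  moreover have "\<bar>f' (Y s)\<bar> \<le> M" using f'[of "Y s"] unfolding Th2_def[abs_def] by (rule st_deriv)
  moreover have "\<bar>w (Y s)\<bar> \<le> 2" by (rule w_bound[OF Y_pos])
  ultimately have "\<bar>f' (Y s)\<bar> * \<bar>w (Y s)\<bar> \<le> M * 2" using M_nonneg by (intro mult_mono) auto
  then show ?thesis using \<open>deriv A s = f' (Y s) * w (Y s)\<close> by (simp add: abs_mult)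
qed

definition P :: "real \<Rightarrow> real" where "P = osc eps A 0"
text \<open>Left in the shape produced by \<open>osc_DERIV\<close>, with unsimplified phases; in
  \<open>P2\<close> the mixed term therefore occurs twice.\<close>

definition P1 :: "real \<Rightarrow> real" where
  "P1 s = osc eps (deriv A) 0 s + osc (omc eps) A (0 + pi / 2) s"
definition P2 :: "real \<Rightarrow> real" where
  "P2 s = (osc eps (deriv (deriv A)) 0 s + osc (omc eps) (deriv A) (0 + pi / 2) s) +
    (osc (omc eps) (deriv A) (0 + pi / 2) s + osc (omc (omc eps)) A (0 + pi / 2 + pi / 2) s)"

lemmas A_props = admissible_deriv[of A, OF A_admissible]
lemmas A1_props = admissible_deriv[of "deriv A", OF A_props(2)]
lemmas A2_props = admissible_deriv[of "deriv (deriv A)", OF A1_props(2)]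

lemma A_zero: "cY s < - 1 / 2 \<Longrightarrow> A s = 0"
  using A_admissible[of 0] by (simp add: admissible_def)

lemma DERIV_P: "DERIV P s :> P1 s"
  unfolding P_def P1_def by (rule osc_DERIV[OF A_props(1) A_zero])

lemma DERIV_P1: "DERIV P1 s :> P2 s"
  unfolding P1_def[abs_def] P2_def
  by (intro DERIV_add osc_DERIV A_props A1_props A_zero)

lemmas coeff_eps_om = coeff_om[OF coeff_eps]
lemmas coeff_eps_om2 = coeff_om[OF coeff_eps_om]

lemma isCont_P2: "isCont P2 s"
  unfolding P2_def[abs_def]
  by (intro continuous_add)
    (rule DERIV_isCont, rule osc_DERIV, (rule A_props(1) A1_props(1) A2_props(1)), (rule A_zero A_props(4) A1_props(4)), assumption)+

lemma P2_bot: "(P2 \<longlongrightarrow> 0) at_bot"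
proof -
  have "(P2 \<longlongrightarrow> (0 + 0) + (0 + 0)) at_bot"
    unfolding P2_def[abs_def]
    by (intro tendsto_add osc_bot[OF coeff_eps A1_props(2)] osc_bot[OF coeff_eps_om A_props(2)]
        osc_bot[OF coeff_eps_om2 A_admissible])
  then show ?thesis by simp
qed

lemma P1_bot: "((\<lambda>s. 1 + P1 s) \<longlongrightarrow> 1) at_bot"
proof -
  have "((\<lambda>s. 1 + P1 s) \<longlongrightarrow> 1 + (0 + 0)) at_bot"
    unfolding P1_def[abs_def]
    by (intro tendsto_add tendsto_const osc_bot[OF coeff_eps A_props(2)] osc_bot[OF coeff_eps_om A_admissible])
  then show ?thesis by simp
qed

lemma P1_moderate: "tame at_bot n P1"
  unfolding P1_def[abs_def]
  by (intro unit_weight.moderate_add osc_moderate coeff_eps coeff_eps_om A_props A_admissible)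

lemma eps_le: "eps n \<le> 1 / qr n" "eps n \<ge> 0" "eps n * om n \<le> 2 * pi / qr n"
proof -
  have "qr n ^ 1 \<le> qr n ^ (n + 3)" using q_ge(1)[of n] by (intro power_increasing) auto
  then show "eps n \<le> 1 / qr n" unfolding eps_def using q_pos[of n]
    by (intro divide_left_mono mult_pos_pos zero_less_power) auto
  show "eps n \<ge> 0" by (simp add: eps_def)
  have "qr n ^ 2 \<le> qr n ^ (n + 3)" using q_ge(1)[of n] by (intro power_increasing) auto
  then have "eps n \<le> 1 / qr n ^ 2" unfolding eps_def using q_pos[of n]
    by (intro divide_left_mono mult_pos_pos zero_less_power) auto
  then have "eps n * om n \<le> 1 / qr n ^ 2 * om n" by (intro mult_right_mono) (auto simp: om_def)
  also have "\<dots> = 2 * pi / qr n" using q_pos[of n] by (simp add: om_def power2_eq_square)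
  finally show "eps n * om n \<le> 2 * pi / qr n" .
qed

lemma P_le: "\<bar>P s\<bar> \<le> 1"
proof -
  define n where "n = idx (Y s)"
  have "\<bar>P s\<bar> \<le> eps n * A s"
    using osc_le[of eps A 0 s] eps_le(2)[of n] A_range[of s] by (simp add: P_def n_def)
  also have "\<dots> \<le> 1 / qr n * 1" using eps_le[of n] A_range[of s] by (intro mult_mono) auto
  also have "\<dots> \<le> 1" using q_ge(1)[of n] by simp
  finally show ?thesis .
qed

text \<open>It keeps the slope of \<open>s + P s\<close> between \<open>1 / 2\<close> and
  \<open>3 / 2\<close>. The estimate is \<open>(2 * M + 2 * pi) / q n\<close>, which the lower bound
  on \<open>q n\<close> makes small.\<close>

lemma P1_le: "\<bar>P1 s\<bar> \<le> 1 / 2"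
proof -
  define n where "n = idx (Y s)"
  have "\<bar>P1 s\<bar> \<le> eps n * \<bar>deriv A s\<bar> + eps n * om n * A s"
    using osc_le[of eps "deriv A" 0 s] osc_le[of "omc eps" A "0 + pi / 2" s] eps_le(2)[of n]
      A_range[of s]
    by (simp add: P1_def n_def abs_mult om_def)
  also have "\<dots> \<le> 1 / qr n * (2 * M) + 2 * pi / qr n * 1"
    using eps_le[of n] A_range[of s] deriv_A_bound[of s] M_nonneg by (intro add_mono mult_mono) (auto simp: om_def)
  also have "\<dots> = (2 * M + 2 * pi) / qr n" by (simp add: add_divide_distrib)
  also have "\<dots> \<le> (2 * M + 8) / qr n" using pi_less_4 by (intro divide_right_mono) auto
  also have "\<dots> \<le> 1 / 2" using q_ge_M[of n] q_pos[of n] by (simp add: divide_le_eq)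
  finally show ?thesis .
qed

end

section \<open>The perturbed time coordinate\<close>

context oscillating_flow
begin

definition h :: "real \<Rightarrow> real" where "h s = s + P s"
definition psi :: "real \<Rightarrow> real" where "psi s = psi0 (h s)"
definition psi1 :: "real \<Rightarrow> real" where "psi1 s = nu0 (psi0 (h s)) * (1 + P1 s)"
definition psi2 :: "real \<Rightarrow> real" where
  "psi2 s = nu0 (psi0 (h s)) * P2 s + deriv nu0 (psi0 (h s)) * nu0 (psi0 (h s)) * (1 + P1 s) * (1 + P1 s)"

lemma h_near: "\<bar>h s - s\<bar> \<le> 1"
  using P_le by (simp add: h_def)

lemma DERIV_h: "DERIV h s :> 1 + P1 s"
  unfolding h_def[abs_def] by (rule DERIV_add[OF DERIV_ident DERIV_P])

lemma one_plus_P1: "1 / 2 \<le> 1 + P1 s" "1 + P1 s \<le> 3 / 2"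
  using P1_le[of s] by (simp_all add: abs_le_iff)

lemma h_bot: "filterlim h at_bot at_bot"
  by (rule filterlim_at_bot_mono[OF base.filterlim_add_at_bot[of 1]])
    (use abs_le_D1[OF h_near] in \<open>auto simp: algebra_simps\<close>)

lemma h_top: "filterlim h at_top at_top"
  unfolding filterlim_at_top
proof
  fix Z :: real
  show "\<forall>\<^sub>F s in at_top. Z \<le> h s"
    using eventually_ge_at_top[of "Z + 1"]
  proof (rule eventually_mono)
    show "Z \<le> h s" if "Z + 1 \<le> s" for s using abs_le_D2[OF h_near[of s]] that by linarith
  qed
qed

lemma isCont_h: "isCont h s" using DERIV_h by (rule DERIV_isCont)

lemma DERIV_psi: "DERIV psi s :> psi1 s"
  unfolding psi_def[abs_def] psi1_def by (rule DERIV_chain2[OF DERIV_psi0 DERIV_h])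

lemma DERIV_psi1: "DERIV psi1 s :> psi2 s"
proof -
  have "DERIV (\<lambda>s. nu0 (psi0 (h s))) s :> deriv nu0 (psi0 (h s)) * nu0 (psi0 (h s)) * (1 + P1 s)"
    by (rule DERIV_chain2[OF DERIV_nu0_psi0 DERIV_h])
  from DERIV_mult'[OF this DERIV_add[OF DERIV_const DERIV_P1], of 1]
  show ?thesis unfolding psi1_def[abs_def] psi2_def by simp
qed

lemma psi1_pos: "psi1 s > 0"
  unfolding psi1_def using one_plus_P1[of s] nu0_pos[OF psi0_pos] by (intro mult_pos_pos) auto

sublocale pert: time_coordinate psi psi1 psi2
proof
  show "continuous_on UNIV psi2"
    unfolding psi2_def[abs_def]
    by (intro continuous_at_imp_continuous_on ballI continuous_add continuous_mult continuous_const isCont_P2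
        DERIV_isCont[OF DERIV_P1] isCont_o2[OF isCont_h] isCont_o2[OF isCont_o2[OF isCont_h isCont_psi0]]
        isCont_deriv_nu0 DERIV_isCont[OF DERIV_nu0] isCont_psi0)
  show "(psi \<longlongrightarrow> 0) at_bot"
    unfolding psi_def[abs_def] by (rule filterlim_compose[OF psi0_bot h_bot])
  show "filterlim psi at_top at_top"
    unfolding psi_def[abs_def] by (rule filterlim_compose[OF psi0_top h_top])
  have lim: "((\<lambda>s. nu0 (psi0 (h s))) \<longlongrightarrow> 0) at_bot"
    by (rule filterlim_compose[OF nu0_psi0_bot h_bot])
  show "(psi1 \<longlongrightarrow> 0) at_bot"
    using tendsto_mult[OF lim P1_bot] by (simp add: psi1_def[abs_def])
  \<comment> \<open>The speed cancels: in the cores the oscillation contributes \<open>P2\<close>,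
    of order \<open>eps n * (om n)\<^sup>2\<close>, which tends to 0. Second derivatives of the
    time-\<open>t\<close> maps are divided by the speed once more, and there the effect keeps size
    1.\<close>
  have "psi2 s / psi1 s = P2 s / (1 + P1 s) + deriv nu0 (psi0 (h s)) * (1 + P1 s)" for s
  proof -
    have "nu0 (psi0 (h s)) \<noteq> 0" "1 + P1 s \<noteq> 0" using nu0_pos[OF psi0_pos[of "h s"]] one_plus_P1[of s] by auto
    then show ?thesis by (simp add: psi1_def psi2_def add_divide_distrib)
  qed
  moreover have "((\<lambda>s. P2 s / (1 + P1 s) + deriv nu0 (psi0 (h s)) * (1 + P1 s)) \<longlongrightarrow> 0 / 1 + 0 * 1) at_bot"
    by (intro tendsto_add tendsto_divide tendsto_mult P2_bot P1_bot one_neq_zero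
        filterlim_compose[OF deriv_nu0_psi0_bot h_bot])
  ultimately show "((\<lambda>s. psi2 s / psi1 s) \<longlongrightarrow> 0) at_bot" by simp
qed (use DERIV_psi DERIV_psi1 psi0_pos psi1_pos in \<open>auto simp: psi_def\<close>)

subsection \<open>Smooth times\<close>

text \<open>Times after which the \<open>n\<close>-th oscillation returns to its phase up to
  \<open>2 * pi * eta n\<close>.\<close>

definition times :: "real set" where
  "times = {t. \<forall>n. \<exists>m::int. \<bar>qr n * t - of_int m\<bar> \<le> eta n}"

text \<open>The reciprocal of the speed of the base field at the point \<open>psi s\<close>. A
  derivative in \<open>x\<close> costs a factor of this order, so flatness in \<open>x\<close> is
  measured by its powers.\<close>

definition v :: "real \<Rightarrow> real" where "v s = 1 / u (Y (h s))"

lemma v_pos: "v s > 0" by (simp add: v_def u_pos)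

lemma v_ge_1: "v s \<ge> 1"
proof -
  have "u (Y (h s)) \<le> exp (- Y (h s))" by (rule u_le)
  also have "\<dots> \<le> 1" using Y_pos[of "h s"] by simp
  finally show ?thesis using u_pos[of "Y (h s)"] by (simp add: v_def)
qed

interpretation weight: growth_weight at_bot v
  by standard (simp add: v_ge_1)

lemma idx_eqI:
  assumes "cos (2 * pi * y) > 0" "\<bar>z - y\<bar> \<le> 1 / 64" shows "idx z = idx y"
proof -
  have "\<bar>z - of_int (round y)\<bar> < 1 / 2"
    using cos_pos_imp_near_round[OF assms(1)] assms(2) by linarith
  then have "round z = round y" by (rule round_unique')
  then show ?thesis by (simp add: idx_def)
qed

lemma cos_move:
  assumes "\<bar>z - y\<bar> \<le> 1 / 64" shows "\<bar>cos (2 * pi * z) - cos (2 * pi * y)\<bar> \<le> 1 / 8"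
proof -
  have "\<bar>cos (2 * pi * z) - cos (2 * pi * y)\<bar> \<le> \<bar>2 * pi * z - 2 * pi * y\<bar>" by (rule cos_lipschitz)
  also have "\<dots> = 2 * pi * \<bar>z - y\<bar>" by (simp add: abs_mult right_diff_distrib[symmetric])
  also have "\<dots> \<le> 2 * pi * (1 / 64)" using assms by (intro mult_left_mono) auto
  also have "\<dots> \<le> 1 / 8" using pi_less_4 by simp
  finally show ?thesis .
qed

lemma v_le_inner:
  assumes "cY s > 0" "\<bar>Y (h s) - Y s\<bar> \<le> 1 / 64"
  shows "v s \<le> qr (idx (Y s)) ^ (idx (Y s) + 1)"
proof -
  define n where "n = idx (Y s)"
  have "lam n \<le> u (Y (h s))" using u_ge_lam[of "Y (h s)"] idx_eqI[OF assms] by (simp add: n_def)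
  then have "1 / u (Y (h s)) \<le> 1 / lam n"
    using lam_pos[of n] u_pos by (intro divide_left_mono mult_pos_pos) auto
  then show ?thesis by (simp add: v_def lam_def n_def)
qed

text \<open>Here \<open>h s\<close> lies where \<open>Th\<close> vanishes and the speed is
  \<open>exp (- y)\<close>; then \<open>q n \<ge> exp (n + 1)\<close> applies at the index of any
  nearby \<open>r\<close>. It is used for \<open>r = s\<close> and \<open>r = s + t\<close>, whose
  indices may differ.\<close>

lemma v_le_outer:
  assumes "cY s \<le> 1 / 8" "\<bar>Y (h s) - Y s\<bar> \<le> 1 / 64" "\<bar>Y r - Y s\<bar> \<le> 1 / 64"
  shows "v s \<le> qr (idx (Y r))"
proof -
  have "cos (2 * pi * Y (h s)) \<le> 1 / 4" using cos_move[OF assms(2)] assms(1) by linarith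
  then have "u (Y (h s)) = exp (- Y (h s))" by (rule u_outside)
  then have "v s = exp (Y (h s))"
    using exp_minus[of "- Y (h s)"] by (simp only: v_def inverse_eq_divide minus_minus)
  also have "\<dots> \<le> exp (real (idx (Y r)) + 1)"
    unfolding exp_le_cancel_iff using idx_ge[of "Y r"] assms(2,3) by linarith
  also have "\<dots> \<le> qr (idx (Y r))" by (rule q_ge(2))
  finally show ?thesis .
qed

lemma sin_om_shift:
  assumes "\<bar>qr n * t - of_int m\<bar> \<le> eta n"
  shows "\<bar>sin (om n * (s + t) + b) - sin (om n * s + b)\<bar> \<le> 2 * pi * eta n"
proof -
  have "sin (om n * (s + t) + b) = sin (om n * s + b + 2 * pi * (qr n * t - of_int m))"
  proof -
    have "om n * (s + t) + b = (om n * s + b + 2 * pi * (qr n * t - of_int m)) + 2 * pi * of_int m"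
      by (simp add: om_def algebra_simps)
    then show ?thesis by (simp only: sin_add sin_int_2pin cos_int_2pin mult_1_right mult_zero_right add_0_right)
  qed
  then have "\<bar>sin (om n * (s + t) + b) - sin (om n * s + b)\<bar> \<le> \<bar>2 * pi * (qr n * t - of_int m)\<bar>"
    using sin_lipschitz[of "om n * s + b + 2 * pi * (qr n * t - of_int m)" "om n * s + b"] by simp
  also have "\<dots> = 2 * pi * \<bar>qr n * t - of_int m\<bar>" by (simp add: abs_mult)
  also have "\<dots> \<le> 2 * pi * eta n" using assms by (intro mult_left_mono) auto
  finally show ?thesis .
qed

text \<open>Where \<open>v\<close> may be as large as \<open>1 / lam n\<close>, the amplitude is constant and the difference is
  small because \<open>q n * t\<close> is nearly an integer; elsewhere \<open>v \<le> q n\<close>, and the coefficients alone suffice.\<close>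

lemma osc_diff_negligible_0:
  assumes c: "coeff c" and a: "admissible 0 a" and t: "t \<in> times"
  shows "negligible at_bot v 0 (\<lambda>s. osc c a b (s + t) - osc c a b s)"
  unfolding negligible.simps
proof
  fix N
  obtain K where K: "K \<ge> 0" "\<forall>\<^sub>F s in at_bot. \<bar>a s\<bar> \<le> K" using admissible_bounded[OF a] by blast
  from a obtain k where k: "\<And>s. cY s > 0 \<Longrightarrow> a s = k" unfolding admissible_def by blast
  define g1 g2 where "g1 n = \<bar>c n\<bar> * qr n ^ N" and "g2 n = \<bar>c n\<bar> * eta n * qr n ^ ((n + 1) * N)" for n
  have g_nonneg: "g1 n \<ge> 0" "g2 n \<ge> 0" for n by (auto simp: g1_def g2_def eta_def)
  have lim1: "((\<lambda>s. g1 (idx (Y (s + r)))) \<longlongrightarrow> 0) at_bot" for r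
    unfolding g1_def by (rule filterlim_compose[OF coeff_lim(1)[OF c] idx_Y_bot])
  have lim2: "((\<lambda>s. g2 (idx (Y (s + 0)))) \<longlongrightarrow> 0) at_bot"
    unfolding g2_def by (rule filterlim_compose[OF coeff_lim(2)[OF c] idx_Y_bot])
  have lim: "((\<lambda>s. K * g1 (idx (Y (s + t))) + K * g1 (idx (Y (s + 0))) + \<bar>k\<bar> * (2 * pi) * g2 (idx (Y (s + 0)))) \<longlongrightarrow> 0) at_bot"
    by (intro tendsto_add_zero tendsto_mult_right_zero lim1 lim2)
  have ev: "\<forall>\<^sub>F s in at_bot. \<bar>a (s + t)\<bar> \<le> K"
    using K(2) base.filterlim_add_at_bot by (rule eventually_compose_filterlim)
  show "((\<lambda>s. v s ^ N * (osc c a b (s + t) - osc c a b s)) \<longlongrightarrow> 0) at_bot"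
  proof (rule Lim_null_comparison[OF _ lim])
    have "\<forall>\<^sub>F s in at_bot. \<forall>r. \<bar>r - s\<bar> \<le> \<bar>t\<bar> + 1 \<longrightarrow> \<bar>Y r - Y s\<bar> \<le> 1 / 64"
      by (rule Y_move) auto
    then show "\<forall>\<^sub>F s in at_bot. norm (v s ^ N * (osc c a b (s + t) - osc c a b s))
      \<le> K * g1 (idx (Y (s + t))) + K * g1 (idx (Y (s + 0))) + \<bar>k\<bar> * (2 * pi) * g2 (idx (Y (s + 0)))"
      using K(2) ev
    proof eventually_elim
      case (elim s)
      let ?d = "osc c a b (s + t) - osc c a b s"
      have hY: "\<bar>Y (h s) - Y s\<bar> \<le> 1 / 64" using elim(1) h_near[of s] by auto
      have tY: "\<bar>Y (s + t) - Y s\<bar> \<le> 1 / 64" using elim(1) by auto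
      define n where "n = idx (Y s)"
      have vN: "v s ^ N \<ge> 0" using v_pos[of s] by simp
      show ?case
      \<comment> \<open>Moving \<open>Y\<close> by \<open>1 / 64\<close> changes the cosine by at
        most \<open>1 / 8\<close>. Above this threshold the cosine is thus positive at
        \<open>s + t\<close> too, so index and amplitude agree at both points; below it,
        \<open>v_le_outer\<close> applies.\<close>
      proof (cases "cY s > 1 / 8")
        case True
        then have c0: "cY s > 0" by simp
        have ct: "cos (2 * pi * Y (s + t)) > 0" using cos_move[OF tY] True by linarith
        have n': "idx (Y (s + t)) = n" using idx_eqI[OF c0 tY] by (simp add: n_def)
        from t obtain m where m: "\<bar>qr n * t - of_int m\<bar> \<le> eta n" unfolding times_def by blast
        have "?d = c n * k * (sin (om n * (s + t) + b) - sin (om n * s + b))"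
          by (simp add: osc_def n' n_def[symmetric] k[OF c0] k[OF ct] right_diff_distrib)
        then have "\<bar>?d\<bar> \<le> \<bar>c n * k\<bar> * (2 * pi * eta n)"
          by (simp only: abs_mult) (intro mult_left_mono sin_om_shift[OF m], simp)
        moreover have "v s ^ N \<le> (qr n ^ (n + 1)) ^ N"
          using v_le_inner[OF c0 hY] v_pos[of s] unfolding n_def by (intro power_mono) auto
        ultimately have "v s ^ N * \<bar>?d\<bar>
            \<le> (qr n ^ (n + 1)) ^ N * (\<bar>c n * k\<bar> * (2 * pi * eta n))"
          using vN by (intro mult_mono) auto
        also have "\<dots> = \<bar>k\<bar> * (2 * pi) * g2 n"
          by (simp only: g2_def abs_mult power_mult[symmetric] mult_ac)
        finally have "norm (v s ^ N * ?d) \<le> \<bar>k\<bar> * (2 * pi) * g2 n"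
          using vN by (simp add: abs_mult)
        then show ?thesis
          using K(1) g_nonneg(1) by (simp add: n_def add_increasing)
      next
        case False
        then have c8: "cY s \<le> 1 / 8" by simp
        have est: "v s ^ N * \<bar>osc c a b r\<bar> \<le> K * g1 (idx (Y r))"
          if "\<bar>a r\<bar> \<le> K" "\<bar>Y r - Y s\<bar> \<le> 1 / 64" for r
        proof -
          have "\<bar>osc c a b r\<bar> \<le> \<bar>c (idx (Y r))\<bar> * K"
            using osc_le[of c a b r] mult_left_mono[OF that(1), of "\<bar>c (idx (Y r))\<bar>"] by linarith
          moreover have "v s ^ N \<le> qr (idx (Y r)) ^ N"
            using v_le_outer[OF c8 hY that(2)] v_pos[of s] by (intro power_mono) auto
          ultimately have "v s ^ N * \<bar>osc c a b r\<bar> \<le> qr (idx (Y r)) ^ N * (\<bar>c (idx (Y r))\<bar> * K)"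
            using vN by (intro mult_mono) auto
          then show ?thesis by (simp add: g1_def mult_ac)
        qed
        have "v s ^ N * \<bar>?d\<bar> \<le> v s ^ N * (\<bar>osc c a b (s + t)\<bar> + \<bar>osc c a b s\<bar>)"
          using vN by (intro mult_left_mono) auto
        also have "\<dots> \<le> K * g1 (idx (Y (s + t))) + K * g1 (idx (Y s))"
          unfolding distrib_left using elim tY by (intro add_mono est) auto
        finally have "norm (v s ^ N * ?d) \<le> K * g1 (idx (Y (s + t))) + K * g1 (idx (Y s))"
          using vN by (simp add: abs_mult)
        moreover have "0 \<le> \<bar>k\<bar> * (2 * pi) * g2 (idx (Y s))" using g_nonneg(2) by simp
        ultimately show ?thesis unfolding add_0_right by linarith
      qed
    qed
  qed
qed

lemma osc_diff_negligible:
  "coeff c \<Longrightarrow> admissible n a \<Longrightarrow> t \<in> times \<Longrightarrow> negligible at_bot v n (\<lambda>s. osc c a b (s + t) - osc c a b s)"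
proof (induction n arbitrary: c a b)
  case 0
  then show ?case by (rule osc_diff_negligible_0)
next
  case (Suc n)
  obtain a' where a': "\<And>s. DERIV a s :> a' s" "admissible n a'"
    by (rule admissible_SucE[OF Suc.prems(2)]) (rule that)
  have z: "a s = 0" if "cY s < - 1 / 2" for s
    using Suc.prems(2) that by (auto simp: admissible_def)
  define D where "D s = osc c a' b s + osc (omc c) a (b + pi / 2) s" for s
  have d: "(osc c a b has_real_derivative D s) (at s)" for s
    unfolding D_def by (rule osc_DERIV[OF a'(1) z])
  have "DERIV (\<lambda>s. osc c a b (s + t)) s :> D (s + t)" for s
    using d[of "s + t"] DERIV_shift[of "osc c a b" "D (s + t)" s t] by simp
  from DERIV_diff[OF this d]
  have dd: "DERIV (\<lambda>s. osc c a b (s + t) - osc c a b s) s :> (osc c a' b (s + t) - osc c a' b s) +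
      (osc (omc c) a (b + pi / 2) (s + t) - osc (omc c) a (b + pi / 2) s)" for s
    by (rule DERIV_cong) (simp add: D_def)
  show ?case
    by (rule negligible_SucI[OF osc_diff_negligible_0[OF Suc.prems(1) admissible_0I[OF Suc.prems(2)] Suc.prems(3)] dd
          weight.negligible_add[OF Suc.IH[OF Suc.prems(1) a'(2) Suc.prems(3)]
            Suc.IH[OF coeff_om[OF Suc.prems(1)] admissible_SucD[OF Suc.prems(2)] Suc.prems(3)]]])
qed

text \<open>By the chain rule, each derivative in \<open>x\<close> of a function of the time brings
  in \<open>1 / psi1\<close>. Since \<open>psi1\<close> is bounded with all its derivatives, it
  remains to see that \<open>1 / psi1 \<le> 2 * v\<close>, which holds as
  \<open>1 + P1 \<ge> 1 / 2\<close>.\<close>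

lemma moderate_inverse_psi1: "moderate at_bot v n (\<lambda>s. 1 / psi1 s)"
proof (rule weight.moderate_inverse[OF psi1_pos])
  have z: "tame at_bot n (\<lambda>s. 1 + P1 s)" for n
    by (intro unit_weight.moderate_add moderate_const P1_moderate)
  have "DERIV (\<lambda>s. Y (h s)) s :> w (Y (h s)) * (1 + P1 s)" for s
    by (rule DERIV_chain2[OF DERIV_Y DERIV_h])
  from tame_compose_coord[OF filterlim_compose[OF Y_bot h_bot] this
      top_weight.negligible_imp_tame[OF negligible_w]
      top_weight.negligible_imp_tame[OF negligible_u] z]
  have "tame at_bot n (\<lambda>s. u (Y (h s)))" .
  from unit_weight.moderate_mult[OF this z]
  have "tame at_bot n psi1" by (simp add: psi1_def[abs_def] nu0_psi0)
  then show "moderate at_bot v n psi1" by (rule tame_imp_moderate[OF weight.weight_ge_1])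
  have "\<bar>1 / psi1 s\<bar> \<le> 2 * v s ^ 1" for s
  proof -
    have "1 / (u (Y (h s)) * (1 + P1 s)) \<le> 1 / (u (Y (h s)) * (1 / 2))"
      using one_plus_P1(1)[of s] u_pos[of "Y (h s)"] by (intro divide_left_mono mult_left_mono mult_pos_pos) auto
    then show ?thesis using psi1_pos[of s] by (simp add: psi1_def nu0_psi0 v_def)
  qed
  then show "moderate at_bot v 0 (\<lambda>s. 1 / psi1 s)"
    unfolding moderate.simps by (intro exI[of _ 1] exI[of _ 2] always_eventually allI)
qed

lemma pert_fl_smooth:
  assumes t: "t \<in> times" shows "Cn_on n (pert.fl t) {0..}"
proof -
  define Q where "Q s = P (s + t) - P s" for s
  define G where "G x = (if x > 0 then Q (pert.\<tau> x) else 0)" for x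
  have "negligible at_bot v n Q" for n
    unfolding Q_def[abs_def] P_def by (rule osc_diff_negligible[OF coeff_eps A_admissible t])
  then have "Cn_on n G UNIV" for n
    unfolding G_def[abs_def]
    by (intro weight.Cn_on_extend_zero[OF pert.tau_at_bot pert.DERIV_tau moderate_inverse_psi1])
  then have "Cn_on n (\<lambda>x. t + G x) {0..}" for n
    by (intro Cn_on_add Cn_on_const) (rule Cn_on_subset, auto)
  from base.smooth_fl_variable_time[OF base_nu_smooth this]
  have "Cn_on n (\<lambda>x. base.fl (t + G x) x) {0..}" .
  moreover have "base.fl (t + G x) x = pert.fl t x" if "x \<in> {0..}" for x
  proof -
    from that have "x \<ge> 0" by simp
    then show ?thesis
    proof (cases rule: pert.half_line_cases)
      case (2 s)
      then have "G x = Q s" using pert.pos[of s] by (simp add: G_def)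
      moreover have "x = psi0 (h s)" using 2 by (simp add: psi_def)
      ultimately have "base.fl (t + G x) x = psi0 (h s + (t + Q s))" by simp
      also have "h s + (t + Q s) = h (s + t)" by (simp add: Q_def h_def)
      also have "psi0 (h (s + t)) = pert.fl t x" unfolding 2 pert.fl_psi by (simp add: psi_def)
      finally show ?thesis .
    qed simp
  qed
  ultimately show ?thesis using Cn_on_cong[of "{0..}" "\<lambda>x. base.fl (t + G x) x" "pert.fl t"] by simp
qed

lemma times_uminus: "t \<in> times \<Longrightarrow> - t \<in> times"
  unfolding times_def
proof (intro CollectI allI)
  fix n assume "t \<in> {t. \<forall>n. \<exists>m::int. \<bar>qr n * t - of_int m\<bar> \<le> eta n}"
  then obtain m :: int where "\<bar>qr n * t - of_int m\<bar> \<le> eta n" by blast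
  moreover have "qr n * - t - of_int (- m) = - (qr n * t - of_int m)" by simp
  ultimately show "\<exists>m::int. \<bar>qr n * - t - of_int m\<bar> \<le> eta n" by (metis abs_minus_cancel)
qed

lemma times_imp_Diff: "t \<in> times \<Longrightarrow> pert.fl t \<in> Diff r"
  unfolding pert.fl_Diff_iff Cr_on_def using pert_fl_smooth times_uminus by blast

lemma one_in_times: "1 \<in> times"
  unfolding times_def
proof (intro CollectI allI)
  show "\<exists>m::int. \<bar>qr n * 1 - of_int m\<bar> \<le> eta n" for n
    by (rule exI[of _ "int (q n)"]) (simp add: eta_def)
qed

subsection \<open>Non-smooth times\<close>

text \<open>The amplitude is constantly 1 around \<open>s\<close>, and the base field is constantly
  \<open>lam n\<close> around \<open>h s\<close>, so that its derivative drops out of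
  \<open>psi2\<close>. Both points have to be in the core: the oscillation is evaluated at
  \<open>s\<close>, the field at \<open>h s\<close>.\<close>

lemma psi_core:
  assumes "\<bar>Y s - real n\<bar> \<le> 1 / 32" "\<bar>Y (h s) - real n\<bar> \<le> 1 / 32"
  shows "psi1 s = lam n * (1 + eps n * om n * cos (om n * s))"
    "psi2 s = - lam n * (eps n * om n * om n) * sin (om n * s)"
    "P1 s = eps n * om n * cos (om n * s)"
proof -
  have idx: "idx y = n" if "\<bar>y - real n\<bar> \<le> 1 / 32" for y
  proof -
    have "\<bar>y - of_int (int n)\<bar> < 1 / 2" using that by simp
    then have "round y = int n" by (rule round_unique')
    then show ?thesis by (simp add: idx_def)
  qed
  have cos: "cos (2 * pi * y) > 3 / 4" if "\<bar>y - real n\<bar> \<le> 1 / 32" for y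
    using cos_near_int[of y "int n"] that by simp
  have c0: "cY s > 0" using cos[OF assms(1)] by simp
  have A1: "A s = 1" using c0 by (simp add: A_def Th2_def st_1)
  have dA: "deriv A s = 0" "deriv (deriv A) s = 0" using A_props(3) A1_props(3) c0 by auto
  have s1: "sin (om n * s + (0 + pi / 2)) = cos (om n * s)" by (simp add: sin_add)
  have s2: "sin (om n * s + (0 + pi / 2 + pi / 2)) = - sin (om n * s)" by (simp add: sin_add)
  show p1: "P1 s = eps n * om n * cos (om n * s)"
    unfolding P1_def osc_def idx[OF assms(1)] dA A1 s1 by simp
  have p2: "P2 s = - (eps n * om n * om n) * sin (om n * s)"
    unfolding P2_def osc_def idx[OF assms(1)] dA A1 s1 s2 by simp
  have u: "nu0 (psi0 (h s)) = lam n"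
    unfolding nu0_psi0 using u_inside[OF less_imp_le[OF cos[OF assms(2)]]] idx[OF assms(2)] by simp
  have "\<forall>\<^sub>F r in nhds (h s). cos (2 * pi * Y r) > 3 / 4"
    by (rule eventually_cos_greater[OF isCont_Y cos[OF assms(2)]])
  moreover have "\<forall>\<^sub>F r in nhds (h s). idx (Y r) = idx (Y (h s))"
    by (rule eventually_idx_const[OF isCont_Y]) (use cos[OF assms(2)] in simp)
  ultimately have "\<forall>\<^sub>F r in nhds (h s). nu0 (psi0 r) = lam n"
    by eventually_elim (simp add: nu0_psi0 u_inside idx[OF assms(2)])
  then have du: "deriv nu0 (psi0 (h s)) * nu0 (psi0 (h s)) = 0"
    using DERIV_nu0_psi0 by (rule DERIV_eventually_const)
  show "psi1 s = lam n * (1 + eps n * om n * cos (om n * s))"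
    unfolding psi1_def u p1 ..
  show "psi2 s = - lam n * (eps n * om n * om n) * sin (om n * s)"
    unfolding psi2_def du unfolding u p2 by simp
qed

text \<open>Start where \<open>Y s = n\<close>; in the far past \<open>Y\<close> drifts so slowly
  that a window of any prescribed length stays in the core.\<close>

lemma core_exists:
  assumes "D \<ge> 0"
  shows "\<exists>N. \<forall>n\<ge>N. \<exists>s. s \<le> B \<and> (\<forall>r. \<bar>r - s\<bar> \<le> D \<longrightarrow> \<bar>Y r - real n\<bar> \<le> 1 / 32)"
proof -
  from Y_move[OF assms, of "1 / 32"] obtain B' where
    B': "\<And>s r. s \<le> B' \<Longrightarrow> \<bar>r - s\<bar> \<le> D \<Longrightarrow> \<bar>Y r - Y s\<bar> \<le> 1 / 32"
    unfolding eventually_at_bot_linorder by auto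
  define C where "C = min B B'"
  obtain N where N: "real N > Y C" using reals_Archimedean2 by blast
  have "\<exists>s. s \<le> B \<and> (\<forall>r. \<bar>r - s\<bar> \<le> D \<longrightarrow> \<bar>Y r - real n\<bar> \<le> 1 / 32)" if "n \<ge> N" for n
  proof -
    have nY: "real n > Y C" using N that by linarith
    then have n0: "real n > 0" using Y_pos[of C] by linarith
    obtain s where s: "psi0 s = 1 / real n" using base.psi_surj[of "1 / real n"] n0 by auto
    have Ys: "Y s = real n" using s by (simp add: Y_def)
    have "psi0 s < psi0 C" using nY n0 psi0_pos[of C] by (simp add: s Y_def field_simps)
    then have "s < C" using strict_mono_less[OF base.strict_mono_psi] by blast
    then show ?thesis using B'[of s] Ys by (intro exI[of _ s]) (auto simp: C_def)
  qed
  then show ?thesis by blast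
qed

text \<open>At points of the \<open>n\<close>-th core with \<open>cos (om n * s) = 0\<close> and \<open>sin (om n * s) = S\<close>, the second
  derivative of the time-\<open>t\<close> map is \<open>4 \<pi>\<^sup>2 S (1 + P1 (s + t) - cos (om n * t))\<close>. If \<open>cos (om n * t) \<le> 0\<close>
  for infinitely many \<open>n\<close>, then \<open>S = 1\<close> and \<open>S = - 1\<close> give incompatible limits at \<open>0\<close>.\<close>

lemma C2_imp_cos_pos:
  assumes C2: "Cn_on 2 (pert.fl t) {0..}"
  shows "\<forall>\<^sub>F n in sequentially. cos (om n * t) > 0"
proof -
  have "Cn_on (Suc 1) (pert.fl t) {0..}" using C2 by (simp add: numeral_2_eq_2)
  then obtain g1 where g1: "\<forall>x\<in>{0..}. (pert.fl t has_real_derivative g1 x) (at x within {0..})" "Cn_on 1 g1 {0..}"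
    unfolding Cn_on.simps(2) by (elim exE conjE)
  obtain g2 where g2: "\<And>x. x \<in> {0..} \<Longrightarrow> (g1 has_real_derivative g2 x) (at x within {0..})" "continuous_on {0..} g2"
    by (rule Cn_on_1E[OF g1(2)], rule that)
  have g1_psi: "g1 (psi s) = psi1 (s + t) / psi1 s" for s
  proof -
    have "DERIV (pert.fl t) (psi s) :> g1 (psi s)"
      using bspec[OF g1(1), of "psi s"] pert.pos[of s] at_half_line[OF pert.pos[of s]] by simp
    moreover have "DERIV (pert.fl t) (psi s) :> psi1 (s + t) / psi1 s"
      using pert.fl_DERIV[OF pert.pos[of s], of t] by simp
    ultimately show ?thesis by (rule DERIV_unique)
  qed
  have g2_psi: "g2 (psi s) * psi1 s = (psi2 (s + t) * psi1 s - psi1 (s + t) * psi2 s) / (psi1 s * psi1 s)" for s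
  proof -
    have "DERIV g1 (psi s) :> g2 (psi s)"
      using g2(1)[of "psi s"] pert.pos[of s] at_half_line[OF pert.pos[of s]] by simp
    from DERIV_chain2[OF this DERIV_psi]
    have "DERIV (\<lambda>s. psi1 (s + t) / psi1 s) s :> g2 (psi s) * psi1 s"
      by (simp add: g1_psi)
    moreover have "DERIV (\<lambda>s. psi1 (s + t)) s :> psi2 (s + t)"
      using DERIV_psi1[of "s + t"] DERIV_shift[of psi1 "psi2 (s + t)" s t] by simp
    from DERIV_divide[OF this DERIV_psi1] psi1_pos[of s]
    have "DERIV (\<lambda>s. psi1 (s + t) / psi1 s) s :> (psi2 (s + t) * psi1 s - psi1 (s + t) * psi2 s) / (psi1 s * psi1 s)" by simp
    ultimately show ?thesis by (rule DERIV_unique)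
  qed
  have "(g2 \<longlongrightarrow> g2 0) (at_right 0)"
    using g2(2)[unfolded continuous_on_def, rule_format, of 0] by (simp add: pert.at_0_half_line)
  then have "((\<lambda>s. g2 (psi s)) \<longlongrightarrow> g2 0) at_bot" using pert.psi_at_right by (rule filterlim_compose)
  then have "\<forall>\<^sub>F s in at_bot. dist (g2 (psi s)) (g2 0) < 1" by (rule tendstoD) simp
  then obtain B where B: "\<And>s. s \<le> B \<Longrightarrow> \<bar>g2 (psi s) - g2 0\<bar> < 1"
    unfolding eventually_at_bot_linorder dist_real_def by blast
  \<comment> \<open>A point of \<open>[s0, s0 + 1]\<close>, shifted by \<open>t\<close> and then
    moved by at most 1 by \<open>h\<close>, stays in this window, and \<open>s0 \<le> B - 1\<close>
    keeps the interval below \<open>B\<close>.\<close>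
  obtain N where N: "\<And>n. n \<ge> N \<Longrightarrow> \<exists>s. s \<le> B - 1 \<and> (\<forall>r. \<bar>r - s\<bar> \<le> \<bar>t\<bar> + 3 \<longrightarrow> \<bar>Y r - real n\<bar> \<le> 1 / 32)"
    using core_exists[of "\<bar>t\<bar> + 3" "B - 1"] by auto
  have "cos (om n * t) > 0" if n: "n \<ge> N" for n
  proof (rule ccontr)
    assume "\<not> cos (om n * t) > 0"
    then have cos_t: "cos (om n * t) \<le> 0" by simp
    from N[OF n] obtain s0 where s0: "s0 \<le> B - 1" "\<And>r. \<bar>r - s0\<bar> \<le> \<bar>t\<bar> + 3 \<Longrightarrow> \<bar>Y r - real n\<bar> \<le> 1 / 32"
      by blast
    have E: "eps n * om n * om n = 4 * pi\<^sup>2 * lam n"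
      using q_pos[of n] by (simp add: eps_def om_def lam_def power2_eq_square power3_eq_cube power_add field_simps)
    have g2_val: "g2 (psi s) = 4 * pi\<^sup>2 * S * (1 + P1 (s + t) - cos (om n * t))"
      if s: "s0 \<le> s" "s \<le> s0 + 1" and S: "sin (om n * s) = S" "cos (om n * s) = 0" for s S
    proof -
      have "\<bar>Y s - real n\<bar> \<le> 1 / 32" "\<bar>Y (h s) - real n\<bar> \<le> 1 / 32"
        "\<bar>Y (s + t) - real n\<bar> \<le> 1 / 32" "\<bar>Y (h (s + t)) - real n\<bar> \<le> 1 / 32"
        using s h_near[of s] h_near[of "s + t"] by (intro s0(2); linarith)+
      note core = psi_core[OF this(1,2)] psi_core[OF this(3,4)]
      have "sin (om n * (s + t)) = S * cos (om n * t)"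
        unfolding distrib_left sin_add S by simp
      with core S have eqs: "psi1 s = lam n" "psi2 s = - lam n * (4 * pi\<^sup>2 * lam n) * S"
        "psi1 (s + t) = lam n * (1 + P1 (s + t))" "psi2 (s + t) = - lam n * (4 * pi\<^sup>2 * lam n) * (S * cos (om n * t))"
        unfolding E by simp_all
      have "g2 (psi s) * lam n = (psi2 (s + t) * lam n - psi1 (s + t) * psi2 s) / (lam n * lam n)"
        using g2_psi[of s] eqs(1) by simp
      also have "\<dots> = 4 * pi\<^sup>2 * S * (1 + P1 (s + t) - cos (om n * t)) * lam n"
        unfolding eqs using lam_pos[of n] by (simp add: field_simps)
      finally show ?thesis using lam_pos[of n] by simp
    qed
    \<comment> \<open>The points sought are \<open>(k + \<sigma> / 4) / q n\<close> for
      \<open>\<sigma> = 1\<close> and \<open>\<sigma> = - 1\<close>. The added 1 leaves room for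
      \<open>\<sigma> = - 1\<close>, and \<open>q n \<ge> 4\<close> leaves room below
      \<open>s0 + 1\<close>.\<close>
    define k where "k = \<lceil>qr n * s0\<rceil> + 1"
    have point: "\<exists>s. s0 \<le> s \<and> s \<le> s0 + 1 \<and> om n * s = \<sigma> * (pi / 2) + 2 * pi * of_int k"
      if "\<bar>\<sigma>\<bar> \<le> 1" for \<sigma> :: real
    proof (intro exI conjI)
      define s where "s = (of_int k + \<sigma> / 4) / qr n"
      have "qr n * s0 + 1 \<le> of_int k" "of_int k \<le> qr n * s0 + 2"
        unfolding k_def by (simp_all add: le_of_int_ceiling, linarith)
      then have *: "qr n * s0 \<le> of_int k + \<sigma> / 4" "of_int k + \<sigma> / 4 \<le> qr n * s0 + qr n"
        using that q_ge(1)[of n] by linarith+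
      then show "s0 \<le> s" "s \<le> s0 + 1" using q_pos[of n] by (simp_all add: s_def field_simps)
      show "om n * s = \<sigma> * (pi / 2) + 2 * pi * of_int k"
        using q_pos[of n] by (simp add: om_def s_def field_simps)
    qed
    \<comment> \<open>With sine 1 and \<open>- 1\<close> this makes \<open>g2\<close> at least 1 and
      at most \<open>- 1\<close>; the two values cannot both be at distance less than 1 from
      \<open>g2 0\<close>.\<close>
    have big: "4 * pi\<^sup>2 * (1 + P1 r - cos (om n * t)) \<ge> 1" for r
    proof -
      have "1 / 2 \<le> 1 + P1 r - cos (om n * t)" using P1_le[of r] cos_t by (simp add: abs_le_iff)
      moreover have "1 * 1 \<le> pi * pi" using pi_gt3 by (intro mult_mono) auto
      ultimately have "4 * 1 * (1 / 2) \<le> 4 * pi\<^sup>2 * (1 + P1 r - cos (om n * t))"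
        by (intro mult_mono) (auto simp: power2_eq_square)
      then show ?thesis by simp
    qed
    obtain s1 where s1: "s0 \<le> s1" "s1 \<le> s0 + 1" "om n * s1 = 1 * (pi / 2) + 2 * pi * of_int k" using point[of 1] by auto
    obtain s2 where s2: "s0 \<le> s2" "s2 \<le> s0 + 1" "om n * s2 = - 1 * (pi / 2) + 2 * pi * of_int k" using point[of "- 1"] by auto
    have "g2 (psi s1) = 4 * pi\<^sup>2 * 1 * (1 + P1 (s1 + t) - cos (om n * t))"
      by (rule g2_val[OF s1(1,2)]) (simp_all only: s1(3) sin_add cos_add sin_int_2pin cos_int_2pin, simp_all)
    then have "g2 (psi s1) \<ge> 1" using big[of "s1 + t"] by simp
    moreover have "g2 (psi s2) = 4 * pi\<^sup>2 * (- 1) * (1 + P1 (s2 + t) - cos (om n * t))"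
      by (rule g2_val[OF s2(1,2)]) (simp_all only: s2(3) sin_add cos_add sin_int_2pin cos_int_2pin, simp_all)
    then have "g2 (psi s2) \<le> - 1" using big[of "s2 + t"] by simp
    moreover have "\<bar>g2 (psi s1) - g2 0\<bar> < 1" "\<bar>g2 (psi s2) - g2 0\<bar> < 1"
      using B s0(1) s1(2) s2(2) by auto
    ultimately show False by linarith
  qed
  then show ?thesis unfolding eventually_sequentially by blast
qed

end

lemma sum_half_powers_le_1: "finite S \<Longrightarrow> (\<Sum>m\<in>S. (1 / 2 :: real) ^ (m + 1)) \<le> 1"
proof -
  assume S: "finite S"
  have "(\<lambda>m. (1 / 2 :: real) ^ Suc m) sums 1" by (rule power_half_series)
  then show ?thesis
    using sum_le_suminf[of "\<lambda>m. (1 / 2 :: real) ^ Suc m" S] S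
    by (simp add: sums_iff)
qed

section \<open>The Cantor set of smooth times\<close>

locale Liouville_times =
  fixes \<alpha> :: real and p :: "nat \<Rightarrow> int" and q :: "nat \<Rightarrow> nat"
  assumes irrational: "\<alpha> \<notin> \<rat>" and coprime_pq: "\<And>n. coprime (p n) (int (q n))"
    and q_ge_4: "\<And>n. real (q n) \<ge> 4 ^ (n + 1)" and q_mono_Suc: "\<And>n. q n \<le> q (Suc n)"
    and approx: "\<And>n. \<bar>real (q n) * \<alpha> - of_int (p n)\<bar> \<le> 1 / real (q n) ^ ((n + 1)\<^sup>2 + 4)"
begin

abbreviation qr :: "nat \<Rightarrow> real" where "qr n \<equiv> real (q n)"

definition \<theta> :: "nat \<Rightarrow> real" where "\<theta> n = qr n * \<alpha> - of_int (p n)"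

definition sums_set :: "real set" where "sums_set = {\<alpha> + sum \<theta> S | S. finite S}"

abbreviation err :: "nat \<Rightarrow> real" where "err n \<equiv> 1 / qr n ^ (n + 1)\<^sup>2"

abbreviation K :: "real set" where "K \<equiv> closure sums_set"

lemma q_bounds: "qr n \<ge> 4" "m \<le> n \<Longrightarrow> qr n \<ge> 2 ^ (m + 1)" "qr n > 0"
proof -
  have "(4::real) ^ 1 \<le> 4 ^ (n + 1)" by (intro power_increasing) auto
  then show "qr n \<ge> 4" using q_ge_4[of n] by (simp only: power_one_right)
  then show "qr n > 0" by simp
  assume "m \<le> n"
  then have "(2::real) ^ (m + 1) \<le> 2 ^ (n + 1)" by (intro power_increasing) auto
  also have "\<dots> \<le> 4 ^ (n + 1)" by (intro power_mono) auto
  also have "\<dots> \<le> qr n" by (rule q_ge_4)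
  finally show "qr n \<ge> 2 ^ (m + 1)" .
qed

lemma theta_nz: "\<theta> n \<noteq> 0"
proof
  assume "\<theta> n = 0"
  then have "\<alpha> = of_int (p n) / of_nat (q n)" using q_bounds(3)[of n] by (simp add: \<theta>_def field_simps)
  then have "\<alpha> \<in> \<rat>" by simp
  with irrational show False by simp
qed

text \<open>Of the four spare powers in \<open>approx\<close>, one cancels the factor
  \<open>q n\<close> and the other three exceed \<open>4 * 2 ^ (m + 1)\<close>. The powers of
  \<open>1 / 2\<close> are there to be summed over \<open>m\<close>.\<close>

lemma theta_le:
  assumes "m \<le> n"
  shows "qr n * \<bar>\<theta> n\<bar> \<le> err n * (1 / 4 * (1 / 2) ^ (m + 1))"
proof -
  have "qr n * \<bar>\<theta> n\<bar> \<le> qr n * (1 / qr n ^ ((n + 1)\<^sup>2 + 4))"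
    unfolding \<theta>_def by (intro mult_left_mono approx) auto
  also have "\<dots> = err n * (1 / qr n ^ 3)"
    using q_bounds(3)[of n] by (simp add: power_add numeral_eq_Suc)
  also have "\<dots> \<le> err n * (1 / (4 * 2 ^ (m + 1)))"
  proof (intro mult_left_mono divide_left_mono mult_pos_pos zero_less_power q_bounds(3))
    have "4 * 2 ^ (m + 1) * 1 \<le> qr n * qr n * qr n"
      using q_bounds[of n] q_bounds(2)[OF assms] by (intro mult_mono) auto
    then show "4 * 2 ^ (m + 1) \<le> qr n ^ 3" by (simp add: power3_eq_cube)
  qed auto
  finally show ?thesis by (simp add: power_one_over)
qed

lemma q_mono: "m \<le> n \<Longrightarrow> q m \<le> q n"
  by (rule lift_Suc_mono_le[of q, OF q_mono_Suc])

text \<open>The integer \<open>q m * p n - q n * p m\<close> is the difference of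
  \<open>q n * \<theta> m\<close> and \<open>q m * \<theta> n\<close>. For \<open>m \<le> n\<close>
  this trades \<open>\<theta> m\<close> for the much smaller \<open>\<theta> n\<close>; for
  \<open>m > n\<close> already \<open>q n * \<theta> m\<close> is small.\<close>

lemma theta_near:
  "\<exists>k::int. \<bar>qr n * \<theta> m - of_int k\<bar> \<le> err n * (1 / 4 * (1 / 2) ^ (m + 1))"
proof (cases "m \<le> n")
  case True
  have "qr n * \<theta> m - of_int (int (q m) * p n - int (q n) * p m) = qr m * \<theta> n"
    by (simp add: \<theta>_def algebra_simps)
  moreover have "\<bar>qr m * \<theta> n\<bar> \<le> qr n * \<bar>\<theta> n\<bar>"
    unfolding abs_mult using q_mono[OF True] by (intro mult_right_mono) auto
  ultimately show ?thesis using theta_le[OF True] by (metis order_trans)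
next
  case False
  then have nm: "n \<le> m" by simp
  have "\<bar>qr n * \<theta> m - of_int 0\<bar> \<le> qr m * \<bar>\<theta> m\<bar>"
    unfolding of_int_0 diff_zero abs_mult using q_mono[OF nm] by (intro mult_right_mono) auto
  also have "\<dots> \<le> err m * (1 / 4 * (1 / 2) ^ (m + 1))" by (rule theta_le) simp
  also have "\<dots> \<le> err n * (1 / 4 * (1 / 2) ^ (m + 1))"
  proof (intro mult_right_mono divide_left_mono mult_pos_pos zero_less_power q_bounds(3))
    have "qr n ^ (n + 1)\<^sup>2 \<le> qr m ^ (n + 1)\<^sup>2"
      using q_mono[OF nm] by (intro power_mono) auto
    also have "\<dots> \<le> qr m ^ (m + 1)\<^sup>2"
      using nm q_bounds(1)[of m] by (intro power_increasing power_mono) auto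
    finally show "qr n ^ (n + 1)\<^sup>2 \<le> qr m ^ (m + 1)\<^sup>2" .
  qed auto
  finally show ?thesis by blast
qed

text \<open>A quarter of the allowed error goes to the sum and a quarter to
  \<open>q n * \<alpha>\<close>. The remaining half is reserved for the passage to the
  closure.\<close>

lemma sums_near:
  assumes "t \<in> sums_set"
  shows "\<exists>k::int. \<bar>qr n * t - of_int k\<bar> \<le> err n * (1 / 2)"
proof -
  define e where "e = err n"
  have e: "e > 0" using q_bounds(3)[of n] by (simp add: e_def)
  obtain S where S: "finite S" "t = \<alpha> + sum \<theta> S" using assms by (auto simp: sums_set_def)
  obtain k where k: "\<And>m. \<bar>qr n * \<theta> m - of_int (k m)\<bar> \<le> e * (1 / 4 * (1 / 2) ^ (m + 1))"
    using theta_near[of n] unfolding e_def by metis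
  have "\<bar>qr n * sum \<theta> S - of_int (sum k S)\<bar> = \<bar>\<Sum>m\<in>S. qr n * \<theta> m - of_int (k m)\<bar>"
    by (simp add: sum_distrib_left sum_subtractf)
  also have "\<dots> \<le> (\<Sum>m\<in>S. \<bar>qr n * \<theta> m - of_int (k m)\<bar>)" by (rule sum_abs)
  also have "\<dots> \<le> (\<Sum>m\<in>S. e * (1 / 4) * (1 / 2) ^ (m + 1))"
    by (intro sum_mono) (use k in \<open>simp add: mult.assoc\<close>)
  also have "\<dots> = e * (1 / 4) * (\<Sum>m\<in>S. (1 / 2) ^ (m + 1))" by (simp add: sum_distrib_left)
  also have "\<dots> \<le> e * (1 / 4) * 1" using e sum_half_powers_le_1[OF S(1)] by (intro mult_left_mono) auto
  finally have 1: "\<bar>qr n * sum \<theta> S - of_int (sum k S)\<bar> \<le> e * (1 / 4)" by simp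
  have "1 * \<bar>\<theta> n\<bar> \<le> qr n * \<bar>\<theta> n\<bar>" using q_bounds(1)[of n] by (intro mult_right_mono) auto
  also have "\<dots> \<le> e * (1 / 4 * (1 / 2) ^ (0 + 1))" unfolding e_def by (rule theta_le) simp
  finally have 2: "\<bar>\<theta> n\<bar> \<le> e * (1 / 4)" using e by simp
  have "qr n * t - of_int (p n + sum k S) = \<theta> n + (qr n * sum \<theta> S - of_int (sum k S))"
    by (simp add: S(2) \<theta>_def algebra_simps)
  then have "\<bar>qr n * t - of_int (p n + sum k S)\<bar> \<le> e * (1 / 2)" using 1 2 by linarith
  then show ?thesis unfolding e_def by blast
qed

lemma closure_near:
  assumes "t \<in> K"
  shows "\<exists>k::int. \<bar>qr n * t - of_int k\<bar> \<le> err n"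
proof -
  define e where "e = err n"
  have e: "e > 0" using q_bounds(3)[of n] by (simp add: e_def)
  have "e / 2 / qr n > 0" using e q_bounds(3)[of n] by simp
  with assms obtain t' where t': "t' \<in> sums_set" "dist t' t < e / 2 / qr n"
    unfolding closure_approachable by blast
  obtain k :: int where k: "\<bar>qr n * t' - of_int k\<bar> \<le> e * (1 / 2)"
    using sums_near[OF t'(1), of n] unfolding e_def by blast
  have "qr n * \<bar>t' - t\<bar> \<le> e / 2"
    using t'(2) q_bounds(3)[of n] by (simp add: dist_real_def field_simps)
  then have "\<bar>qr n * t' - qr n * t\<bar> \<le> e / 2"
    by (simp add: abs_mult right_diff_distrib[symmetric])
  with k have "\<bar>qr n * t - of_int k\<bar> \<le> e" by linarith
  then show ?thesis unfolding e_def by blast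
qed

lemma theta_small: "\<bar>\<theta> n\<bar> \<le> (1 / 2) ^ (n + 1)"
proof -
  have "1 * \<bar>\<theta> n\<bar> \<le> qr n * \<bar>\<theta> n\<bar>" using q_bounds(1)[of n] by (intro mult_right_mono) auto
  also have "\<dots> \<le> err n * (1 / 4 * (1 / 2) ^ (n + 1))" by (rule theta_le) simp
  also have "\<dots> \<le> 1 * (1 * (1 / 2) ^ (n + 1))"
    using q_bounds(1)[of n] by (intro mult_mono mult_right_mono) auto
  finally show ?thesis by simp
qed

text \<open>Add one more \<open>\<theta> m\<close> with large \<open>m\<close> outside
  \<open>S\<close>; it is small, and nonzero by irrationality.\<close>

lemma sums_set_limit_point: assumes "t \<in> sums_set" shows "t islimpt sums_set"
  unfolding islimpt_approachable
proof (intro allI impI)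
  fix e :: real assume e: "e > 0"
  obtain S where S: "finite S" "t = \<alpha> + sum \<theta> S" using assms by (auto simp: sums_set_def)
  obtain N where N: "(1 / 2 :: real) ^ N < e" using real_arch_pow_inv[OF e, of "1 / 2"] by auto
  obtain m where m: "m \<ge> N" "m \<notin> S"
    using S(1) by (metis finite_nat_set_iff_bounded_le le_cases Suc_n_not_le_n le_SucI)
  have "\<bar>\<theta> m\<bar> \<le> (1 / 2) ^ (m + 1)" by (rule theta_small)
  also have "\<dots> \<le> (1 / 2) ^ N" using m(1) by (intro power_decreasing) auto
  finally have "\<bar>\<theta> m\<bar> < e" using N by linarith
  moreover have "\<alpha> + sum \<theta> (insert m S) \<in> sums_set" using S(1) unfolding sums_set_def by blast
  moreover have "\<alpha> + sum \<theta> (insert m S) = t + \<theta> m" using S m(2) by simp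
  ultimately show "\<exists>x'\<in>sums_set. x' \<noteq> t \<and> dist x' t < e"
    using theta_nz[of m] by (intro bexI[of _ "t + \<theta> m"]) (auto simp: dist_real_def)
qed

text \<open>The set is totally disconnected because an interval of length at least
  \<open>2 / q n\<close> contains a \<open>t\<close> for which \<open>q n * t\<close> lies halfway
  between two integers, while \<open>closure_near\<close> puts \<open>q n * t\<close> within
  \<open>1 / 4\<close> of an integer. It is bounded since every finite sum of terms
  \<open>\<bar>\<theta> m\<bar>\<close> is at most 1.\<close>

lemma cantor_set_closure: "cantor_set K"
  unfolding cantor_set_def
proof (intro conjI ballI)
  have "\<alpha> + sum \<theta> {} \<in> sums_set" unfolding sums_set_def by blast
  then show "K \<noteq> {}" using closure_subset by blast
  have "bounded sums_set"
    unfolding bounded_iff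
  proof (intro exI[of _ "\<bar>\<alpha>\<bar> + 1"] ballI)
    fix t assume "t \<in> sums_set"
    then obtain S where S: "finite S" "t = \<alpha> + sum \<theta> S" by (auto simp: sums_set_def)
    have "\<bar>sum \<theta> S\<bar> \<le> (\<Sum>m\<in>S. (1 / 2) ^ (m + 1))"
      by (rule order_trans[OF sum_abs sum_mono[OF theta_small]])
    also have "\<dots> \<le> 1" by (rule sum_half_powers_le_1[OF S(1)])
    finally show "norm t \<le> \<bar>\<alpha>\<bar> + 1" using S(2) by simp
  qed
  then show "compact K" by simp
next
  fix x assume "x \<in> K"
  then have "x islimpt sums_set" using sums_set_limit_point by (auto simp: closure_def)
  then show "x islimpt K" using closure_subset by (rule islimpt_subset)
next
  fix x assume x: "x \<in> K"
  have no_interval: False if ab: "a < b" "{a..b} \<subseteq> K" for a b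
  proof -
    obtain n where "2 / (b - a) < real n" using reals_Archimedean2 by blast
    moreover have "real n < 2 ^ n" by (rule of_nat_less_two_power)
    moreover have "(2::real) ^ n \<le> 2 ^ (n + 1)" by (intro power_increasing) auto
    ultimately have "2 / (b - a) \<le> qr n" using q_bounds(2)[of n n] by linarith
    then have len: "2 \<le> qr n * b - qr n * a"
      using ab(1) by (simp add: field_simps)
    define k where "k = \<lceil>qr n * a\<rceil>"
    have k: "qr n * a \<le> of_int k" "of_int k \<le> qr n * a + 1"
      unfolding k_def by linarith+
    define t where "t = (of_int k + 1 / 2) / qr n"
    have qt: "qr n * t = of_int k + 1 / 2" using q_bounds(3)[of n] by (simp add: t_def)
    have "qr n * a \<le> qr n * t" "qr n * t \<le> qr n * b"
      unfolding qt using k len by linarith+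
    then have "t \<in> {a..b}" using q_bounds(3)[of n] by simp
    then obtain m :: int where m: "\<bar>qr n * t - of_int m\<bar> \<le> err n"
      using ab(2) closure_near[of t n] by blast
    have "qr n ^ 1 \<le> qr n ^ (n + 1)\<^sup>2"
      using q_bounds(1)[of n] by (intro power_increasing) auto
    then have "4 \<le> qr n ^ (n + 1)\<^sup>2" using q_bounds(1)[of n] unfolding power_one_right by linarith
    then have "err n \<le> 1 / 4"
      using q_bounds(3)[of n] by (intro divide_left_mono mult_pos_pos) auto
    then have "\<bar>real_of_int k + 1 / 2 - of_int m\<bar> \<le> 1 / 4" using m unfolding qt by linarith
    then have "\<bar>real_of_int (k - m) + 1 / 2\<bar> \<le> 1 / 4" by (simp add: algebra_simps)
    then have "real_of_int (k - m) < of_int 0" "of_int (- 1) < real_of_int (k - m)"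
      by (simp_all only: abs_le_iff of_int_0 of_int_minus of_int_1) linarith+
    then show False unfolding of_int_less_iff by linarith
  qed
  show "connected_component_set K x = {x}"
  proof (intro equalityI subsetI)
    fix y assume y: "y \<in> connected_component_set K x"
    have xC: "x \<in> connected_component_set K x" using x by simp
    have "{min x y..max x y} \<subseteq> connected_component_set K x"
      by (rule connected_contains_Icc[OF connected_connected_component]) (use xC y in \<open>auto simp: min_def max_def\<close>)
    also have "\<dots> \<subseteq> K" by (rule connected_component_subset)
    finally have "\<not> min x y < max x y" using no_interval by blast
    then show "y \<in> {x}" by (auto simp: min_def max_def split: if_splits)
  qed (use x in simp)
qed

lemma alpha_in_closure: "\<alpha> \<in> K"
proof -
  have "\<alpha> + sum \<theta> {} \<in> sums_set" unfolding sums_set_def by blast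
  then show ?thesis using closure_subset[of sums_set] by auto
qed

text \<open>For odd \<open>q n\<close> the first cosine is \<open>- 1\<close>. For even
  \<open>q n\<close> the coprime \<open>p n\<close> is odd, and
  \<open>pi * q n * \<alpha> = pi * p n + pi * \<theta> n\<close> makes the second cosine equal to
  \<open>- cos (pi * \<theta> n)\<close>, with
  \<open>\<bar>\<theta> n\<bar> \<le> 1 / 2\<close>.\<close>

lemma cos_nonpos:
  "cos (2 * pi * qr n * (1 / 2)) \<le> 0 \<or> cos (2 * pi * qr n * (\<alpha> / 2)) \<le> 0"
proof (cases "even (q n)")
  case False
  have "cos (2 * pi * qr n * (1 / 2)) = cos (qr n * pi)" by (simp add: mult.commute)
  also have "\<dots> = (- 1) ^ q n" by (rule cos_npi)
  finally show ?thesis using False by simp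
next
  case True
  have "odd (p n)"
  proof
    assume "even (p n)"
    with True have "(2::int) dvd 1"
      using coprime_common_divisor[OF coprime_pq[of n], of 2] by simp
    then show False by simp
  qed
  then obtain j where j: "p n = 2 * j + 1" by (rule oddE)
  have "\<bar>\<theta> n\<bar> \<le> (1 / 2) ^ (n + 1)" by (rule theta_small)
  also have "\<dots> \<le> (1 / 2) ^ 1" by (intro power_decreasing) auto
  finally have th: "\<bar>\<theta> n\<bar> \<le> 1 / 2" by simp
  have z: "\<bar>pi * \<theta> n\<bar> \<le> pi / 2"
    using mult_left_mono[OF th, of pi] by (simp add: abs_mult)
  have c: "cos (pi * \<theta> n) \<ge> 0"
    by (rule cos_ge_zero) (use abs_le_D1[OF z] abs_le_D2[OF z] in linarith)+
  have "2 * pi * qr n * (\<alpha> / 2) = 2 * pi * of_int j + (pi + pi * \<theta> n)"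
    by (simp add: \<theta>_def j algebra_simps)
  then have "cos (2 * pi * qr n * (\<alpha> / 2)) = cos (pi + pi * \<theta> n)"
    by (simp only: cos_add[of "2 * pi * of_int j"] sin_int_2pin cos_int_2pin)
  also have "\<dots> = - cos (pi * \<theta> n)" by (simp add: cos_add)
  finally show ?thesis using c by simp
qed

end

section \<open>Choice of the constants and assembly\<close>

theorem theorem1:
  fixes \<alpha> :: real
  assumes "Liouville \<alpha>"
  shows "\<exists>(f :: real \<Rightarrow> real) (K :: real set).
           f \<in> Diff \<infinity> \<and>
           (\<forall>x\<ge>0. f x = x \<longleftrightarrow> x = 0) \<and>
           szekeres_flow f \<in> iso real_group (centralizer_group 1 f) \<and>
           cantor_set K \<and> \<alpha> \<in> K \<and>
           (\<forall>r::enat. 2 \<le> r \<longrightarrow>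
              subgroup (centralizer r f) (centralizer_group 1 f) \<and>
              centralizer r f \<noteq> centralizer 1 f \<and>
              K \<subseteq> centralizer_times r f)"
proof -
  obtain st :: "real \<Rightarrow> real" where st: "\<And>n. Cn_on n st UNIV" "\<And>u. u \<le> 0 \<Longrightarrow> st u = 0"
    "\<And>u. u \<ge> 1 / 2 \<Longrightarrow> st u = 1" "\<And>u. 0 \<le> st u" "\<And>u. st u \<le> 1"
    by (rule smooth_step_exists, rule that)
  obtain st' where st': "\<And>x. x \<in> UNIV \<Longrightarrow> (st has_real_derivative st' x) (at x within UNIV)" "continuous_on UNIV st'"
    by (rule Cn_on_1E[OF st(1)], rule that)
  \<comment> \<open>This interval contains all values of
    \<open>cos (2 * pi * y) + 1 / 2\<close>.\<close>
  have "bounded (st' ` {-2..2})"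
    using st'(2) by (intro compact_imp_bounded compact_continuous_image) (auto intro: continuous_on_subset)
  then obtain C where C: "\<And>x. x \<in> {-2..2} \<Longrightarrow> \<bar>st' x\<bar> \<le> C" unfolding bounded_real by blast
  define M where "M = C * (2 * pi)"
  have C0: "C \<ge> 0" using C[of 0] by simp
  have deriv_le: "\<bar>d\<bar> \<le> M" if d: "DERIV (\<lambda>y. st (cos (2 * pi * y) + 1 / 2)) y :> d" for y d
  proof -
    have "DERIV (\<lambda>y. cos (2 * pi * y) + 1 / 2) y :> - sin (2 * pi * y) * (2 * pi)"
      by (auto intro!: derivative_eq_intros)
    from DERIV_chain2[of st, OF _ this] st'(1)
    have "DERIV (\<lambda>y. st (cos (2 * pi * y) + 1 / 2)) y :> st' (cos (2 * pi * y) + 1 / 2) * (- sin (2 * pi * y) * (2 * pi))" by simp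
    with d have "d = st' (cos (2 * pi * y) + 1 / 2) * (- sin (2 * pi * y) * (2 * pi))" by (rule DERIV_unique)
    then have "\<bar>d\<bar> = \<bar>st' (cos (2 * pi * y) + 1 / 2)\<bar> * \<bar>- sin (2 * pi * y) * (2 * pi)\<bar>"
      by (simp only: abs_mult)
    also have "\<dots> \<le> C * (2 * pi)"
    proof (rule mult_mono)
      show "\<bar>st' (cos (2 * pi * y) + 1 / 2)\<bar> \<le> C"
        using cos_ge_minus_one[of "2 * pi * y"] cos_le_one[of "2 * pi * y"]
        by (intro C) (simp only: atLeastAtMost_iff, linarith)
      show "\<bar>- sin (2 * pi * y) * (2 * pi)\<bar> \<le> 2 * pi" by (simp add: abs_mult)
    qed (use C0 in auto)
    finally show ?thesis by (simp only: M_def)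
  qed
  obtain p q where pq: "\<And>n. coprime (p n) (int (q n))" "\<And>n. real (q n) \<ge> 4 ^ (n + 1)"
    "\<And>n. real (q n) \<ge> 4 * M + 32" "\<And>n. q n \<le> q (Suc n)"
    "\<And>n. \<bar>real (q n) * \<alpha> - of_int (p n)\<bar> \<le> 1 / real (q n) ^ ((n + 1)\<^sup>2 + 4)"
    by (rule Liouville_sequence[OF assms], rule that)
  interpret oscillating_field st q M
    by standard (use st deriv_le pq C0 in \<open>auto simp: M_def\<close>)
  obtain psi0 where psi0: "\<And>s. psi0 s > 0" "\<And>s. DERIV psi0 s :> nu0 (psi0 s)"
    "(psi0 \<longlongrightarrow> 0) at_bot" "filterlim psi0 at_top at_top"
    by (rule base_coordinate_exists, rule that)
  interpret oscillating_flow st q M psi0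
    by standard (use psi0 in auto)
  interpret K: Liouville_times \<alpha> p q
    by standard (use assms pq in \<open>auto simp: Liouville_def\<close>)
  define f where "f = pert.fl 1"
  have K_times: "K.K \<subseteq> times"
    unfolding times_def eta_def using K.closure_near by blast
  \<comment> \<open>Equality would make the time-\<open>1 / 2\<close> and the
    time-\<open>\<alpha> / 2\<close> maps C2, so both cosines in \<open>K.cos_nonpos\<close> would
    be positive for all large \<open>n\<close>.\<close>
  have proper: "centralizer r f \<noteq> centralizer 1 f" if r: "2 \<le> r" for r :: enat
  proof
    assume "centralizer r f = centralizer 1 f"
    then have "pert.fl t \<in> Diff r" for t
      using pert.centralizer_1_eq pert.fl_centralizer_iff unfolding f_def by blast
    moreover have "enat 2 \<le> r" using r by (simp add: numeral_eq_enat)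
    ultimately have "Cn_on 2 (pert.fl t) {0..}" for t unfolding pert.fl_Diff_iff Cr_on_def by blast
    then have ev: "\<forall>\<^sub>F n in sequentially. cos (om n * t) > 0" for t by (rule C2_imp_cos_pos)
    have "\<forall>\<^sub>F n in sequentially. False"
      using ev[of "1 / 2"] ev[of "\<alpha> / 2"]
    proof eventually_elim
      case (elim n)
      then show False using K.cos_nonpos[of n] unfolding om_def by linarith
    qed
    then show False by simp
  qed
  show ?thesis
  proof (intro exI[of _ f] exI[of _ "K.K"] conjI allI impI)
    show "f \<in> Diff \<infinity>" unfolding f_def by (rule times_imp_Diff[OF one_in_times])
    show "f x = x \<longleftrightarrow> x = 0" if "x \<ge> 0" for x
      using that unfolding f_def by (cases rule: pert.half_line_cases) (use pert.pos in \<open>auto simp: less_le\<close>)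
    show "szekeres_flow f \<in> iso real_group (centralizer_group 1 f)"
      unfolding f_def pert.szekeres_flow_eq by (rule pert.fl_iso)
    show "cantor_set K.K" by (rule K.cantor_set_closure)
    show "\<alpha> \<in> K.K" by (rule K.alpha_in_closure)
    fix r :: enat assume r: "2 \<le> r"
    have "(1::enat) \<le> 2" by (simp add: one_enat_def numeral_eq_enat)
    then have "1 \<le> r" using r by (rule order_trans)
    then show "subgroup (centralizer r f) (centralizer_group 1 f)"
      unfolding f_def by (rule pert.centralizer_subgroup)
    show "centralizer r f \<noteq> centralizer 1 f" by (rule proper[OF r])
    show "K.K \<subseteq> centralizer_times r f"
      unfolding f_def pert.centralizer_times_eq using K_times times_imp_Diff by blast
  qed
qed

end
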